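(* Let $G$ be a commutative reductive complex Lie group and let $X$ be a complex $G$-manifold. Assume that there are characters $\chi_1,\dots,\chi_n$ of $G$ such that finitely many complete elements of the spaces $\mathscr A(X)_{\chi_j}$, $j=1,\dots,n$, span the tangent space of $X$ at every point. Then $X$ is $G$-elliptic.
   Context: A complex $G$-manifold is a complex manifold with a holomorphic action of $G$ by biholomorphisms. $\mathscr A(X)$ denotes the holomorphic vector fields on $X$. $G$ acts on $\mathscr A(X)$ by $(g_*\xi)(x)=Dg|_{g^{-1}x}(\xi(g^{-1}x))$. For a character $\chi$ of $G$ (a holomorphic homomorphism $G\to\mathbb C^*$), $\mathscr A(X)_\chi$ is the set of $\xi\in\mathscr A(X)$ with $g_*\xi=\chi(g)\xi$ for all $g\in G$. A holomorphic vector field is complete if its flow exists for all complex time. A spray on $X$ is a holomorphic map $s:E\to X$ defined on the total space of a holomorphic vector bundle $E$ on $X$ such that $s(0_x)=x$ for all $x\in X$; it is dominating if $s|_{E_x}:E_x\to X$ is a submersion at $0_x$ for all $x\in X$. It is a $G$-spray if the action on $X$ lifts to a holomorphic action on $E$ by vector bundle isomorphisms such that both $s$ and the projection $E\to X$ are $G$-equivariant. $X$ is $G$-elliptic if it carries a dominating $G$-spray. *)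

theory Defs
  imports "HOL-Analysis.Analysis" "HOL-Algebra.Group_Action"
begin

section \<open>Holomorphic maps between open subsets of \<open>\<complex>\<^sup>n\<close>\<close>

text \<open>As in the library's \<^const>\<open>Euclidean_space\<close>, a vector of \<open>\<complex>\<^sup>n\<close> is a sequence that vanishes from
  index \<open>n\<close> on. The dimension is thus a natural number that may be \<open>0\<close> and may be quantified inside
  a formula, as is needed for the rank of a vector bundle.\<close>

definition cspace :: "nat \<Rightarrow> (nat \<Rightarrow> complex) set" where
  "cspace n = {z. \<forall>i\<ge>n. z i = 0}"

definition cEuclidean_space :: "nat \<Rightarrow> (nat \<Rightarrow> complex) topology" where
  "cEuclidean_space n = top_of_set (cspace n)"

text \<open>Complex (Frechet) differentiability at every point. The domain \<open>U\<close> is meant to be open in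
  \<open>\<complex>\<^sup>n\<close>, not in the type \<^typ>\<open>nat \<Rightarrow> complex\<close>. For \<open>n = 0\<close> the limit is taken along the trivial
  filter and every function is holomorphic.\<close>

definition cholomorphic_on :: "nat \<Rightarrow> (nat \<Rightarrow> complex) set \<Rightarrow> ((nat \<Rightarrow> complex) \<Rightarrow> complex) \<Rightarrow> bool" where
  "cholomorphic_on n U f \<longleftrightarrow>
     (\<forall>a\<in>U. \<exists>c :: nat \<Rightarrow> complex.
        ((\<lambda>z. (f z - f a - (\<Sum>i<n. c i * (z i - a i))) / of_real (\<Sum>i<n. norm (z i - a i)))
           \<longlongrightarrow> 0) (at a within U))"

text \<open>The derivative of \<open>f\<close> at a point \<open>a\<close> of \<open>\<complex>\<^sup>n\<close>, given by the Jacobian matrix of partial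
  derivatives; it depends only on the values of \<open>f\<close> on \<open>\<complex>\<^sup>n\<close> near \<open>a\<close>.\<close>

definition cjacobian ::
    "nat \<Rightarrow> ((nat \<Rightarrow> complex) \<Rightarrow> (nat \<Rightarrow> complex)) \<Rightarrow> (nat \<Rightarrow> complex) \<Rightarrow> (nat \<Rightarrow> complex) \<Rightarrow> (nat \<Rightarrow> complex)" where
  "cjacobian n f a v = (\<lambda>j. \<Sum>i<n. deriv (\<lambda>t. f (a(i := t)) j) (a i) * v i)"


section \<open>Complex manifolds\<close>

text \<open>A chart \<open>(U, \<phi>)\<close> consists of its domain and its coordinate map; the values of \<open>\<phi>\<close> outside
  \<open>U\<close> are irrelevant.\<close>

type_synonym 'a chart = "'a set \<times> ('a \<Rightarrow> nat \<Rightarrow> complex)"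

record 'a cmfd =
  mtop :: "'a topology"
  mdim :: nat
  atlas :: "'a chart set"

abbreviation points :: "'a cmfd \<Rightarrow> 'a set" where
  "points M \<equiv> topspace (mtop M)"

definition charts_at :: "'a cmfd \<Rightarrow> 'a \<Rightarrow> 'a chart set" where
  "charts_at M p = {c \<in> atlas M. p \<in> fst c}"

definition chart_inv :: "'a chart \<Rightarrow> (nat \<Rightarrow> complex) \<Rightarrow> 'a" where
  "chart_inv c = inv_into (fst c) (snd c)"

definition is_chart :: "'a topology \<Rightarrow> nat \<Rightarrow> 'a chart \<Rightarrow> bool" where
  "is_chart T n c \<longleftrightarrow>
     openin T (fst c) \<and> openin (cEuclidean_space n) (snd c ` fst c) \<and>
     homeomorphic_map (subtopology T (fst c)) (subtopology (cEuclidean_space n) (snd c ` fst c)) (snd c)"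

definition complex_manifold :: "'a cmfd \<Rightarrow> bool" where
  "complex_manifold M \<longleftrightarrow>
     Hausdorff_space (mtop M) \<and> second_countable (mtop M) \<and>
     (\<forall>c\<in>atlas M. is_chart (mtop M) (mdim M) c) \<and>
     (\<Union>c\<in>atlas M. fst c) = points M \<and>
     (\<forall>c\<in>atlas M. \<forall>d\<in>atlas M. \<forall>j.
        cholomorphic_on (mdim M) (snd c ` (fst c \<inter> fst d)) (\<lambda>z. snd d (chart_inv c z) j))"

definition holomorphic_map :: "'a cmfd \<Rightarrow> 'b cmfd \<Rightarrow> ('a \<Rightarrow> 'b) \<Rightarrow> bool" where
  "holomorphic_map M N f \<longleftrightarrow>
     continuous_map (mtop M) (mtop N) f \<and>
     (\<forall>c\<in>atlas M. \<forall>d\<in>atlas N. \<forall>j.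
        cholomorphic_on (mdim M) (snd c ` {x \<in> fst c. f x \<in> fst d}) (\<lambda>z. snd d (f (chart_inv c z)) j))"

definition biholomorphic_map :: "'a cmfd \<Rightarrow> 'b cmfd \<Rightarrow> ('a \<Rightarrow> 'b) \<Rightarrow> bool" where
  "biholomorphic_map M N f \<longleftrightarrow>
     bij_betw f (points M) (points N) \<and> holomorphic_map M N f \<and>
     holomorphic_map N M (inv_into (points M) f)"

definition holomorphic_function :: "'a cmfd \<Rightarrow> ('a \<Rightarrow> complex) \<Rightarrow> bool" where
  "holomorphic_function M f \<longleftrightarrow>
     (\<forall>c\<in>atlas M. cholomorphic_on (mdim M) (snd c ` fst c) (\<lambda>z. f (chart_inv c z)))"

definition cspace_manifold :: "nat \<Rightarrow> (nat \<Rightarrow> complex) cmfd" where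
  "cspace_manifold n = \<lparr>mtop = cEuclidean_space n, mdim = n, atlas = {(cspace n, id)}\<rparr>"

definition open_submanifold :: "'a cmfd \<Rightarrow> 'a set \<Rightarrow> 'a cmfd" where
  "open_submanifold M U =
     \<lparr>mtop = subtopology (mtop M) U, mdim = mdim M, atlas = (\<lambda>(V, \<phi>). (V \<inter> U, \<phi>)) ` atlas M\<rparr>"

definition product_manifold :: "'a cmfd \<Rightarrow> 'b cmfd \<Rightarrow> ('a \<times> 'b) cmfd" where
  "product_manifold M N =
     \<lparr>mtop = prod_topology (mtop M) (mtop N), mdim = mdim M + mdim N,
      atlas = {(U \<times> V, \<lambda>(x, y) i. if i < mdim M then \<phi> x i else \<psi> y (i - mdim M)) |U \<phi> V \<psi>.
                 (U, \<phi>) \<in> atlas M \<and> (V, \<psi>) \<in> atlas N}\<rparr>"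


section \<open>Tangent vectors and differentials\<close>

text \<open>A tangent vector at \<open>p\<close> is a family of coordinate vectors, one for each chart around \<open>p\<close>, that
  transforms by the Jacobian matrices of the transition maps (with the dummy value \<open>0\<close> at all other
  arguments). The vector space operations are pointwise.\<close>

type_synonym 'a tangent = "'a chart \<Rightarrow> nat \<Rightarrow> complex"

definition tangent_space :: "'a cmfd \<Rightarrow> 'a \<Rightarrow> 'a tangent set" where
  "tangent_space M p =
     {v. (\<forall>c. c \<notin> charts_at M p \<longrightarrow> v c = (\<lambda>i. 0)) \<and>
         (\<forall>c\<in>charts_at M p. v c \<in> cspace (mdim M)) \<and>
         (\<forall>c\<in>charts_at M p. \<forall>d\<in>charts_at M p.
            v d = cjacobian (mdim M) (\<lambda>z. snd d (chart_inv c z)) (snd c p) (v c))}"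

text \<open>By the chain rule the choice of the chart \<open>c\<close> around \<open>p\<close> is immaterial on
  \<^const>\<open>tangent_space\<close>.\<close>

definition differential :: "'a cmfd \<Rightarrow> 'b cmfd \<Rightarrow> ('a \<Rightarrow> 'b) \<Rightarrow> 'a \<Rightarrow> 'a tangent \<Rightarrow> 'b tangent" where
  "differential M N f p v =
     (let c = (SOME c. c \<in> charts_at M p) in
      (\<lambda>d. if d \<in> charts_at N (f p)
            then cjacobian (mdim M) (\<lambda>z. snd d (f (chart_inv c z))) (snd c p) (v c)
            else (\<lambda>i. 0)))"

definition submersion_at :: "'a cmfd \<Rightarrow> 'b cmfd \<Rightarrow> ('a \<Rightarrow> 'b) \<Rightarrow> 'a \<Rightarrow> bool" where
  "submersion_at M N f p \<longleftrightarrow> differential M N f p ` tangent_space M p = tangent_space N (f p)"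


section \<open>Holomorphic vector fields\<close>

type_synonym 'a vfield = "'a \<Rightarrow> 'a tangent"

definition holomorphic_vfields :: "'a cmfd \<Rightarrow> 'a vfield set" where
  "holomorphic_vfields X =
     {\<xi> \<in> (\<Pi>\<^sub>E x\<in>points X. tangent_space X x).
        \<forall>c\<in>atlas X. \<forall>j. cholomorphic_on (mdim X) (snd c ` fst c) (\<lambda>z. \<xi> (chart_inv c z) c j)}"

definition integral_curve :: "'a cmfd \<Rightarrow> 'a vfield \<Rightarrow> (complex \<Rightarrow> 'a) \<Rightarrow> bool" where
  "integral_curve X \<xi> \<gamma> \<longleftrightarrow>
     continuous_map euclidean (mtop X) \<gamma> \<and>
     (\<forall>t. \<forall>c\<in>charts_at X (\<gamma> t). \<forall>i<mdim X.
        ((\<lambda>s. snd c (\<gamma> s) i) has_field_derivative \<xi> (\<gamma> t) c i) (at t))"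

text \<open>The flow exists for all complex time. Joint holomorphy of the flow is not demanded, since it
  follows from the theory of ordinary differential equations.\<close>

definition complete_vfield :: "'a cmfd \<Rightarrow> 'a vfield \<Rightarrow> bool" where
  "complete_vfield X \<xi> \<longleftrightarrow>
     (\<exists>\<Phi>. \<forall>x\<in>points X. \<Phi> 0 x = x \<and> integral_curve X \<xi> (\<lambda>t. \<Phi> t x))"

definition spans_tangent_space :: "'a cmfd \<Rightarrow> 'a vfield set \<Rightarrow> 'a \<Rightarrow> bool" where
  "spans_tangent_space X F x \<longleftrightarrow>
     tangent_space X x = {(\<lambda>c i. \<Sum>\<xi>\<in>F. a \<xi> * \<xi> x c i) |a :: 'a vfield \<Rightarrow> complex. True}"


section \<open>Complex Lie groups\<close>

record 'g clie_group = "'g monoid" +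
  gmfd :: "'g cmfd"

definition complex_lie_group :: "'g clie_group \<Rightarrow> bool" where
  "complex_lie_group G \<longleftrightarrow>
     group G \<and> complex_manifold (gmfd G) \<and> points (gmfd G) = carrier G \<and>
     holomorphic_map (product_manifold (gmfd G) (gmfd G)) (gmfd G) (\<lambda>(g, h). g \<otimes>\<^bsub>G\<^esub> h) \<and>
     holomorphic_map (gmfd G) (gmfd G) (\<lambda>g. inv\<^bsub>G\<^esub> g)"

definition clinear_on :: "nat \<Rightarrow> ((nat \<Rightarrow> complex) \<Rightarrow> (nat \<Rightarrow> complex)) \<Rightarrow> bool" where
  "clinear_on n L \<longleftrightarrow>
     (\<forall>v\<in>cspace n. \<forall>w\<in>cspace n. L (\<lambda>i. v i + w i) = (\<lambda>i. L v i + L w i)) \<and>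
     (\<forall>a. \<forall>v\<in>cspace n. L (\<lambda>i. a * v i) = (\<lambda>i. a * L v i))"

definition csubspace_of :: "nat \<Rightarrow> (nat \<Rightarrow> complex) set \<Rightarrow> bool" where
  "csubspace_of n W \<longleftrightarrow>
     W \<subseteq> cspace n \<and> (\<lambda>i. 0) \<in> W \<and>
     (\<forall>v\<in>W. \<forall>w\<in>W. (\<lambda>i. v i + w i) \<in> W) \<and> (\<forall>a. \<forall>v\<in>W. (\<lambda>i. a * v i) \<in> W)"

definition holomorphic_rep ::
    "'g clie_group \<Rightarrow> nat \<Rightarrow> ('g \<Rightarrow> (nat \<Rightarrow> complex) \<Rightarrow> (nat \<Rightarrow> complex)) \<Rightarrow> bool" where
  "holomorphic_rep G n \<rho> \<longleftrightarrow>
     group_action G (cspace n) \<rho> \<and> (\<forall>g\<in>carrier G. clinear_on n (\<rho> g)) \<and>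
     (\<forall>v\<in>cspace n. \<forall>i. holomorphic_function (gmfd G) (\<lambda>g. \<rho> g v i))"

definition completely_reducible ::
    "'g clie_group \<Rightarrow> nat \<Rightarrow> ('g \<Rightarrow> (nat \<Rightarrow> complex) \<Rightarrow> (nat \<Rightarrow> complex)) \<Rightarrow> bool" where
  "completely_reducible G n \<rho> \<longleftrightarrow>
     (\<forall>W. csubspace_of n W \<and> (\<forall>g\<in>carrier G. \<rho> g ` W \<subseteq> W) \<longrightarrow>
        (\<exists>W'. csubspace_of n W' \<and> (\<forall>g\<in>carrier G. \<rho> g ` W' \<subseteq> W') \<and>
              W \<inter> W' = {\<lambda>i. 0} \<and> {(\<lambda>i. v i + w i) |v w. v \<in> W \<and> w \<in> W'} = cspace n))"

text \<open>Reductivity in the sense of Hochschild and Mostow. For a complex Lie group this is the same as being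
  the complexification of a compact Lie group.\<close>

definition reductive :: "'g clie_group \<Rightarrow> bool" where
  "reductive G \<longleftrightarrow>
     complex_lie_group G \<and> finite (connected_components_of (mtop (gmfd G))) \<and>
     (\<exists>n \<rho>. holomorphic_rep G n \<rho> \<and> inj_on \<rho> (carrier G)) \<and>
     (\<forall>n \<rho>. holomorphic_rep G n \<rho> \<longrightarrow> completely_reducible G n \<rho>)"

definition Cstar :: "complex monoid" where
  "Cstar = \<lparr>carrier = UNIV - {0}, mult = (*), one = 1\<rparr>"

definition characters :: "'g clie_group \<Rightarrow> ('g \<Rightarrow> complex) set" where
  "characters G = {chi \<in> hom G Cstar. holomorphic_function (gmfd G) chi}"


section \<open>Actions on manifolds and on vector fields\<close>

definition holomorphic_action :: "'g clie_group \<Rightarrow> 'x cmfd \<Rightarrow> ('g \<Rightarrow> 'x \<Rightarrow> 'x) \<Rightarrow> bool" where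
  "holomorphic_action G X \<alpha> \<longleftrightarrow>
     group_action G (points X) \<alpha> \<and>
     holomorphic_map (product_manifold (gmfd G) X) X (\<lambda>(g, x). \<alpha> g x)"

definition complex_G_manifold :: "'g clie_group \<Rightarrow> 'x cmfd \<Rightarrow> ('g \<Rightarrow> 'x \<Rightarrow> 'x) \<Rightarrow> bool" where
  "complex_G_manifold G X \<alpha> \<longleftrightarrow> complex_manifold X \<and> holomorphic_action G X \<alpha>"

definition push_vfield ::
    "'g clie_group \<Rightarrow> 'x cmfd \<Rightarrow> ('g \<Rightarrow> 'x \<Rightarrow> 'x) \<Rightarrow> 'g \<Rightarrow> 'x vfield \<Rightarrow> 'x vfield" where
  "push_vfield G X \<alpha> g \<xi> =
     (\<lambda>x\<in>points X. differential X X (\<alpha> g) (\<alpha> (inv\<^bsub>G\<^esub> g) x) (\<xi> (\<alpha> (inv\<^bsub>G\<^esub> g) x)))"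

definition vfields_char ::
    "'g clie_group \<Rightarrow> 'x cmfd \<Rightarrow> ('g \<Rightarrow> 'x \<Rightarrow> 'x) \<Rightarrow> ('g \<Rightarrow> complex) \<Rightarrow> 'x vfield set" where
  "vfields_char G X \<alpha> chi =
     {\<xi> \<in> holomorphic_vfields X.
        \<forall>g\<in>carrier G. push_vfield G X \<alpha> g \<xi> = (\<lambda>x\<in>points X. \<lambda>c i. chi g * \<xi> x c i)}"


section \<open>Holomorphic vector bundles and sprays\<close>

record ('x, 'e) vbundle =
  total :: "'e cmfd"
  proj :: "'e \<Rightarrow> 'x"
  vzero :: "'x \<Rightarrow> 'e"
  vadd :: "'e \<Rightarrow> 'e \<Rightarrow> 'e"
  vscale :: "complex \<Rightarrow> 'e \<Rightarrow> 'e"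

definition fibre :: "('x, 'e) vbundle \<Rightarrow> 'x \<Rightarrow> 'e set" where
  "fibre E x = {e \<in> points (total E). proj E e = x}"

text \<open>A linear isomorphism from the fibre over \<open>x\<close> to \<open>\<complex>\<^sup>r\<close>. Its existence makes the fibre a
  complex vector space.\<close>

definition fibre_iso :: "nat \<Rightarrow> ('x, 'e) vbundle \<Rightarrow> 'x \<Rightarrow> ('e \<Rightarrow> nat \<Rightarrow> complex) \<Rightarrow> bool" where
  "fibre_iso r E x L \<longleftrightarrow>
     bij_betw L (fibre E x) (cspace r) \<and>
     vzero E x \<in> fibre E x \<and> L (vzero E x) = (\<lambda>i. 0) \<and>
     (\<forall>e\<in>fibre E x. \<forall>e'\<in>fibre E x.
        vadd E e e' \<in> fibre E x \<and> L (vadd E e e') = (\<lambda>i. L e i + L e' i)) \<and>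
     (\<forall>a. \<forall>e\<in>fibre E x. vscale E a e \<in> fibre E x \<and> L (vscale E a e) = (\<lambda>i. a * L e i))"

definition holomorphic_vbundle :: "nat \<Rightarrow> 'x cmfd \<Rightarrow> ('x, 'e) vbundle \<Rightarrow> bool" where
  "holomorphic_vbundle r X E \<longleftrightarrow>
     complex_manifold (total E) \<and> holomorphic_map (total E) X (proj E) \<and>
     (\<forall>x\<in>points X. \<exists>U \<theta>.
        openin (mtop X) U \<and> x \<in> U \<and>
        biholomorphic_map
          (open_submanifold (total E) {e \<in> points (total E). proj E e \<in> U})
          (product_manifold (open_submanifold X U) (cspace_manifold r)) \<theta> \<and>
        (\<forall>y\<in>U. (\<forall>e\<in>fibre E y. fst (\<theta> e) = y) \<and> fibre_iso r E y (\<lambda>e. snd (\<theta> e))))"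

text \<open>The fibre as a complex manifold: as for any finite-dimensional complex vector space, the
  linear isomorphisms to \<open>\<complex>\<^sup>r\<close> are the charts.\<close>

definition fibre_manifold :: "nat \<Rightarrow> ('x, 'e) vbundle \<Rightarrow> 'x \<Rightarrow> 'e cmfd" where
  "fibre_manifold r E x =
     \<lparr>mtop = subtopology (mtop (total E)) (fibre E x), mdim = r,
      atlas = {(fibre E x, L) |L. fibre_iso r E x L}\<rparr>"

definition spray :: "nat \<Rightarrow> 'x cmfd \<Rightarrow> ('x, 'e) vbundle \<Rightarrow> ('e \<Rightarrow> 'x) \<Rightarrow> bool" where
  "spray r X E s \<longleftrightarrow>
     holomorphic_vbundle r X E \<and> holomorphic_map (total E) X s \<and>
     (\<forall>x\<in>points X. s (vzero E x) = x)"

definition dominating :: "nat \<Rightarrow> 'x cmfd \<Rightarrow> ('x, 'e) vbundle \<Rightarrow> ('e \<Rightarrow> 'x) \<Rightarrow> bool" where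
  "dominating r X E s \<longleftrightarrow>
     (\<forall>x\<in>points X. submersion_at (fibre_manifold r E x) X s (vzero E x))"

definition G_spray ::
    "nat \<Rightarrow> 'g clie_group \<Rightarrow> 'x cmfd \<Rightarrow> ('g \<Rightarrow> 'x \<Rightarrow> 'x) \<Rightarrow> ('x, 'e) vbundle \<Rightarrow> ('e \<Rightarrow> 'x) \<Rightarrow> bool" where
  "G_spray r G X \<alpha> E s \<longleftrightarrow>
     spray r X E s \<and>
     (\<exists>\<beta>. holomorphic_action G (total E) \<beta> \<and>
        (\<forall>g\<in>carrier G. \<forall>e\<in>points (total E).
           proj E (\<beta> g e) = \<alpha> g (proj E e) \<and> s (\<beta> g e) = \<alpha> g (s e)) \<and>
        (\<forall>g\<in>carrier G. \<forall>x\<in>points X. \<forall>e\<in>fibre E x.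
           (\<forall>e'\<in>fibre E x. \<beta> g (vadd E e e') = vadd E (\<beta> g e) (\<beta> g e')) \<and>
           (\<forall>a. \<beta> g (vscale E a e) = vscale E a (\<beta> g e))))"

text \<open>The type \<^typ>\<open>'x \<times> (nat \<Rightarrow> complex)\<close> of the points of the total space is no restriction: a bundle
  of rank \<open>r\<close> is, as a set, in fibrewise bijection with the product of the base and \<open>\<complex>\<^sup>r\<close>, and its
  topology, complex structure and vector space operations can be transported. No triviality of the bundle
  is implied.\<close>

definition G_elliptic :: "'g clie_group \<Rightarrow> 'x cmfd \<Rightarrow> ('g \<Rightarrow> 'x \<Rightarrow> 'x) \<Rightarrow> bool" where
  "G_elliptic G X \<alpha> \<longleftrightarrow>
     (\<exists>r (E :: ('x, 'x \<times> (nat \<Rightarrow> complex)) vbundle) s. G_spray r G X \<alpha> E s \<and> dominating r X E s)"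

end

theory Submission
  imports Defs "HOL-Complex_Analysis.Complex_Analysis"
begin

text \<open>
  Let \<open>\<xi>\<^sub>1, \<dots>, \<xi>\<^sub>r\<close> be the given complete fields, with characters \<open>\<kappa>\<^sub>i\<close> and flows \<open>\<Phi>\<^sub>i\<close>. On the
  trivial bundle of rank \<open>r\<close> over \<open>X\<close> consider \<open>s (x, t) = \<Phi>\<^sub>r(t\<^sub>r) \<dots> \<Phi>\<^sub>1(t\<^sub>1) x\<close>. Its derivative
  along the fibre at \<open>0\<close> sends \<open>t\<close> to the sum of the \<open>t\<^sub>i \<xi>\<^sub>i(x)\<close>, so \<open>s\<close> is dominating. Since \<open>g\<close>
  maps \<open>\<xi>\<^sub>i\<close> to \<open>\<kappa>\<^sub>i(g) \<xi>\<^sub>i\<close>, uniqueness of integral curves gives \<open>g \<Phi>\<^sub>i(t) x = \<Phi>\<^sub>i(\<kappa>\<^sub>i(g) t) g x\<close>,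
  and \<open>s\<close> is equivariant if \<open>g\<close> acts on the bundle by \<open>(x, t) \<mapsto> (g x, (\<kappa>\<^sub>i(g) t\<^sub>i)\<^sub>i)\<close>.

  The flows are known to be holomorphic in the time only. Locally the coordinates of \<open>\<Phi>(t) x\<close> are
  power series in \<open>t\<close> whose coefficients are iterated derivatives of the coordinates along the
  field, hence holomorphic in \<open>x\<close>. Cauchy's estimates make the series converge uniformly, so \<open>\<Phi>\<close> is
  jointly holomorphic near \<open>t = 0\<close>, and by the group law everywhere.
\<close>

text \<open>\<open>complete_vfield\<close> supplies, for each point separately, an entire curve that
  solves the equation; it does not say how two such curves are related. Uniqueness, the group law
  and joint holomorphy are therefore all derived here. Complex time makes this possible without
  Picard iteration, since solutions are analytic.

  \<open>cholomorphic_on\<close> asks for a Frechet derivative at every point, a property that is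
  not visibly closed under partial derivatives or uniform limits, both of which the power series
  requires. The way round is the class \<open>separately_holomorphic\<close>, to which Cauchy's
  theory in one variable applies, with \<open>osgood\<close> as the way back. On manifolds
  everything is phrased through germs (\<open>hfun_at\<close>, \<open>hmap_at\<close>), so that
  compositions carry no domains.

  The flows may fail to commute. Equivariance survives because \<open>g\<close> moves past one
  factor at a time, multiplying only that factor's own time by a character value. These values are
  complex, which is where completeness in complex time enters.\<close>

section \<open>Polydiscs\<close>

definition polydisc :: "nat \<Rightarrow> (nat \<Rightarrow> complex) \<Rightarrow> real \<Rightarrow> (nat \<Rightarrow> complex) set" where
  "polydisc n a e = {z \<in> cspace n. \<forall>i<n. norm (z i - a i) < e}"

lemma polydisc_subset_cspace: "polydisc n a e \<subseteq> cspace n"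
  by (auto simp: polydisc_def)

lemma centre_in_polydisc: "a \<in> cspace n \<Longrightarrow> 0 < e \<Longrightarrow> a \<in> polydisc n a e"
  by (auto simp: polydisc_def)

lemma polydisc_mono: "e \<le> e' \<Longrightarrow> polydisc n a e \<subseteq> polydisc n a e'"
  by (auto simp: polydisc_def intro: less_le_trans)

lemma upd_in_cspace: "a \<in> cspace n \<Longrightarrow> i < n \<Longrightarrow> a(i := t) \<in> cspace n"
  by (auto simp: cspace_def)

lemma upd_in_polydisc:
  "a \<in> polydisc n b e \<Longrightarrow> i < n \<Longrightarrow> a(i := t) \<in> polydisc n b e \<longleftrightarrow> t \<in> ball (b i) e"
  by (auto simp: polydisc_def cspace_def dist_norm norm_minus_commute)

text \<open>A basic open set of the product topology constrains finitely many coordinates. Those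
  from \<open>n\<close> on vanish on \<open>cspace n\<close> and constrain nothing there; for the
  others one radius serves all.\<close>

lemma openin_cspace_iff:
  "openin (cEuclidean_space n) U \<longleftrightarrow> U \<subseteq> cspace n \<and> (\<forall>a\<in>U. \<exists>e>0. polydisc n a e \<subseteq> U)"
proof (intro iffI conjI ballI)
  assume "openin (cEuclidean_space n) U"
  then obtain S where S: "open S" "U = cspace n \<inter> S"
    by (auto simp: cEuclidean_space_def openin_open)
  then show "U \<subseteq> cspace n" by auto
  fix a assume a: "a \<in> U"
  have "openin (product_topology (\<lambda>i. euclidean) UNIV) S"
    using S(1) by (simp add: open_fun_def)
  from product_topology_open_contains_basis [OF this, of a] a S obtain Y where
    Y: "a \<in> (\<Pi>\<^sub>E i\<in>UNIV. Y i)" "\<And>i. open (Y i)" "finite {i. Y i \<noteq> UNIV}" "(\<Pi>\<^sub>E i\<in>UNIV. Y i) \<subseteq> S"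
    by auto
  have "\<exists>e>0. ball (a i) e \<subseteq> Y i" for i
    using Y(1,2) by (meson PiE_mem UNIV_I open_contains_ball)
  then obtain r where r: "\<And>i. 0 < r i" "\<And>i. ball (a i) (r i) \<subseteq> Y i" by metis
  \<comment> \<open>The inserted 1 keeps the minimum defined and positive when no coordinate is
    constrained.\<close>
  define e where "e = Min (insert 1 (r ` {i. Y i \<noteq> UNIV}))"
  have e: "0 < e" "\<And>i. Y i \<noteq> UNIV \<Longrightarrow> e \<le> r i"
    using Y(3) r(1) by (auto simp: e_def)
  have "z \<in> U" if z: "z \<in> polydisc n a e" for z
  proof -
    have "z i \<in> Y i" for i
    proof (cases "Y i = UNIV")
      case False
      show ?thesis
      proof (cases "i < n")
        case True
        then have "z i \<in> ball (a i) (r i)" using z e(2) [OF False]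
          by (auto simp: polydisc_def dist_norm norm_minus_commute)
        then show ?thesis using r by blast
      next
        case False
        then have "z i = a i" using z a S by (auto simp: polydisc_def cspace_def)
        then show ?thesis using Y(1) by auto
      qed
    qed auto
    then show ?thesis using Y(4) z S by (auto simp: polydisc_def)
  qed
  then show "\<exists>e>0. polydisc n a e \<subseteq> U" using e by blast
next
  assume U: "U \<subseteq> cspace n \<and> (\<forall>a\<in>U. \<exists>e>0. polydisc n a e \<subseteq> U)"
  then obtain r where r: "\<And>a. a \<in> U \<Longrightarrow> 0 < r a" "\<And>a. a \<in> U \<Longrightarrow> polydisc n a (r a) \<subseteq> U" by metis
  define S where "S = (\<Union>a\<in>U. \<Inter>i\<in>{..<n}. {z :: nat \<Rightarrow> complex. norm (z i - a i) < r a})"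
  have "open {z :: nat \<Rightarrow> complex. norm (z i - a i) < r a}" for i a
    by (intro open_Collect_less continuous_intros continuous_on_product_coordinates)
  then have "open S"
    unfolding S_def by (intro open_UN ballI open_INT finite_lessThan)
  moreover have "U = cspace n \<inter> S"
  proof
    show "U \<subseteq> cspace n \<inter> S" using U r(1) by (auto simp: S_def)
    show "cspace n \<inter> S \<subseteq> U"
    proof
      fix z assume "z \<in> cspace n \<inter> S"
      then obtain a where "a \<in> U" "z \<in> polydisc n a (r a)" by (auto simp: S_def polydisc_def)
      then show "z \<in> U" using r(2) by blast
    qed
  qed
  ultimately show "openin (cEuclidean_space n) U" by (auto simp: cEuclidean_space_def openin_open)
qed

lemma openin_polydisc: "openin (cEuclidean_space n) (polydisc n a e)"
  unfolding openin_cspace_iff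
proof (intro conjI ballI)
  fix b assume b: "b \<in> polydisc n a e"
  define d where "d = Min (insert 1 ((\<lambda>i. e - norm (b i - a i)) ` {..<n}))"
  have "0 < d" using b by (auto simp: d_def polydisc_def)
  moreover have "polydisc n b d \<subseteq> polydisc n a e"
  proof
    fix z assume z: "z \<in> polydisc n b d"
    have "norm (z i - a i) < e" if "i < n" for i
    proof -
      have "d \<le> e - norm (b i - a i)" using that by (auto simp: d_def intro!: Min_le)
      then show ?thesis using norm_triangle_ineq [of "z i - b i" "b i - a i"] z that
        by (auto simp: polydisc_def)
    qed
    then show "z \<in> polydisc n a e" using z by (auto simp: polydisc_def)
  qed
  ultimately show "\<exists>d>0. polydisc n b d \<subseteq> polydisc n a e" by blast
qed (rule polydisc_subset_cspace)

lemma tendsto_fun_iff: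
  fixes f :: "'a \<Rightarrow> 'i \<Rightarrow> 'b::topological_space"
  shows "(f \<longlongrightarrow> l) F \<longleftrightarrow> (\<forall>i. ((\<lambda>x. f x i) \<longlongrightarrow> l i) F)"
  using limitin_componentwise [of "\<lambda>_::'i. euclidean :: 'b topology" UNIV f l F]
  by (simp add: euclidean_product_topology)

text \<open>\<open>cholomorphic_on\<close> takes its limits within the domain; this makes them
  independent of the domain, so that differentiability becomes a property of a function at a
  point.\<close>

lemma at_within_cspace:
  assumes "openin (cEuclidean_space n) U" "a \<in> U"
  shows "at a within U = at a within cspace n"
proof -
  obtain S where "open S" "U = cspace n \<inter> S"
    using assms by (auto simp: cEuclidean_space_def openin_open)
  then show ?thesis using assms(2) at_within_nhd [of a S U "cspace n"] by auto
qed

lemma eventually_at_cspace: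
  assumes "openin (cEuclidean_space n) U" "a \<in> U" "\<And>z. z \<in> U \<Longrightarrow> P z"
  shows "eventually P (at a within cspace n)"
  unfolding at_within_cspace [OF assms(1,2), symmetric] eventually_at_topological
  using assms(3) by (intro exI [of _ UNIV]) auto

section \<open>Complex differentiability\<close>

text \<open>Caratheodory's form of the Frechet derivative, which reduces the chain rule to algebra and
  limits of compositions.\<close>

definition cdiff_at :: "nat \<Rightarrow> ((nat \<Rightarrow> complex) \<Rightarrow> complex) \<Rightarrow> (nat \<Rightarrow> complex) \<Rightarrow> bool" where
  "cdiff_at n f a \<longleftrightarrow> (\<exists>q. (\<forall>z\<in>cspace n. f z - f a = (\<Sum>i<n. q i z * (z i - a i))) \<and>
      (\<forall>i<n. (q i \<longlongrightarrow> q i a) (at a within cspace n)))"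

lemma cdiff_atE:
  assumes "cdiff_at n f a"
  obtains q where "\<And>z. z \<in> cspace n \<Longrightarrow> f z = f a + (\<Sum>i<n. q i z * (z i - a i))"
    "\<And>i. i < n \<Longrightarrow> (q i \<longlongrightarrow> q i a) (at a within cspace n)"
proof -
  obtain q where q: "\<forall>z\<in>cspace n. f z - f a = (\<Sum>i<n. q i z * (z i - a i))"
    "\<forall>i<n. (q i \<longlongrightarrow> q i a) (at a within cspace n)"
    using assms by (auto simp: cdiff_at_def)
  show thesis
    by (rule that [of q]) (use q in \<open>auto simp flip: q(1)[rule_format]\<close>)
qed

text \<open>Given a Frechet derivative, its error has to be shared out among the coordinates. Since
  the norm of \<open>w\<close> is \<open>cnj (sgn w) * w\<close>, the product of
  \<open>err z\<close> with the sum of the \<open>norm (z i - a i)\<close> splits into the summands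
  \<open>err z * cnj (sgn (z i - a i)) * (z i - a i)\<close>. Conversely, the remainder is at most
  the sum of the \<open>norm (q i z - q i a)\<close> times that of the
  \<open>norm (z i - a i)\<close>.\<close>

lemma cdiff_at_iff_frechet:
  assumes a: "a \<in> cspace n"
  shows "cdiff_at n f a \<longleftrightarrow> (\<exists>c :: nat \<Rightarrow> complex.
          ((\<lambda>z. (f z - f a - (\<Sum>i<n. c i * (z i - a i))) / of_real (\<Sum>i<n. norm (z i - a i)))
            \<longlongrightarrow> 0) (at a within cspace n))" (is "_ \<longleftrightarrow> ?L")
proof
  assume ?L
  then obtain c where c: "((\<lambda>z. (f z - f a - (\<Sum>i<n. c i * (z i - a i))) / of_real (\<Sum>i<n. norm (z i - a i)))
          \<longlongrightarrow> 0) (at a within cspace n)" by blast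
  define err where "err z = (f z - f a - (\<Sum>i<n. c i * (z i - a i))) / of_real (\<Sum>i<n. norm (z i - a i))" for z
  define q where "q i z = c i + err z * cnj (sgn (z i - a i))" for i z
  have "f z - f a = (\<Sum>i<n. q i z * (z i - a i))" if z: "z \<in> cspace n" for z
  proof -
    have cs: "cnj (sgn w) * w = of_real (norm w)" for w :: complex
    proof (cases "w = 0")
      case False
      have "cnj (sgn w) * w = (w * cnj w) / of_real (norm w)"
        by (simp add: sgn_eq)
      also have "\<dots> = of_real (norm w)"
        using False by (simp add: complex_norm_square[symmetric] power2_eq_square)
      finally show ?thesis .
    qed auto
    have "(\<Sum>i<n. q i z * (z i - a i)) = (\<Sum>i<n. c i * (z i - a i)) + err z * of_real (\<Sum>i<n. norm (z i - a i))"
      by (simp add: q_def distrib_right sum.distrib sum_distrib_left mult.assoc cs)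
    also have "\<dots> = f z - f a"
    proof (cases "(\<Sum>i<n. norm (z i - a i)) = 0")
      case True
      then have "z i = a i" if "i < n" for i
        using that by (subst (asm) sum_nonneg_eq_0_iff) auto
      moreover have "z i = a i" if "\<not> i < n" for i using that z a by (auto simp: cspace_def)
      ultimately have "z = a" by blast
      then show ?thesis by simp
    next
      case False
      then show ?thesis unfolding err_def by (simp add: divide_simps del: of_real_sum)
    qed
    finally show ?thesis by simp
  qed
  \<comment> \<open>The value of \<open>q i\<close> at \<open>a\<close> is \<open>c i\<close>
    because \<open>sgn 0 = 0\<close>.\<close>
  moreover have "(q i \<longlongrightarrow> q i a) (at a within cspace n)" for i
  proof -
    have "((\<lambda>z. err z * cnj (sgn (z i - a i))) \<longlongrightarrow> 0) (at a within cspace n)"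
    proof (rule Lim_null_comparison)
      show "((\<lambda>z. norm (err z)) \<longlongrightarrow> 0) (at a within cspace n)"
        using c unfolding err_def by (rule tendsto_norm_zero)
      show "\<forall>\<^sub>F z in at a within cspace n. norm (err z * cnj (sgn (z i - a i))) \<le> norm (err z)"
        by (intro always_eventually allI) (simp add: norm_mult norm_sgn)
    qed
    then have "((\<lambda>z. c i + err z * cnj (sgn (z i - a i))) \<longlongrightarrow> c i + 0) (at a within cspace n)"
      by (intro tendsto_intros)
    then show ?thesis unfolding q_def by simp
  qed
  ultimately show "cdiff_at n f a" by (auto simp: cdiff_at_def)
next
  assume "cdiff_at n f a"
  then obtain q where q: "\<And>z. z \<in> cspace n \<Longrightarrow> f z = f a + (\<Sum>i<n. q i z * (z i - a i))"
    "\<And>i. i < n \<Longrightarrow> (q i \<longlongrightarrow> q i a) (at a within cspace n)" by (elim cdiff_atE) blast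
  have "((\<lambda>z. (f z - f a - (\<Sum>i<n. q i a * (z i - a i))) / of_real (\<Sum>i<n. norm (z i - a i)))
          \<longlongrightarrow> 0) (at a within cspace n)"
  proof (rule Lim_null_comparison)
    show "((\<lambda>z. \<Sum>i<n. norm (q i z - q i a)) \<longlongrightarrow> 0) (at a within cspace n)"
      by (rule tendsto_null_sum, rule tendsto_norm_zero, rule LIM_zero, rule q(2)) simp
    show "\<forall>\<^sub>F z in at a within cspace n. norm ((f z - f a - (\<Sum>i<n. q i a * (z i - a i))) / of_real (\<Sum>i<n. norm (z i - a i)))
        \<le> (\<Sum>i<n. norm (q i z - q i a))"
      unfolding eventually_at_filter
    proof (intro always_eventually allI impI)
      fix z assume z: "z \<in> cspace n"
      define s where "s = (\<Sum>i<n. norm (z i - a i))"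
      have s0: "s \<ge> 0" by (simp add: s_def sum_nonneg)
      have "norm (f z - f a - (\<Sum>i<n. q i a * (z i - a i))) = norm (\<Sum>i<n. (q i z - q i a) * (z i - a i))"
        using q(1) [OF z] by (simp add: sum_subtractf left_diff_distrib)
      also have "\<dots> \<le> (\<Sum>i<n. norm (q i z - q i a) * s)"
        by (rule sum_norm_le) (auto simp: norm_mult s_def intro!: mult_left_mono member_le_sum)
      finally have *: "norm (f z - f a - (\<Sum>i<n. q i a * (z i - a i))) \<le> (\<Sum>i<n. norm (q i z - q i a)) * s"
        by (simp add: sum_distrib_right)
      show "norm ((f z - f a - (\<Sum>i<n. q i a * (z i - a i))) / of_real (\<Sum>i<n. norm (z i - a i)))
        \<le> (\<Sum>i<n. norm (q i z - q i a))"
        using * s0 unfolding s_def[symmetric]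
        by (cases "s = 0") (auto simp: norm_divide divide_simps sum_nonneg simp del: of_real_sum)
    qed
  qed
  then show ?L by (rule exI [where x="\<lambda>i. q i a"])
qed

lemma cholomorphic_on_iff_cdiff_at:
  assumes U: "openin (cEuclidean_space n) U"
  shows "cholomorphic_on n U f \<longleftrightarrow> (\<forall>a\<in>U. cdiff_at n f a)"
proof -
  have "U \<subseteq> cspace n" using U by (simp add: openin_cspace_iff)
  then show ?thesis
    unfolding cholomorphic_on_def
    by (intro ball_cong refl) (subst at_within_cspace [OF U], assumption, rule cdiff_at_iff_frechet [symmetric], blast)
qed

text \<open>Unlike \<open>at a within cspace n\<close>, this filter sees the point itself, so that
  functions which agree eventually also agree at a point \<open>a\<close> of
  \<open>cspace n\<close>.\<close>

abbreviation nhds_cspace :: "nat \<Rightarrow> (nat \<Rightarrow> complex) \<Rightarrow> (nat \<Rightarrow> complex) filter" where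
  "nhds_cspace n a \<equiv> inf (nhds a) (principal (cspace n))"

lemma eventually_nhds_cspace_iff:
  assumes "a \<in> cspace n"
  shows "eventually P (nhds_cspace n a) \<longleftrightarrow> (\<exists>e>0. \<forall>z\<in>polydisc n a e. P z)"
proof
  assume "eventually P (nhds_cspace n a)"
  then obtain S where S: "open S" "a \<in> S" "\<forall>z\<in>S. z \<in> cspace n \<longrightarrow> P z"
    by (auto simp: eventually_inf_principal eventually_nhds)
  then have "openin (cEuclidean_space n) (cspace n \<inter> S)"
    by (auto simp: cEuclidean_space_def openin_open)
  then obtain e where "e > 0" "polydisc n a e \<subseteq> cspace n \<inter> S"
    using S(2) assms unfolding openin_cspace_iff by (metis IntI)
  then show "\<exists>e>0. \<forall>z\<in>polydisc n a e. P z" using S by blast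
next
  assume "\<exists>e>0. \<forall>z\<in>polydisc n a e. P z"
  then obtain e where e: "e > 0" "\<forall>z\<in>polydisc n a e. P z" by blast
  obtain S where "open S" "polydisc n a e = cspace n \<inter> S"
    using openin_polydisc [of n a e] by (auto simp: cEuclidean_space_def openin_open)
  then show "eventually P (nhds_cspace n a)"
    using e centre_in_polydisc [OF assms e(1)]
    by (auto simp: eventually_inf_principal eventually_nhds intro!: exI [of _ S])
qed

lemma eventually_nhds_cspaceI:
  assumes "openin (cEuclidean_space n) U" "a \<in> U" "\<And>z. z \<in> U \<Longrightarrow> P z"
  shows "eventually P (nhds_cspace n a)"
proof -
  have "a \<in> cspace n" "\<exists>e>0. polydisc n a e \<subseteq> U" using assms(1,2) by (auto simp: openin_cspace_iff)
  then show ?thesis using assms(3) by (subst eventually_nhds_cspace_iff) auto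
qed

lemma eventually_nhds_cspace_at:
  "eventually P (nhds_cspace n a) \<Longrightarrow> eventually P (at a within cspace n)"
  by (auto simp: eventually_inf_principal eventually_nhds eventually_at_topological)

lemma eventually_nhds_cspace_eventually:
  assumes "a \<in> cspace n" "eventually P (nhds_cspace n a)"
  shows "eventually (\<lambda>z. eventually P (nhds_cspace n z)) (nhds_cspace n a)"
proof -
  obtain e where e: "e > 0" "\<forall>z\<in>polydisc n a e. P z"
    using assms by (auto simp: eventually_nhds_cspace_iff)
  show ?thesis
    using openin_polydisc centre_in_polydisc [OF assms(1) e(1)]
    by (rule eventually_nhds_cspaceI) (rule eventually_nhds_cspaceI [OF openin_polydisc _ e(2) [rule_format]])
qed

lemma eventually_nhds_cspace_imp:
  "a \<in> cspace n \<Longrightarrow> eventually P (nhds_cspace n a) \<Longrightarrow> P a"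
  by (auto simp: eventually_inf_principal dest: eventually_nhds_x_imp_x)

lemma eventually_nhds_cspace_mem: "eventually (\<lambda>z. z \<in> cspace n) (nhds_cspace n a)"
  by (simp add: eventually_inf_principal)

lemma tendsto_coordinate: "((\<lambda>z. z i) \<longlongrightarrow> a i) (at a within S)" for a :: "nat \<Rightarrow> complex"
  using tendsto_ident_at [of a S] unfolding tendsto_fun_iff by blast

lemma cdiff_at_cong:
  assumes "a \<in> cspace n" "eventually (\<lambda>z. f z = g z) (nhds_cspace n a)"
  shows "cdiff_at n f a \<longleftrightarrow> cdiff_at n g a"
proof -
  have "f a = g a" using assms by (rule eventually_nhds_cspace_imp)
  moreover have "eventually (\<lambda>z. f z = g z) (at a within cspace n)"
    using assms(2) by (rule eventually_nhds_cspace_at)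
  ultimately show ?thesis unfolding cdiff_at_iff_frechet [OF assms(1)]
    by (intro ex_cong1 tendsto_cong) (auto elim: eventually_mono)
qed

lemma cdiff_atI:
  assumes "openin (cEuclidean_space n) U" "a \<in> U"
    "\<And>z. z \<in> U \<Longrightarrow> f z = f a + (\<Sum>i<n. q i z * (z i - a i))"
    "\<And>i. i < n \<Longrightarrow> (q i \<longlongrightarrow> q i a) (at a within cspace n)"
  shows "cdiff_at n f a"
proof -
  have a: "a \<in> cspace n" using assms by (auto simp: openin_cspace_iff)
  have "cdiff_at n (\<lambda>z. f a + (\<Sum>i<n. q i z * (z i - a i))) a"
    unfolding cdiff_at_def using assms(4) by (intro exI [of _ q]) auto
  moreover have "eventually (\<lambda>z. f z = f a + (\<Sum>i<n. q i z * (z i - a i))) (nhds_cspace n a)"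
    using assms by (intro eventually_nhds_cspaceI)
  ultimately show ?thesis using cdiff_at_cong [OF a, of f] by simp
qed

lemma cdiff_at_tendsto:
  assumes "cdiff_at n f a"
  shows "(f \<longlongrightarrow> f a) (at a within cspace n)"
proof -
  obtain q where q: "\<And>z. z \<in> cspace n \<Longrightarrow> f z = f a + (\<Sum>i<n. q i z * (z i - a i))"
    "\<And>i. i < n \<Longrightarrow> (q i \<longlongrightarrow> q i a) (at a within cspace n)" using assms by (elim cdiff_atE) blast
  have "((\<lambda>z. f a + (\<Sum>i<n. q i z * (z i - a i))) \<longlongrightarrow> f a + (\<Sum>i<n. q i a * (a i - a i))) (at a within cspace n)"
    by (intro tendsto_intros q(2) tendsto_coordinate) auto
  then have "((\<lambda>z. f a + (\<Sum>i<n. q i z * (z i - a i))) \<longlongrightarrow> f a) (at a within cspace n)" by simp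
  moreover have "eventually (\<lambda>z. f a + (\<Sum>i<n. q i z * (z i - a i)) = f z) (at a within cspace n)"
    unfolding eventually_at_filter using q(1) by (intro always_eventually) auto
  ultimately show ?thesis by (rule Lim_transform_eventually)
qed

text \<open>The coefficients of \<open>F\<close> at \<open>G z\<close> times those of the components
  of \<open>G\<close> are coefficients for the composite. The form of the hypothesis on
  \<open>G\<close>, which concerns all of \<open>cspace m\<close>, is localised later in
  \<open>chol_at_compose\<close>.\<close>

lemma cdiff_at_compose:
  assumes a: "a \<in> cspace m" and G: "\<And>z. z \<in> cspace m \<Longrightarrow> G z \<in> cspace n"
    and g: "\<And>j. j < n \<Longrightarrow> cdiff_at m (\<lambda>z. G z j) a" and F: "cdiff_at n F (G a)"
  shows "cdiff_at m (\<lambda>z. F (G z)) a"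
proof -
  obtain Q where Q: "\<And>z. z \<in> cspace n \<Longrightarrow> F z = F (G a) + (\<Sum>j<n. Q j z * (z j - G a j))"
    "\<And>j. j < n \<Longrightarrow> (Q j \<longlongrightarrow> Q j (G a)) (at (G a) within cspace n)" using F by (elim cdiff_atE) blast
  have "\<forall>j\<in>{..<n}. \<exists>q. (\<forall>z\<in>cspace m. G z j - G a j = (\<Sum>i<m. q i z * (z i - a i))) \<and>
      (\<forall>i<m. (q i \<longlongrightarrow> q i a) (at a within cspace m))"
    using g by (auto simp: cdiff_at_def)
  then obtain q where q: "\<And>j z. j < n \<Longrightarrow> z \<in> cspace m \<Longrightarrow> G z j - G a j = (\<Sum>i<m. q j i z * (z i - a i))"
    "\<And>i j. j < n \<Longrightarrow> i < m \<Longrightarrow> (q j i \<longlongrightarrow> q j i a) (at a within cspace m)"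
    by (subst (asm) bchoice_iff) auto
  have Gt: "(G \<longlongrightarrow> G a) (at a within cspace m)"
    unfolding tendsto_fun_iff
  proof
    fix j
    show "((\<lambda>z. G z j) \<longlongrightarrow> G a j) (at a within cspace m)"
    proof (cases "j < n")
      case True then show ?thesis using cdiff_at_tendsto [OF g] by blast
    next
      case False
      then have "z \<in> cspace m \<Longrightarrow> G z j = 0" for z using G by (auto simp: cspace_def)
      then show ?thesis using a
        by (intro tendsto_eventually) (auto simp: eventually_at_filter)
    qed
  qed
  have "F (G z) - F (G a) = (\<Sum>i<m. (\<Sum>j<n. Q j (G z) * q j i z) * (z i - a i))" if z: "z \<in> cspace m" for z
  proof -
    have "F (G z) - F (G a) = (\<Sum>j<n. Q j (G z) * (G z j - G a j))"
      using Q(1) [OF G [OF z]] by simp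
    also have "\<dots> = (\<Sum>j<n. \<Sum>i<m. Q j (G z) * q j i z * (z i - a i))"
      by (intro sum.cong) (auto simp: q(1) z sum_distrib_left mult.assoc)
    also have "\<dots> = (\<Sum>i<m. \<Sum>j<n. Q j (G z) * q j i z * (z i - a i))" by (rule sum.swap)
    finally show ?thesis by (simp add: sum_distrib_right)
  qed
  moreover have "((\<lambda>z. \<Sum>j<n. Q j (G z) * q j i z) \<longlongrightarrow> (\<Sum>j<n. Q j (G a) * q j i a)) (at a within cspace m)"
    if "i < m" for i
  proof (intro tendsto_intros q(2) that)
    fix j assume "j \<in> {..<n}"
    \<comment> \<open>Continuity of \<open>Q j\<close>, including its value at \<open>G a\<close>:
      there may be \<open>z\<close> arbitrarily near \<open>a\<close> with \<open>G z = G a\<close>,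
      about which a punctured limit says nothing.\<close>
    then have "continuous (at (G a) within cspace n) (Q j)"
      using Q(2) by (simp add: continuous_within)
    then show "((\<lambda>z. Q j (G z)) \<longlongrightarrow> Q j (G a)) (at a within cspace m)"
      by (rule continuous_within_tendsto_compose) (use Gt G in \<open>auto simp: eventually_at_filter\<close>)
  qed auto
  ultimately show ?thesis unfolding cdiff_at_def
    by (intro exI [of _ "\<lambda>i z. \<Sum>j<n. Q j (G z) * q j i z"]) auto
qed

lemma cdiff_at_const: "cdiff_at n (\<lambda>z. c) a"
  unfolding cdiff_at_def by (intro exI [of _ "\<lambda>i z. 0"]) auto

lemma cdiff_at_coordinate:
  assumes "a \<in> cspace n" shows "cdiff_at n (\<lambda>z. z i) a"
proof (cases "i < n")
  case True
  then show ?thesis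
    unfolding cdiff_at_def by (intro exI [of _ "\<lambda>k z. of_bool (k = i)"]) (auto simp: of_bool_def if_distrib [of "\<lambda>c. c * _"] cong: if_cong)
next
  case False
  then have "eventually (\<lambda>z. z i = 0) (nhds_cspace n a)"
    by (auto simp: eventually_inf_principal cspace_def)
  then show ?thesis using cdiff_at_cong [OF assms, of "\<lambda>z. z i" "\<lambda>z. 0"] by (simp add: cdiff_at_const)
qed

lemma cdiff_at_add:
  assumes "cdiff_at n f a" "cdiff_at n g a" shows "cdiff_at n (\<lambda>z. f z + g z) a"
proof -
  obtain p q where p: "\<forall>z\<in>cspace n. f z - f a = (\<Sum>i<n. p i z * (z i - a i))" "\<forall>i<n. (p i \<longlongrightarrow> p i a) (at a within cspace n)"
    and q: "\<forall>z\<in>cspace n. g z - g a = (\<Sum>i<n. q i z * (z i - a i))" "\<forall>i<n. (q i \<longlongrightarrow> q i a) (at a within cspace n)"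
    using assms unfolding cdiff_at_def by blast
  have "f z + g z - (f a + g a) = (\<Sum>i<n. (p i z + q i z) * (z i - a i))" if "z \<in> cspace n" for z
  proof -
    have "f z + g z - (f a + g a) = (f z - f a) + (g z - g a)" by simp
    then show ?thesis using p(1) q(1) that by (simp add: distrib_right sum.distrib)
  qed
  then show ?thesis unfolding cdiff_at_def using p(2) q(2)
    by (intro exI [of _ "\<lambda>i z. p i z + q i z"]) (auto intro!: tendsto_intros)
qed

lemma cdiff_at_mult:
  assumes "cdiff_at n f a" "cdiff_at n g a" shows "cdiff_at n (\<lambda>z. f z * g z) a"
proof -
  obtain p q where p: "\<forall>z\<in>cspace n. f z - f a = (\<Sum>i<n. p i z * (z i - a i))" "\<forall>i<n. (p i \<longlongrightarrow> p i a) (at a within cspace n)"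
    and q: "\<forall>z\<in>cspace n. g z - g a = (\<Sum>i<n. q i z * (z i - a i))" "\<forall>i<n. (q i \<longlongrightarrow> q i a) (at a within cspace n)"
    using assms unfolding cdiff_at_def by blast
  have "f z * g z - (f a * g a) = (\<Sum>i<n. (p i z * g z + f a * q i z) * (z i - a i))" if "z \<in> cspace n" for z
  proof -
    have "f z * g z - (f a * g a) = (f z - f a) * g z + f a * (g z - g a)" by (simp add: algebra_simps)
    then show ?thesis using p(1) q(1) that
      by (simp add: distrib_right sum.distrib sum_distrib_left sum_distrib_right mult.commute mult.left_commute)
        (simp add: mult_ac sum.distrib distrib_left)
  qed
  then show ?thesis unfolding cdiff_at_def using p(2) q(2) cdiff_at_tendsto [OF assms(2)]
    by (intro exI [of _ "\<lambda>i z. p i z * g z + f a * q i z"]) (auto intro!: tendsto_intros)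
qed

text \<open>The same one-variable derivative as in the summands of \<open>cjacobian\<close>, so that
  differentials of maps unfold to sums of \<open>pd\<close>.\<close>

definition pd :: "nat \<Rightarrow> ((nat \<Rightarrow> complex) \<Rightarrow> complex) \<Rightarrow> (nat \<Rightarrow> complex) \<Rightarrow> complex" where
  "pd i f a = deriv (\<lambda>t. f (a(i := t))) (a i)"

lemma cdiff_at_curve:
  assumes f: "cdiff_at n f (\<gamma> t)" and S: "open S" "t \<in> S" "\<And>s. s \<in> S \<Longrightarrow> \<gamma> s \<in> cspace n"
    and w: "\<And>k. k < n \<Longrightarrow> ((\<lambda>s. \<gamma> s k) has_field_derivative w k) (at t)"
  shows "((\<lambda>s. f (\<gamma> s)) has_field_derivative (\<Sum>k<n. pd k f (\<gamma> t) * w k)) (at t)"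
proof -
  obtain q where q: "\<And>z. z \<in> cspace n \<Longrightarrow> f z = f (\<gamma> t) + (\<Sum>i<n. q i z * (z i - \<gamma> t i))"
    "\<And>i. i < n \<Longrightarrow> (q i \<longlongrightarrow> q i (\<gamma> t)) (at (\<gamma> t) within cspace n)" using f by (elim cdiff_atE) blast
  \<comment> \<open>Stated for an arbitrary curve through \<open>\<gamma> t\<close> because it
    serves twice: for the coordinate lines, where it identifies \<open>q k (\<gamma> t)\<close> with
    \<open>pd k f (\<gamma> t)\<close>, and then for \<open>\<gamma>\<close> itself.\<close>
  have *: "((\<lambda>s. f (\<delta> s)) has_field_derivative (\<Sum>k<n. q k (\<gamma> t) * v k)) (at u)"
    if \<delta>: "open T" "u \<in> T" "\<And>s. s \<in> T \<Longrightarrow> \<delta> s \<in> cspace n" "\<delta> u = \<gamma> t"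
      and v: "\<And>k. k < n \<Longrightarrow> ((\<lambda>s. \<delta> s k) has_field_derivative v k) (at u)" for \<delta> :: "complex \<Rightarrow> nat \<Rightarrow> complex" and u v T
  proof -
    have T: "eventually (\<lambda>s. s \<in> T) (at u)"
      using \<delta>(1,2) by (simp add: eventually_at_in_open')
    have dt: "(\<delta> \<longlongrightarrow> \<gamma> t) (at u)"
      unfolding tendsto_fun_iff
    proof
      fix k
      show "((\<lambda>s. \<delta> s k) \<longlongrightarrow> \<gamma> t k) (at u)"
      proof (cases "k < n")
        case True then show ?thesis
          using v [OF True] \<delta>(4) by (metis DERIV_isCont isCont_def)
      next
        case False
        have "\<delta> s k = \<gamma> t k" if "s \<in> T" for s
          using \<delta>(3) [OF that] \<delta>(3) [OF \<delta>(2)] False by (auto simp: cspace_def simp flip: \<delta>(4))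
        then show ?thesis
          by (intro tendsto_eventually) (use T in \<open>auto elim: eventually_mono\<close>)
      qed
    qed
    have "((\<lambda>s. \<Sum>k<n. q k (\<delta> s) * ((\<delta> s k - \<delta> u k) / (s - u))) \<longlongrightarrow> (\<Sum>k<n. q k (\<gamma> t) * v k)) (at u)"
    proof (intro tendsto_intros)
      fix k assume k: "k \<in> {..<n}"
      then have "continuous (at (\<gamma> t) within cspace n) (q k)"
        using q(2) by (simp add: continuous_within)
      then show "((\<lambda>s. q k (\<delta> s)) \<longlongrightarrow> q k (\<gamma> t)) (at u)"
        by (rule continuous_within_tendsto_compose) (use dt T \<delta>(3) in \<open>auto elim: eventually_mono\<close>)
      show "((\<lambda>s. (\<delta> s k - \<delta> u k) / (s - u)) \<longlongrightarrow> v k) (at u)"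
        using v k by (simp add: has_field_derivative_iff)
    qed
    moreover have "eventually (\<lambda>s. (\<Sum>k<n. q k (\<delta> s) * ((\<delta> s k - \<delta> u k) / (s - u))) = (f (\<delta> s) - f (\<delta> u)) / (s - u)) (at u)"
      using T by eventually_elim (simp add: q(1) \<delta> sum_divide_distrib)
    ultimately show ?thesis
      unfolding has_field_derivative_iff by (rule Lim_transform_eventually)
  qed
  have "pd k f (\<gamma> t) = q k (\<gamma> t)" if k: "k < n" for k
    unfolding pd_def
  proof (rule DERIV_imp_deriv)
    have "((\<lambda>s. f ((\<gamma> t)(k := s))) has_field_derivative (\<Sum>j<n. q j (\<gamma> t) * of_bool (j = k))) (at (\<gamma> t k))"
      by (rule * [of UNIV])
        (use k S in \<open>auto simp del: fun_upd_apply intro!: upd_in_cspace\<close>, auto intro!: derivative_eq_intros)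
    then show "((\<lambda>s. f ((\<gamma> t)(k := s))) has_field_derivative q k (\<gamma> t)) (at (\<gamma> t k))"
      using k by (simp add: of_bool_def if_distrib cong: if_cong)
  qed
  then show ?thesis using * [OF S refl w] by simp
qed

lemma cdiff_at_partial:
  assumes "cdiff_at n f a" "i < n" "a \<in> cspace n"
  shows "((\<lambda>t. f (a(i := t))) has_field_derivative pd i f a) (at (a i))"
proof -
  have "((\<lambda>s. f (a(i := s))) has_field_derivative (\<Sum>k<n. pd k f (a(i := a i)) * of_bool (k = i))) (at (a i))"
    by (rule cdiff_at_curve [of n _ _ _ UNIV])
      (use assms in \<open>auto simp del: fun_upd_apply intro!: upd_in_cspace\<close>, auto intro!: derivative_eq_intros)
  then show ?thesis using assms by (simp add: of_bool_def if_distrib cong: if_cong)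
qed

section \<open>Separately holomorphic functions\<close>

text \<open>The working class for estimates: each slice is a holomorphic function of one variable on
  a whole disc, and continuity supplies the local bounds that make the estimates uniform over the
  slices.\<close>

definition separately_holomorphic :: "nat \<Rightarrow> (nat \<Rightarrow> complex) \<Rightarrow> real \<Rightarrow> ((nat \<Rightarrow> complex) \<Rightarrow> complex) \<Rightarrow> bool" where
  "separately_holomorphic n b e f \<longleftrightarrow> continuous_on (polydisc n b e) f \<and>
     (\<forall>a\<in>polydisc n b e. \<forall>i<n. (\<lambda>t. f (a(i := t))) holomorphic_on ball (b i) e)"

lemma separately_holomorphic_subset:
  assumes f: "separately_holomorphic n b e f" and sub: "polydisc n a r \<subseteq> polydisc n b e"
    and a: "a \<in> cspace n" and r: "0 < r"
  shows "separately_holomorphic n a r f"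
  unfolding separately_holomorphic_def
proof (intro conjI ballI allI impI)
  show "continuous_on (polydisc n a r) f"
    using f sub by (auto simp: separately_holomorphic_def intro: continuous_on_subset)
  fix z i assume z: "z \<in> polydisc n a r" and i: "i < n"
  have aa: "a \<in> polydisc n a r" "a \<in> polydisc n b e" using centre_in_polydisc [OF a r] sub by auto
  have "ball (a i) r \<subseteq> ball (b i) e"
  proof
    fix t assume "t \<in> ball (a i) r"
    then have "a(i := t) \<in> polydisc n b e" using upd_in_polydisc [OF aa(1) i] sub by blast
    then show "t \<in> ball (b i) e" using upd_in_polydisc [OF aa(2) i] by blast
  qed
  then show "(\<lambda>t. f (z(i := t))) holomorphic_on ball (a i) r"
    using f z i sub unfolding separately_holomorphic_def by (meson holomorphic_on_subset subsetD)
qed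

lemma cdiff_at_imp_separately_holomorphic:
  assumes f: "\<And>z. z \<in> polydisc n b e \<Longrightarrow> cdiff_at n f z"
  shows "separately_holomorphic n b e f"
  unfolding separately_holomorphic_def
proof (intro conjI ballI allI impI)
  show "continuous_on (polydisc n b e) f"
    unfolding continuous_on_def
    using cdiff_at_tendsto [OF f] at_within_cspace [OF openin_polydisc] by metis
  fix a i assume a: "a \<in> polydisc n b e" and i: "i < n"
  show "(\<lambda>t. f (a(i := t))) holomorphic_on ball (b i) e"
    unfolding holomorphic_on_def field_differentiable_def
  proof
    fix t assume "t \<in> ball (b i) e"
    then have t: "a(i := t) \<in> polydisc n b e" using upd_in_polydisc [OF a i] by blast
    have "((\<lambda>s. f ((a(i := t))(i := s))) has_field_derivative pd i f (a(i := t))) (at ((a(i := t)) i))"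
      using f [OF t] i t polydisc_subset_cspace by (intro cdiff_at_partial) blast+
    then show "\<exists>f'. ((\<lambda>t. f (a(i := t))) has_field_derivative f') (at t within ball (b i) e)"
      by (auto intro: has_field_derivative_at_within)
  qed
qed

lemma continuous_on_cspace_bounded:
  fixes f :: "(nat \<Rightarrow> complex) \<Rightarrow> complex"
  assumes "continuous_on (polydisc n b e) f" "a \<in> polydisc n b e"
  obtains r where "0 < r" "polydisc n a r \<subseteq> polydisc n b e" "\<And>z. z \<in> polydisc n a r \<Longrightarrow> norm (f z) \<le> norm (f a) + 1"
proof -
  have a: "a \<in> cspace n" using assms(2) polydisc_subset_cspace by blast
  have "(f \<longlongrightarrow> f a) (at a within polydisc n b e)" using assms by (simp add: continuous_on_def)
  then have "eventually (\<lambda>z. dist (f z) (f a) < 1) (at a within polydisc n b e)"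
    by (rule tendstoD) simp
  then obtain S where "open S" "a \<in> S" and S: "\<And>z. z \<in> S \<Longrightarrow> z \<noteq> a \<Longrightarrow> z \<in> polydisc n b e \<Longrightarrow> dist (f z) (f a) < 1"
    by (auto simp: eventually_at_topological)
  then have "openin (cEuclidean_space n) (polydisc n b e \<inter> (cspace n \<inter> S))"
    using openin_open_Int [OF \<open>open S\<close>, of "cspace n"]
    by (intro openin_Int [OF openin_polydisc]) (simp add: cEuclidean_space_def)
  then obtain r where r: "0 < r" "polydisc n a r \<subseteq> polydisc n b e \<inter> (cspace n \<inter> S)"
    using assms(2) a \<open>a \<in> S\<close> unfolding openin_cspace_iff by (metis IntI)
  have "norm (f z) \<le> norm (f a) + 1" if "z \<in> polydisc n a r" for z
  proof (cases "z = a")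
    case False
    then have "dist (f z) (f a) < 1" using S r that by blast
    then show ?thesis using norm_triangle_ineq2 [of "f z" "f a"] by (simp add: dist_norm)
  qed auto
  then show thesis using that r by blast
qed

text \<open>Taylor's formula of order one on the disc of radius \<open>r / 4\<close> about
  \<open>w\<close>. Around each of its points a circle of radius \<open>r / 8\<close> still lies in
  \<open>ball c r\<close>, so Cauchy's estimate bounds the second derivative by
  \<open>2 * (B + 1) / (r / 8)^2\<close>, which is where 128 comes from. The bound is
  \<open>B + 1\<close> because the Cauchy estimate wants the values in an open ball.\<close>

lemma holomorphic_second_order_bound:
  assumes h: "h holomorphic_on ball c r" and B: "\<And>w. w \<in> ball c r \<Longrightarrow> norm (h w) \<le> B"
    and w: "w \<in> ball c (r / 2)" and u: "norm u < r / 4"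
  shows "norm (h (w + u) - h w - deriv h w * u) \<le> 128 * (B + 1) / r\<^sup>2 * (norm u)\<^sup>2"
proof -
  have r: "0 < r" using u norm_ge_zero [of u] by linarith
  have sub: "ball w (r / 4) \<subseteq> ball c r"
  proof
    fix x assume "x \<in> ball w (r/4)"
    then show "x \<in> ball c r" using w dist_triangle [of c x w] r by auto
  qed
  have diff: "((deriv ^^ k) h has_field_derivative (deriv ^^ Suc k) h x) (at x within ball w (r / 4))"
    if "x \<in> ball w (r / 4)" for k x
  proof -
    have "(deriv ^^ k) h holomorphic_on ball c r" using h by (intro holomorphic_higher_deriv) auto
    then have "((deriv ^^ k) h has_field_derivative deriv ((deriv ^^ k) h) x) (at x)"
      using that sub by (intro holomorphic_derivI [of _ "ball c r"]) auto
    then show ?thesis by (auto intro: has_field_derivative_at_within)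
  qed
  have "norm (h (w + u) - (\<Sum>i\<le>1. (deriv ^^ i) h w * (w + u - w) ^ i / fact i))
      \<le> (fact 2 * (B + 1) / (r / 8) ^ 2) * norm (w + u - w) ^ Suc 1 / fact 1"
  proof (rule complex_Taylor [where S = "ball w (r/4)" and f = "\<lambda>i. (deriv ^^ i) h", simplified funpow_0])
    show "norm ((deriv ^^ Suc 1) h x) \<le> fact 2 * (B + 1) / (r / 8) ^ 2" if x: "x \<in> ball w (r / 4)" for x
    proof -
      have sub2: "cball x (r / 8) \<subseteq> ball c r"
      proof
        fix y assume "y \<in> cball x (r/8)"
        then show "y \<in> ball c r"
          using x w dist_triangle [of c y x] dist_triangle [of c x w] r by auto
      qed
      have "norm ((deriv ^^ 2) h x) \<le> fact 2 * (B + 1) / (r / 8) ^ 2"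
      proof (rule Cauchy_higher_deriv_bound [where y = 0])
        show "h holomorphic_on ball x (r / 8)"
          using sub2 ball_subset_cball by (intro holomorphic_on_subset [OF h]) blast
        show "continuous_on (cball x (r / 8)) h"
          using sub2 h by (meson continuous_on_subset holomorphic_on_imp_continuous_on)
        show "h y \<in> ball 0 (B + 1)" if "y \<in> ball x (r / 8)" for y
          using B [of y] sub2 that by (force simp: subset_iff)
      qed (use r in auto)
      then show ?thesis by (simp add: numeral_2_eq_2)
    qed
  qed (use diff u r in \<open>auto simp: dist_norm\<close>)
  then show ?thesis
    by (simp add: field_simps power2_eq_square)
qed

lemma separately_holomorphic_second_order_bound:
  assumes f: "separately_holomorphic n a r f" and B: "\<And>z. z \<in> polydisc n a r \<Longrightarrow> norm (f z) \<le> B"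
    and z: "z \<in> polydisc n a (r / 2)" and i: "i < n" and u: "norm u < r / 4"
  shows "norm (f (z(i := z i + u)) - f z - pd i f z * u) \<le> 128 * (B + 1) / r\<^sup>2 * (norm u)\<^sup>2"
proof -
  have r: "0 < r" using u norm_ge_zero [of u] by linarith
  have zr: "z \<in> polydisc n a r" using z polydisc_mono [of "r/2" r n a] r by auto
  have zi: "z i \<in> ball (a i) (r / 2)" using z i by (auto simp: polydisc_def dist_norm norm_minus_commute)
  have "norm (f (z(i := z i + u)) - f (z(i := z i)) - deriv (\<lambda>t. f (z(i := t))) (z i) * u)
      \<le> 128 * (B + 1) / r\<^sup>2 * (norm u)\<^sup>2"
    by (rule holomorphic_second_order_bound [of _ "a i" r])
      (use f zr i zi u upd_in_polydisc [OF zr i] B in \<open>auto simp: separately_holomorphic_def simp del: fun_upd_apply\<close>)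
  then show ?thesis by (simp add: pd_def)
qed

lemma separately_holomorphic_uniform_limit:
  assumes f: "\<And>k. separately_holomorphic n a r (f k)" and lim: "uniform_limit (polydisc n a r) f g sequentially"
  shows "separately_holomorphic n a r g"
  unfolding separately_holomorphic_def
proof (intro conjI ballI allI impI)
  show "continuous_on (polydisc n a r) g"
    by (rule uniform_limit_theorem [OF _ lim]) (use f in \<open>auto simp: separately_holomorphic_def\<close>)
  fix z i assume z: "z \<in> polydisc n a r" and i: "i < n"
  show "(\<lambda>t. g (z(i := t))) holomorphic_on ball (a i) r"
  proof (rule holomorphic_uniform_sequence [where f = "\<lambda>k t. f k (z(i := t))"])
    show "(\<lambda>t. f k (z(i := t))) holomorphic_on ball (a i) r" for k
      using f z i by (auto simp: separately_holomorphic_def)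
    fix x assume "x \<in> ball (a i) r"
    then obtain d where d: "0 < d" "cball x d \<subseteq> ball (a i) r"
      by (meson open_ball open_contains_cball)
    have "uniform_limit (cball x d) (\<lambda>k t. f k (z(i := t))) (\<lambda>t. g (z(i := t))) sequentially"
      unfolding uniform_limit_iff
    proof (intro allI impI)
      fix \<epsilon> :: real assume "\<epsilon> > 0"
      with lim have "\<forall>\<^sub>F k in sequentially. \<forall>y\<in>polydisc n a r. dist (f k y) (g y) < \<epsilon>"
        by (auto simp: uniform_limit_iff)
      then show "\<forall>\<^sub>F k in sequentially. \<forall>t\<in>cball x d. dist (f k (z(i := t))) (g (z(i := t))) < \<epsilon>"
        by eventually_elim (use d upd_in_polydisc [OF z i] in blast)
    qed
    with d show "\<exists>d>0. cball x d \<subseteq> ball (a i) r \<and>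
        uniform_limit (cball x d) (\<lambda>k t. f k (z(i := t))) (\<lambda>t. g (z(i := t))) sequentially" by blast
  qed auto
qed

lemma continuous_on_fun_upd_shift:
  "continuous_on S (\<lambda>z :: nat \<Rightarrow> complex. z(i := z i + u))"
proof (rule continuous_on_coordinatewise_then_product)
  fix k
  show "continuous_on S (\<lambda>z :: nat \<Rightarrow> complex. (z(i := z i + u)) k)"
    by (cases "k = i") (auto intro!: continuous_intros continuous_on_product_coordinates intro: continuous_on_subset [OF continuous_on_product_coordinates])
qed

text \<open>The partial derivative is the limit of difference quotients with steps
  \<open>u k\<close>. The second order bound has a constant independent of \<open>z\<close>, so the
  convergence is uniform, and the class is closed under uniform limits.\<close>

lemma separately_holomorphic_pd:
  assumes f: "separately_holomorphic n a r f" and B: "\<And>z. z \<in> polydisc n a r \<Longrightarrow> norm (f z) \<le> B"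
    and i: "i < n" and r: "0 < r"
  shows "separately_holomorphic n a (r / 2) (pd i f)"
proof -
  define C where "C = 128 * (B + 1) / r\<^sup>2"
  \<comment> \<open>A null sequence of nonzero steps. The offset 8 keeps them at most
    \<open>r / 8\<close>, below the \<open>r / 4\<close> that the second order bound
    demands.\<close>
  define u :: "nat \<Rightarrow> complex" where "u k = of_real (r / (8 + real k))" for k
  have u: "u k \<noteq> 0" "norm (u k) < r / 4" "norm (u k) = r / (8 + real k)" for k
    using r by (auto simp: u_def norm_divide divide_simps simp flip: of_real_add)
  have half: "polydisc n a (r / 2) \<subseteq> polydisc n a r" using r by (intro polydisc_mono) auto
  have shift: "z(i := z i + u k) \<in> polydisc n a r" if "z \<in> polydisc n a (r / 2)" for z k
  proof -
    have "norm (z i - a i) < r / 2" using that i by (auto simp: polydisc_def)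
    then have "norm (z i + u k - a i) < r"
      using norm_triangle_ineq [of "z i - a i" "u k"] u(2) [of k] r by (auto simp: algebra_simps)
    then show ?thesis using upd_in_polydisc [OF subsetD [OF half that] i]
      by (simp add: dist_norm norm_minus_commute)
  qed
  show ?thesis
  proof (rule separately_holomorphic_uniform_limit [where f = "\<lambda>k z. (f (z(i := z i + u k)) - f z) / u k"])
    show "separately_holomorphic n a (r / 2) (\<lambda>z. (f (z(i := z i + u k)) - f z) / u k)" for k
      unfolding separately_holomorphic_def
    proof (intro conjI ballI allI impI)
      have cf: "continuous_on (polydisc n a r) f" using f by (simp add: separately_holomorphic_def)
      have "continuous_on (polydisc n a (r/2)) (\<lambda>z. f (z(i := z i + u k)))"
        by (rule continuous_on_compose2 [OF cf continuous_on_fun_upd_shift]) (use shift in blast)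
      moreover have "continuous_on (polydisc n a (r/2)) f" using cf half by (rule continuous_on_subset)
      ultimately show "continuous_on (polydisc n a (r/2)) (\<lambda>z. (f (z(i := z i + u k)) - f z) / u k)"
        using u(1) by (intro continuous_intros) auto
      fix z j assume z: "z \<in> polydisc n a (r/2)" and j: "j < n"
      have zr: "z \<in> polydisc n a r" using z half by blast
      have balls: "ball (a j) (r/2) \<subseteq> ball (a j) r" using r by auto
      have "(\<lambda>t. f ((z(j := t))(i := (z(j := t)) i + u k))) holomorphic_on ball (a j) (r/2)"
      proof (cases "i = j")
        case True
        \<comment> \<open>In the shifted direction itself the slice of the shifted function is a
          translate of a slice of \<open>f\<close>; in any other direction it is a slice through the
          shifted point.\<close>
        have "(\<lambda>t. f (z(j := t))) \<circ> (\<lambda>t. t + u k) holomorphic_on ball (a j) (r / 2)"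
        proof (rule holomorphic_on_compose)
          show "(\<lambda>t. f (z(j := t))) holomorphic_on (\<lambda>t. t + u k) ` ball (a j) (r / 2)"
          proof (rule holomorphic_on_subset)
            show "(\<lambda>t. f (z(j := t))) holomorphic_on ball (a j) r"
              using f zr j by (auto simp: separately_holomorphic_def)
            show "(\<lambda>t. t + u k) ` ball (a j) (r / 2) \<subseteq> ball (a j) r"
            proof safe
              fix t assume "t \<in> ball (a j) (r/2)"
              then show "t + u k \<in> ball (a j) r"
                using u(2) [of k] norm_triangle_ineq [of "a j - t" "- u k"] r
                by (auto simp: dist_norm algebra_simps)
            qed
          qed
        qed (intro holomorphic_intros)
        then show ?thesis by (simp add: o_def True)
      next
        case False
        have "(z(j := t))(i := (z(j := t)) i + u k) = (z(i := z i + u k))(j := t)" for t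
          using False by (simp add: fun_upd_twist)
        moreover have "(\<lambda>t. f ((z(i := z i + u k))(j := t))) holomorphic_on ball (a j) r"
          using f shift [OF z] j unfolding separately_holomorphic_def by blast
        ultimately show ?thesis using balls by (auto intro: holomorphic_on_subset)
      qed
      moreover have "(\<lambda>t. f (z(j := t))) holomorphic_on ball (a j) (r/2)"
        using f zr j balls unfolding separately_holomorphic_def by (meson holomorphic_on_subset)
      ultimately show "(\<lambda>t. (f ((z(j := t))(i := (z(j := t)) i + u k)) - f (z(j := t))) / u k) holomorphic_on ball (a j) (r/2)"
        using u(1) by (intro holomorphic_intros) auto
    qed
    have bound: "dist ((f (z(i := z i + u k)) - f z) / u k) (pd i f z) \<le> C * norm (u k)"
      if z: "z \<in> polydisc n a (r/2)" for z k
    proof -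
      have "norm (f (z(i := z i + u k)) - f z - pd i f z * u k) \<le> C * (norm (u k))\<^sup>2"
        unfolding C_def by (rule separately_holomorphic_second_order_bound) (use f B z i u in auto)
      moreover have "(f (z(i := z i + u k)) - f z) / u k - pd i f z
          = (f (z(i := z i + u k)) - f z - pd i f z * u k) / u k"
        using u(1) [of k] by (simp add: divide_simps)
      ultimately show ?thesis using u(1) [of k]
        by (simp add: dist_norm norm_divide divide_simps power2_eq_square mult_ac)
    qed
    have lim0: "(\<lambda>k. C * norm (u k)) \<longlonglongrightarrow> 0"
      unfolding u(3) by real_asymp
    show "uniform_limit (polydisc n a (r/2)) (\<lambda>k z. (f (z(i := z i + u k)) - f z) / u k) (pd i f) sequentially"
      unfolding uniform_limit_iff
    proof (intro allI impI)
      fix \<epsilon> :: real assume "\<epsilon> > 0"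
      with lim0 have "\<forall>\<^sub>F k in sequentially. C * norm (u k) < \<epsilon>" by (rule order_tendstoD)
      then show "\<forall>\<^sub>F k in sequentially. \<forall>z\<in>polydisc n a (r/2). dist ((f (z(i := z i + u k)) - f z) / u k) (pd i f z) < \<epsilon>"
        by eventually_elim (use bound in \<open>blast intro: le_less_trans\<close>)
    qed
  qed
qed

text \<open>Moving from \<open>a\<close> to \<open>z\<close> one coordinate at a time, the difference quotients of \<open>f\<close> along the
  steps are the coefficients in Caratheodory's form.\<close>

lemma separately_holomorphic_cdiff_at_centre:
  assumes f: "separately_holomorphic n a r f" and B: "\<And>z. z \<in> polydisc n a r \<Longrightarrow> norm (f z) \<le> B"
    and a: "a \<in> cspace n" and r: "0 < r"
  shows "cdiff_at n f a"
proof -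
  define C where "C = 128 * (B + 1) / r\<^sup>2"
  define \<zeta> where "\<zeta> i z = (\<lambda>k. if k < i then z k else a k)" for i and z :: "nat \<Rightarrow> complex"
  \<comment> \<open>If the i-th step is trivial, the quotient would be 0/0 and is replaced by its
    limiting value.\<close>
  define q where "q i z = (if z i = a i then pd i f (\<zeta> i z) else (f (\<zeta> (Suc i) z) - f (\<zeta> i z)) / (z i - a i))" for i z
  have \<zeta>a: "\<zeta> i a = a" for i by (auto simp: \<zeta>_def)
  have \<zeta>n: "\<zeta> n z = z" if "z \<in> cspace n" for z using that a by (auto simp: \<zeta>_def cspace_def)
  have \<zeta>0: "\<zeta> 0 z = a" for z by (auto simp: \<zeta>_def)
  have \<zeta>Suc: "\<zeta> (Suc i) z = (\<zeta> i z)(i := \<zeta> i z i + (z i - a i))" for i z by (auto simp: \<zeta>_def)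
  have \<zeta>_in: "\<zeta> i z \<in> polydisc n a d" if "z \<in> polydisc n a d" "0 < d" for i z d
    using that a by (auto simp: \<zeta>_def polydisc_def cspace_def)
  show ?thesis
  proof (rule cdiff_atI [OF openin_polydisc centre_in_polydisc [OF a, of "r/4"]])
    show "f z = f a + (\<Sum>i<n. q i z * (z i - a i))" if z: "z \<in> polydisc n a (r / 4)" for z
    proof -
      have "q i z * (z i - a i) = f (\<zeta> (Suc i) z) - f (\<zeta> i z)" for i
        by (cases "z i = a i") (auto simp: q_def \<zeta>Suc)
      then have "(\<Sum>i<n. q i z * (z i - a i)) = f (\<zeta> n z) - f (\<zeta> 0 z)"
        using sum_lessThan_telescope [of "\<lambda>i. f (\<zeta> i z)" n] by simp
      then show ?thesis using \<zeta>n [of z] \<zeta>0 subsetD [OF polydisc_subset_cspace z] by simp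
    qed
    fix i assume i: "i < n"
    \<comment> \<open>Compares the coefficient with the partial derivative at the intermediate
      point, uniformly in \<open>z\<close>. What then remains is the continuity of
      \<open>pd i f\<close>, since \<open>\<zeta> i z\<close> tends to \<open>a\<close>. The radius
      \<open>r / 4\<close> is the largest step for which the second order bound is
      available.\<close>
    have near: "norm (q i z - pd i f (\<zeta> i z)) \<le> C * norm (z i - a i)" if z: "z \<in> polydisc n a (r / 4)" for z
    proof (cases "z i = a i")
      case False
      have "norm (f ((\<zeta> i z)(i := \<zeta> i z i + (z i - a i))) - f (\<zeta> i z) - pd i f (\<zeta> i z) * (z i - a i))
          \<le> C * (norm (z i - a i))\<^sup>2"
        unfolding C_def
      proof (rule separately_holomorphic_second_order_bound [OF f B _ i])
        show "\<zeta> i z \<in> polydisc n a (r/2)"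
          using z polydisc_mono [of "r/4" "r/2" n a] r by (intro \<zeta>_in) auto
        show "norm (z i - a i) < r / 4" using z i by (auto simp: polydisc_def)
      qed
      moreover have "f ((\<zeta> i z)(i := \<zeta> i z i + (z i - a i))) - f (\<zeta> i z) - pd i f (\<zeta> i z) * (z i - a i)
          = (q i z - pd i f (\<zeta> i z)) * (z i - a i)"
        unfolding left_diff_distrib using False by (simp add: q_def \<zeta>Suc)
      ultimately have "norm (q i z - pd i f (\<zeta> i z)) * norm (z i - a i) \<le> C * norm (z i - a i) * norm (z i - a i)"
        by (simp add: norm_mult power2_eq_square mult.assoc)
      then show ?thesis using False by (simp add: mult_le_cancel_right)
    qed (simp add: q_def)
    have ev: "eventually (\<lambda>z. z \<in> polydisc n a (r/4)) (at a within cspace n)"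
      using r by (intro eventually_at_cspace [OF openin_polydisc centre_in_polydisc [OF a]]) auto
    have "((\<lambda>z. q i z - pd i f (\<zeta> i z)) \<longlongrightarrow> 0) (at a within cspace n)"
    proof (rule Lim_null_comparison)
      show "\<forall>\<^sub>F z in at a within cspace n. norm (q i z - pd i f (\<zeta> i z)) \<le> C * norm (z i - a i)"
        using ev by eventually_elim (rule near)
      have "((\<lambda>z. C * norm (z i - a i)) \<longlongrightarrow> C * norm (a i - a i)) (at a within cspace n)"
        by (intro tendsto_intros tendsto_coordinate)
      then show "((\<lambda>z. C * norm (z i - a i)) \<longlongrightarrow> 0) (at a within cspace n)" by simp
    qed
    moreover have "((\<lambda>z. pd i f (\<zeta> i z)) \<longlongrightarrow> pd i f a) (at a within cspace n)"
    proof (rule continuous_within_tendsto_compose [where S = "polydisc n a (r/2)" and f = "pd i f" and x = "\<zeta> i"])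
      have "continuous_on (polydisc n a (r/2)) (pd i f)"
        using separately_holomorphic_pd [OF f B i r] by (simp add: separately_holomorphic_def)
      then show "continuous (at a within polydisc n a (r/2)) (pd i f)"
        using centre_in_polydisc [OF a, of "r/2"] r by (simp add: continuous_on_eq_continuous_within)
      show "\<forall>\<^sub>F z in at a within cspace n. \<zeta> i z \<in> polydisc n a (r/2)"
        using ev by eventually_elim (use polydisc_mono [of "r/4" "r/2" n a] r in \<open>auto intro!: \<zeta>_in\<close>)
      show "(\<zeta> i \<longlongrightarrow> a) (at a within cspace n)"
        unfolding tendsto_fun_iff \<zeta>_def
      proof
        fix k
        show "((\<lambda>z. if k < i then z k else a k) \<longlongrightarrow> a k) (at a within cspace n)"
          by (cases "k < i") (auto simp: tendsto_coordinate)
      qed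
    qed
    ultimately have "((\<lambda>z. (q i z - pd i f (\<zeta> i z)) + pd i f (\<zeta> i z)) \<longlongrightarrow> 0 + pd i f a) (at a within cspace n)"
      by (rule tendsto_add)
    moreover have "q i a = pd i f a" by (simp add: q_def \<zeta>a)
    ultimately show "(q i \<longlongrightarrow> q i a) (at a within cspace n)" by simp
  qed (use r in auto)
qed

text \<open>Osgood's lemma. The estimates at a centre require a bounded function, and continuity
  provides a bound on a smaller polydisc around the given point.\<close>

lemma osgood:
  assumes f: "separately_holomorphic n b e f" and a: "a \<in> polydisc n b e"
  shows "cdiff_at n f a"
proof -
  have cs: "a \<in> cspace n" using a polydisc_subset_cspace by blast
  obtain r where r: "0 < r" "polydisc n a r \<subseteq> polydisc n b e" "\<And>z. z \<in> polydisc n a r \<Longrightarrow> norm (f z) \<le> norm (f a) + 1"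
    using f a by (auto simp: separately_holomorphic_def elim: continuous_on_cspace_bounded)
  show ?thesis
    using separately_holomorphic_cdiff_at_centre [OF separately_holomorphic_subset [OF f r(2) cs r(1)] r(3) cs r(1)] by blast
qed

section \<open>Germs of holomorphic functions and maps\<close>

text \<open>Differentiability near \<open>a\<close> rather than at \<open>a\<close> only, because
  this is what partial derivatives and uniform limits preserve. Membership of \<open>a\<close> is
  part of the definition: outside the closed set \<open>cspace n\<close> the filter is trivial and
  the second conjunct would be vacuous.\<close>

definition chol_at :: "nat \<Rightarrow> ((nat \<Rightarrow> complex) \<Rightarrow> complex) \<Rightarrow> (nat \<Rightarrow> complex) \<Rightarrow> bool" where
  "chol_at n f a \<longleftrightarrow> a \<in> cspace n \<and> eventually (cdiff_at n f) (nhds_cspace n a)"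

lemma chol_at_iff:
  "chol_at n f a \<longleftrightarrow> a \<in> cspace n \<and> (\<exists>e>0. \<forall>z\<in>polydisc n a e. cdiff_at n f z)"
  by (auto simp: chol_at_def eventually_nhds_cspace_iff)

lemma chol_at_imp_cdiff_at: "chol_at n f a \<Longrightarrow> cdiff_at n f a"
  by (auto simp: chol_at_def intro: eventually_nhds_cspace_imp)

lemma cholomorphic_on_iff_chol_at:
  assumes "openin (cEuclidean_space n) U"
  shows "cholomorphic_on n U f \<longleftrightarrow> (\<forall>a\<in>U. chol_at n f a)"
proof
  assume L: "cholomorphic_on n U f"
  show "\<forall>a\<in>U. chol_at n f a"
  proof
    fix a assume a: "a \<in> U"
    then show "chol_at n f a"
      using L assms unfolding chol_at_def cholomorphic_on_iff_cdiff_at [OF assms]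
      by (auto simp: openin_cspace_iff intro: eventually_nhds_cspaceI [OF assms])
  qed
qed (auto simp: cholomorphic_on_iff_cdiff_at [OF assms] intro: chol_at_imp_cdiff_at)

lemma chol_at_eventually:
  assumes "chol_at n f a" shows "eventually (chol_at n f) (nhds_cspace n a)"
  using eventually_nhds_cspace_eventually [of a n "cdiff_at n f"] assms eventually_nhds_cspace_mem [of n a]
  unfolding chol_at_def by (auto elim: eventually_elim2)

lemma chol_at_cong:
  assumes "a \<in> cspace n" "eventually (\<lambda>z. f z = g z) (nhds_cspace n a)"
  shows "chol_at n f a \<longleftrightarrow> chol_at n g a"
proof -
  have "eventually (\<lambda>z. cdiff_at n f z = cdiff_at n g z) (nhds_cspace n a)"
    using eventually_nhds_cspace_eventually [OF assms] eventually_nhds_cspace_mem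
    by eventually_elim (rule cdiff_at_cong)
  then show ?thesis unfolding chol_at_def by (auto elim: eventually_elim2)
qed

lemma chol_at_const: "a \<in> cspace n \<Longrightarrow> chol_at n (\<lambda>z. c) a"
  by (simp add: chol_at_def cdiff_at_const always_eventually)

lemma chol_at_coordinate: "a \<in> cspace n \<Longrightarrow> chol_at n (\<lambda>z. z i) a"
  unfolding chol_at_def using eventually_nhds_cspace_mem [of n a]
  by (auto elim!: eventually_mono intro: cdiff_at_coordinate)

lemma chol_at_add: "chol_at n f a \<Longrightarrow> chol_at n g a \<Longrightarrow> chol_at n (\<lambda>z. f z + g z) a"
  unfolding chol_at_def by (auto elim: eventually_elim2 intro: cdiff_at_add)

lemma chol_at_mult: "chol_at n f a \<Longrightarrow> chol_at n g a \<Longrightarrow> chol_at n (\<lambda>z. f z * g z) a"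
  unfolding chol_at_def by (auto elim: eventually_elim2 intro: cdiff_at_mult)

lemma chol_at_sum:
  assumes "a \<in> cspace n" "\<And>k. k \<in> K \<Longrightarrow> chol_at n (f k) a"
  shows "chol_at n (\<lambda>z. \<Sum>k\<in>K. f k z) a"
  using assms(2)
proof (induction K rule: infinite_finite_induct)
  case (insert k K)
  then have "chol_at n (\<lambda>z. f k z + (\<Sum>k\<in>K. f k z)) a" by (intro chol_at_add) auto
  then show ?case using insert by simp
qed (use assms(1) in \<open>auto simp: chol_at_const\<close>)

lemma chol_at_power: "chol_at n f a \<Longrightarrow> chol_at n (\<lambda>z. f z ^ k) a"
  by (induction k) (auto simp: chol_at_const chol_at_mult chol_at_def [of n _ a, THEN iffD1, THEN conjunct1])

text \<open>Here \<open>G\<close> takes values in \<open>cspace n\<close> only near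
  \<open>a\<close>. Cutting its values off at index \<open>n\<close> gives a map \<open>G'\<close>
  to which the pointwise chain rule applies and which has the same germ.\<close>

lemma chol_at_compose:
  assumes a: "a \<in> cspace m" and G: "eventually (\<lambda>z. G z \<in> cspace n) (nhds_cspace m a)"
    and g: "\<And>j. j < n \<Longrightarrow> chol_at m (\<lambda>z. G z j) a" and F: "chol_at n F (G a)"
  shows "chol_at m (\<lambda>z. F (G z)) a"
proof -
  define G' where "G' z = (\<lambda>j. if j < n then G z j else 0)" for z
  have G': "G' z \<in> cspace n" for z by (auto simp: G'_def cspace_def)
  have GG': "G' z = G z" if "G z \<in> cspace n" for z using that by (auto simp: G'_def cspace_def)
  obtain e where e: "e > 0" "\<And>z. z \<in> polydisc n (G a) e \<Longrightarrow> cdiff_at n F z"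
    using F by (auto simp: chol_at_iff)
  have "eventually (\<lambda>z. \<forall>j\<in>{..<n}. norm (G z j - G a j) < e \<and> cdiff_at m (\<lambda>z. G z j) z) (nhds_cspace m a)"
  proof (intro eventually_ball_finite ballI eventually_conj)
    fix j assume "j \<in> {..<n}"
    then have gj: "chol_at m (\<lambda>z. G z j) a" using g by auto
    then show "eventually (cdiff_at m (\<lambda>z. G z j)) (nhds_cspace m a)" by (simp add: chol_at_def)
    have "((\<lambda>z. G z j) \<longlongrightarrow> G a j) (at a within cspace m)"
      by (rule cdiff_at_tendsto [OF chol_at_imp_cdiff_at [OF gj]])
    then have "\<forall>\<^sub>F z in at a within cspace m. dist (G z j) (G a j) < e"
      using e(1) by (rule tendstoD)
    then show "\<forall>\<^sub>F z in nhds_cspace m a. norm (G z j - G a j) < e"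
      using e(1) by (auto simp: eventually_at_filter eventually_inf_principal dist_norm elim!: eventually_mono)
  qed auto
  with eventually_nhds_cspace_eventually [OF a G] eventually_nhds_cspace_mem G
  have "eventually (cdiff_at m (\<lambda>z. F (G z))) (nhds_cspace m a)"
  proof eventually_elim
    case (elim z)
    have eq: "eventually (\<lambda>z. G' z = G z) (nhds_cspace m z)"
      using elim(1) by eventually_elim (rule GG')
    have "cdiff_at m (\<lambda>z. F (G' z)) z"
    proof (rule cdiff_at_compose [OF elim(2) G'])
      show "cdiff_at m (\<lambda>z. G' z j) z" if "j < n" for j
      proof -
        have "cdiff_at m (\<lambda>z. G z j) z" using elim that by blast
        then show ?thesis using that by (simp add: G'_def)
      qed
      have "G z \<in> polydisc n (G a) e" using elim by (auto simp: polydisc_def)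
      then show "cdiff_at n F (G' z)" using e(2) GG' elim by auto
    qed
    moreover have "eventually (\<lambda>z. F (G' z) = F (G z)) (nhds_cspace m z)"
      using eq by eventually_elim simp
    ultimately show ?case using cdiff_at_cong [OF elim(2), of "\<lambda>z. F (G' z)" "\<lambda>z. F (G z)"] by simp
  qed
  then show ?thesis using a by (simp add: chol_at_def)
qed

text \<open>The detour through separate holomorphy: the difference quotients converge within that
  class, and Osgood's lemma leads back to Frechet derivatives. This is what allows the Lie
  derivative to be iterated.\<close>

lemma chol_at_pd:
  assumes f: "chol_at n f a" and i: "i < n"
  shows "chol_at n (pd i f) a"
proof -
  obtain e where a: "a \<in> cspace n" and e: "0 < e" "\<And>z. z \<in> polydisc n a e \<Longrightarrow> cdiff_at n f z"
    using f by (auto simp: chol_at_iff)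
  have sf: "separately_holomorphic n a e f" by (rule cdiff_at_imp_separately_holomorphic) (rule e)
  obtain r where r: "0 < r" "polydisc n a r \<subseteq> polydisc n a e" "\<And>z. z \<in> polydisc n a r \<Longrightarrow> norm (f z) \<le> norm (f a) + 1"
    using sf centre_in_polydisc [OF a e(1)] by (auto simp: separately_holomorphic_def elim: continuous_on_cspace_bounded)
  have "separately_holomorphic n a (r/2) (pd i f)"
    by (rule separately_holomorphic_pd [OF separately_holomorphic_subset [OF sf r(2) a r(1)] r(3) i r(1)])
  then have "\<forall>z\<in>polydisc n a (r/2). cdiff_at n (pd i f) z" using osgood by blast
  then show ?thesis using a r(1) by (auto simp: chol_at_iff intro!: exI [of _ "r/2"])
qed

text \<open>Weierstrass's convergence theorem in several variables, by the same detour.\<close>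

lemma chol_at_uniform_limit:
  assumes "\<And>k z. z \<in> polydisc n a r \<Longrightarrow> chol_at n (f k) z" "uniform_limit (polydisc n a r) f g sequentially"
    and "a \<in> cspace n" "0 < r"
  shows "chol_at n g a"
proof -
  have "separately_holomorphic n a r (f k)" for k
    by (rule cdiff_at_imp_separately_holomorphic) (use assms chol_at_imp_cdiff_at in blast)
  then have "separately_holomorphic n a r g" using assms(2) by (rule separately_holomorphic_uniform_limit)
  then show ?thesis using osgood assms(3,4) by (auto simp: chol_at_iff)
qed

section \<open>Charts of a complex manifold and neighbourhood filters\<close>

lemma in_charts_at: "c \<in> charts_at M p \<longleftrightarrow> c \<in> atlas M \<and> p \<in> fst c"
  by (auto simp: charts_at_def)

lemma charts_at_nonempty: "complex_manifold M \<Longrightarrow> p \<in> points M \<Longrightarrow> \<exists>c. c \<in> charts_at M p"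
proof -
  assume "complex_manifold M" "p \<in> points M"
  then have "p \<in> (\<Union>c\<in>atlas M. fst c)" by (simp add: complex_manifold_def)
  then show "\<exists>c. c \<in> charts_at M p" unfolding charts_at_def by blast
qed

context
  fixes M :: "'a cmfd" and c :: "'a chart"
  assumes M: "complex_manifold M" and c: "c \<in> atlas M"
begin

lemma is_chartD: "is_chart (mtop M) (mdim M) c"
  using M c by (auto simp: complex_manifold_def)

lemma chart_open: "openin (mtop M) (fst c)"
  and chart_image_open: "openin (cEuclidean_space (mdim M)) (snd c ` fst c)"
  and chart_homeomorphic: "homeomorphic_map (subtopology (mtop M) (fst c))
      (subtopology (cEuclidean_space (mdim M)) (snd c ` fst c)) (snd c)"
  using is_chartD by (auto simp: is_chart_def)

lemma chart_subset: "fst c \<subseteq> points M"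
  using chart_open by (rule openin_subset)

lemma chart_inj: "inj_on (snd c) (fst c)"
  using homeomorphic_imp_injective_map [OF chart_homeomorphic] chart_subset
  by (simp add: inf.absorb2)

lemma chart_inv_chart: "x \<in> fst c \<Longrightarrow> chart_inv c (snd c x) = x"
  by (simp add: chart_inv_def inv_into_f_f chart_inj)

lemma chart_chart_inv: "z \<in> snd c ` fst c \<Longrightarrow> snd c (chart_inv c z) = z"
  by (simp add: chart_inv_def f_inv_into_f)

lemma chart_inv_in: "z \<in> snd c ` fst c \<Longrightarrow> chart_inv c z \<in> fst c"
  by (simp add: chart_inv_def inv_into_into)

lemma chart_in_cspace: "x \<in> fst c \<Longrightarrow> snd c x \<in> cspace (mdim M)"
  using chart_image_open unfolding openin_cspace_iff by blast

lemma chart_image_of_open: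
  assumes "openin (mtop M) W" "W \<subseteq> fst c"
  shows "openin (cEuclidean_space (mdim M)) (snd c ` W)"
proof -
  have "openin (subtopology (mtop M) (fst c)) W"
    using assms by (simp add: openin_open_subtopology chart_open)
  then have "openin (subtopology (cEuclidean_space (mdim M)) (snd c ` fst c)) (snd c ` W)"
    using homeomorphic_imp_open_map [OF chart_homeomorphic] by (simp add: open_map_def)
  then show ?thesis using chart_image_open by (simp add: openin_open_subtopology)
qed

lemma chart_vimage_of_open:
  assumes "openin (cEuclidean_space (mdim M)) V"
  shows "openin (mtop M) {x \<in> fst c. snd c x \<in> V}"
proof -
  have cm: "continuous_map (subtopology (mtop M) (fst c)) (cEuclidean_space (mdim M)) (snd c)"
    using homeomorphic_imp_continuous_map [OF chart_homeomorphic] by (simp add: continuous_map_in_subtopology)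
  have "openin (subtopology (mtop M) (fst c)) {x \<in> topspace (subtopology (mtop M) (fst c)). snd c x \<in> V}"
    by (rule openin_continuous_map_preimage [OF cm assms])
  moreover have "topspace (subtopology (mtop M) (fst c)) = fst c" using chart_subset by auto
  ultimately have "openin (subtopology (mtop M) (fst c)) {x \<in> fst c. snd c x \<in> V}" by (simp only:)
  then show ?thesis using chart_open by (rule openin_trans_full)
qed

text \<open>A chart is a homeomorphism onto an open subset of \<open>cspace (mdim M)\<close>, so it
  identifies neighbourhoods of a point with neighbourhoods of its coordinate vector. All later
  passages between a manifold and its coordinates rest on this.\<close>

lemma eventually_chart:
  assumes p: "p \<in> fst c"
  shows "eventually Q (nhds_cspace (mdim M) (snd c p)) \<longleftrightarrow> eventually (\<lambda>x. Q (snd c x)) (nhdsin (mtop M) p)"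
proof
  assume "eventually Q (nhds_cspace (mdim M) (snd c p))"
  then obtain e where e: "e > 0" "\<forall>z\<in>polydisc (mdim M) (snd c p) e. Q z"
    using chart_in_cspace [OF p] by (auto simp: eventually_nhds_cspace_iff)
  show "eventually (\<lambda>x. Q (snd c x)) (nhdsin (mtop M) p)"
    unfolding eventually_nhdsin
  proof (intro disjI2 exI conjI ballI)
    show "openin (mtop M) {x \<in> fst c. snd c x \<in> polydisc (mdim M) (snd c p) e}"
      by (rule chart_vimage_of_open [OF openin_polydisc])
  qed (use e p centre_in_polydisc [OF chart_in_cspace [OF p]] in auto)
next
  assume "eventually (\<lambda>x. Q (snd c x)) (nhdsin (mtop M) p)"
  then obtain S where S: "openin (mtop M) S" "p \<in> S" "\<forall>x\<in>S. Q (snd c x)"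
    using p chart_subset by (auto simp: eventually_nhdsin)
  show "eventually Q (nhds_cspace (mdim M) (snd c p))"
  proof (rule eventually_nhds_cspaceI)
    show "openin (cEuclidean_space (mdim M)) (snd c ` (S \<inter> fst c))"
      using S chart_open by (intro chart_image_of_open) auto
  qed (use S p in auto)
qed

lemma eventually_in_chart: "p \<in> fst c \<Longrightarrow> eventually (\<lambda>x. x \<in> fst c) (nhdsin (mtop M) p)"
  using chart_open by (auto simp: eventually_nhdsin)

lemma eventually_chart_inv:
  assumes p: "p \<in> fst c"
  shows "eventually P (nhdsin (mtop M) p) \<longleftrightarrow> eventually (\<lambda>z. P (chart_inv c z)) (nhds_cspace (mdim M) (snd c p))"
proof -
  have "eventually (\<lambda>x. P x = P (chart_inv c (snd c x))) (nhdsin (mtop M) p)"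
    using eventually_in_chart [OF p] by eventually_elim (simp add: chart_inv_chart)
  then show ?thesis unfolding eventually_chart [OF p] by (rule eventually_subst)
qed

end

section \<open>Germs of holomorphic functions and maps on manifolds\<close>

lemma eventually_nhdsin_imp: "eventually P (nhdsin T p) \<Longrightarrow> p \<in> topspace T \<Longrightarrow> P p"
  by (auto simp: eventually_nhdsin)

lemma eventually_nhdsin_eventually:
  "eventually P (nhdsin T p) \<Longrightarrow> eventually (\<lambda>x. eventually P (nhdsin T x)) (nhdsin T p)"
  by (auto simp: eventually_nhdsin)

lemma eventually_nhdsin_topspace: "eventually (\<lambda>x. x \<in> topspace T) (nhdsin T p)"
  by (auto simp: eventually_nhdsin)

definition hfun_at :: "'a cmfd \<Rightarrow> ('a \<Rightarrow> complex) \<Rightarrow> 'a \<Rightarrow> bool" where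
  "hfun_at M h p \<longleftrightarrow> (\<exists>c\<in>charts_at M p. chol_at (mdim M) (\<lambda>z. h (chart_inv c z)) (snd c p))"

text \<open>The limit condition is continuity at \<open>p\<close>. It guarantees that near
  \<open>p\<close> the values of \<open>f\<close> lie in the domain of \<open>d\<close>; otherwise
  the last condition could concern values of \<open>snd d\<close> outside that domain, which are
  arbitrary.\<close>

definition hmap_at :: "'a cmfd \<Rightarrow> 'b cmfd \<Rightarrow> ('a \<Rightarrow> 'b) \<Rightarrow> 'a \<Rightarrow> bool" where
  "hmap_at M N f p \<longleftrightarrow> p \<in> points M \<and> limitin (mtop N) f (f p) (nhdsin (mtop M) p) \<and>
     (\<exists>d\<in>charts_at N (f p). \<forall>j<mdim N. hfun_at M (\<lambda>x. snd d (f x) j) p)"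

lemma chol_at_transform:
  assumes "chol_at n f a" "eventually (\<lambda>z. f z = g z) (nhds_cspace n a)"
  shows "chol_at n g a"
  using assms chol_at_cong [of a n f g] by (simp add: chol_at_def)

lemma chart_transition_chol_at:
  assumes M: "complex_manifold M" and c: "c \<in> charts_at M p" and d: "d \<in> charts_at M p"
  shows "chol_at (mdim M) (\<lambda>z. snd d (chart_inv c z) j) (snd c p)"
proof -
  have cd: "c \<in> atlas M" "d \<in> atlas M" "p \<in> fst c" "p \<in> fst d" using c d by (auto simp: charts_at_def)
  have "openin (cEuclidean_space (mdim M)) (snd c ` (fst c \<inter> fst d))"
    using cd M by (intro chart_image_of_open openin_Int chart_open) auto
  moreover have "cholomorphic_on (mdim M) (snd c ` (fst c \<inter> fst d)) (\<lambda>z. snd d (chart_inv c z) j)"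
    using M cd unfolding complex_manifold_def by blast
  ultimately show ?thesis using cd by (auto simp: cholomorphic_on_iff_chol_at)
qed

text \<open>\<open>hfun_at\<close> asks for a single chart. Any other one differs from it by a
  transition map, which is holomorphic, so the chart may be chosen to suit each argument.\<close>

lemma hfun_at_chart:
  assumes M: "complex_manifold M" and h: "hfun_at M h p" and c: "c \<in> charts_at M p"
  shows "chol_at (mdim M) (\<lambda>z. h (chart_inv c z)) (snd c p)"
proof -
  obtain d where d: "d \<in> charts_at M p" "chol_at (mdim M) (\<lambda>z. h (chart_inv d z)) (snd d p)"
    using h by (auto simp: hfun_at_def)
  have cd: "c \<in> atlas M" "d \<in> atlas M" "p \<in> fst c" "p \<in> fst d" using c d by (auto simp: charts_at_def)
  have ev: "eventually (\<lambda>z. chart_inv c z \<in> fst d) (nhds_cspace (mdim M) (snd c p))"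
    using eventually_in_chart [OF M cd(2,4)]
    by (simp add: eventually_chart_inv [OF M cd(1,3), where P = "\<lambda>x. x \<in> fst d"])
  have pc: "snd c p \<in> cspace (mdim M)" by (rule chart_in_cspace [OF M cd(1,3)])
  have "chol_at (mdim M) (\<lambda>z. h (chart_inv d (snd d (chart_inv c z)))) (snd c p)"
  proof (rule chol_at_compose [OF pc, where G = "\<lambda>z. snd d (chart_inv c z)" and F = "\<lambda>z. h (chart_inv d z)"])
    show "\<forall>\<^sub>F z in nhds_cspace (mdim M) (snd c p). snd d (chart_inv c z) \<in> cspace (mdim M)"
      using ev by eventually_elim (use chart_in_cspace [OF M cd(2)] in blast)
    show "chol_at (mdim M) (\<lambda>z. h (chart_inv d z)) (snd d (chart_inv c (snd c p)))"
      using d(2) chart_inv_chart [OF M cd(1,3)] by simp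
  qed (rule chart_transition_chol_at [OF M c d(1)])
  moreover have "eventually (\<lambda>z. h (chart_inv d (snd d (chart_inv c z))) = h (chart_inv c z)) (nhds_cspace (mdim M) (snd c p))"
    using ev by eventually_elim (use chart_inv_chart [OF M cd(2)] in simp)
  ultimately show ?thesis by (rule chol_at_transform)
qed

lemma hfun_at_iff_chart:
  assumes "complex_manifold M" "c \<in> charts_at M p"
  shows "hfun_at M h p \<longleftrightarrow> chol_at (mdim M) (\<lambda>z. h (chart_inv c z)) (snd c p)"
  using hfun_at_chart [OF assms(1) _ assms(2)] assms(2) by (auto simp: hfun_at_def)

lemma hfun_at_points: "complex_manifold M \<Longrightarrow> hfun_at M h p \<Longrightarrow> p \<in> points M"
  unfolding hfun_at_def charts_at_def using chart_subset by blast

lemma hfun_at_cong: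
  assumes M: "complex_manifold M" and p: "p \<in> points M" and "eventually (\<lambda>x. h x = k x) (nhdsin (mtop M) p)"
  shows "hfun_at M h p \<longleftrightarrow> hfun_at M k p"
proof -
  obtain c where c: "c \<in> charts_at M p" using charts_at_nonempty [OF M p] by blast
  then have cd: "c \<in> atlas M" "p \<in> fst c" by (auto simp: charts_at_def)
  have "eventually (\<lambda>z. h (chart_inv c z) = k (chart_inv c z)) (nhds_cspace (mdim M) (snd c p))"
    using assms(3) by (simp add: eventually_chart_inv [OF M cd, where P = "\<lambda>x. h x = k x"])
  then show ?thesis unfolding hfun_at_iff_chart [OF M c]
    by (intro chol_at_cong chart_in_cspace [OF M cd])
qed

lemma hfun_at_transform:
  assumes "complex_manifold M" "hfun_at M h p" "eventually (\<lambda>x. h x = k x) (nhdsin (mtop M) p)"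
  shows "hfun_at M k p"
  using assms(2) hfun_at_cong [OF assms(1) hfun_at_points [OF assms(1,2)] assms(3)] by simp

lemma hfun_at_eventually:
  assumes M: "complex_manifold M" and h: "hfun_at M h p"
  shows "eventually (hfun_at M h) (nhdsin (mtop M) p)"
proof -
  obtain c where c: "c \<in> charts_at M p" "chol_at (mdim M) (\<lambda>z. h (chart_inv c z)) (snd c p)"
    using h by (auto simp: hfun_at_def)
  then have cd: "c \<in> atlas M" "p \<in> fst c" by (auto simp: charts_at_def)
  have "eventually (\<lambda>x. chol_at (mdim M) (\<lambda>z. h (chart_inv c z)) (snd c x)) (nhdsin (mtop M) p)"
    using chol_at_eventually [OF c(2)] by (simp add: eventually_chart [OF M cd])
  then show ?thesis using eventually_in_chart [OF M cd]
  proof eventually_elim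
    case (elim x)
    then have "c \<in> charts_at M x" using cd by (simp add: charts_at_def)
    then show ?case using elim by (subst hfun_at_iff_chart [OF M])
  qed
qed

lemma hfun_at_const: "complex_manifold M \<Longrightarrow> p \<in> points M \<Longrightarrow> hfun_at M (\<lambda>x. k) p"
  unfolding hfun_at_def by (metis charts_at_nonempty chart_in_cspace chol_at_const in_charts_at)

lemma hfun_at_add:
  assumes "complex_manifold M" "hfun_at M h p" "hfun_at M k p"
  shows "hfun_at M (\<lambda>x. h x + k x) p"
  using assms(2) chol_at_add [OF _ hfun_at_chart [OF assms(1,3)]] unfolding hfun_at_def by blast

lemma hfun_at_mult:
  assumes "complex_manifold M" "hfun_at M h p" "hfun_at M k p"
  shows "hfun_at M (\<lambda>x. h x * k x) p"
  using assms(2) chol_at_mult [OF _ hfun_at_chart [OF assms(1,3)]] unfolding hfun_at_def by blast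

lemma hfun_at_chart_coordinate:
  assumes M: "complex_manifold M" and c: "c \<in> charts_at M p"
  shows "hfun_at M (\<lambda>x. snd c x j) p"
  unfolding hfun_at_def using chart_transition_chol_at [OF M c c] c by blast

lemma hfun_at_compose:
  assumes M: "complex_manifold M" and N: "complex_manifold N"
    and f: "hmap_at M N f p" and h: "hfun_at N h (f p)"
  shows "hfun_at M (\<lambda>x. h (f x)) p"
proof -
  obtain d where d: "d \<in> charts_at N (f p)" "\<And>j. j < mdim N \<Longrightarrow> hfun_at M (\<lambda>x. snd d (f x) j) p"
    and p: "p \<in> points M" and lim: "limitin (mtop N) f (f p) (nhdsin (mtop M) p)"
    using f by (auto simp: hmap_at_def)
  obtain c where c: "c \<in> charts_at M p" using charts_at_nonempty [OF M p] by blast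
  then have cd: "c \<in> atlas M" "p \<in> fst c" "d \<in> atlas N" "f p \<in> fst d" using d by (auto simp: charts_at_def)
  have ev: "eventually (\<lambda>x. f x \<in> fst d) (nhdsin (mtop M) p)"
    using lim chart_open [OF N cd(3)] cd(4) by (auto simp: limitin_def)
  have pc: "snd c p \<in> cspace (mdim M)" by (rule chart_in_cspace [OF M cd(1,2)])
  have "chol_at (mdim M) (\<lambda>z. h (chart_inv d (snd d (f (chart_inv c z))))) (snd c p)"
  proof (rule chol_at_compose [OF pc, where G = "\<lambda>z. snd d (f (chart_inv c z))" and F = "\<lambda>z. h (chart_inv d z)"])
    have "eventually (\<lambda>x. snd d (f x) \<in> cspace (mdim N)) (nhdsin (mtop M) p)"
      using ev by eventually_elim (use chart_in_cspace [OF N cd(3)] in blast)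
    then show "\<forall>\<^sub>F z in nhds_cspace (mdim M) (snd c p). snd d (f (chart_inv c z)) \<in> cspace (mdim N)"
      by (simp add: eventually_chart_inv [OF M cd(1,2), where P = "\<lambda>x. snd d (f x) \<in> cspace (mdim N)"])
    show "chol_at (mdim N) (\<lambda>z. h (chart_inv d z)) (snd d (f (chart_inv c (snd c p))))"
      using hfun_at_chart [OF N h d(1)] chart_inv_chart [OF M cd(1,2)] by simp
  qed (rule hfun_at_chart [OF M d(2) c])
  then have "hfun_at M (\<lambda>x. h (chart_inv d (snd d (f x)))) p"
    using c by (auto simp: hfun_at_def)
  moreover have "eventually (\<lambda>x. h (chart_inv d (snd d (f x))) = h (f x)) (nhdsin (mtop M) p)"
    using ev by eventually_elim (use chart_inv_chart [OF N cd(3)] in simp)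
  ultimately show ?thesis by (rule hfun_at_transform [OF M])
qed

text \<open>The coordinates of any chart of \<open>N\<close> are themselves holomorphic functions,
  and composing with them frees the choice of chart in the target.\<close>

lemma hmap_at_chart:
  assumes "complex_manifold M" "complex_manifold N" "hmap_at M N f p" "d \<in> charts_at N (f p)"
  shows "hfun_at M (\<lambda>x. snd d (f x) j) p"
  using hfun_at_compose [OF assms(1-3) hfun_at_chart_coordinate [OF assms(2,4)]] .

lemma hmap_at_points:
  assumes "hmap_at M N f p" shows "p \<in> points M" "f p \<in> points N"
  using assms by (auto simp: hmap_at_def limitin_def)

lemma hmap_at_compose:
  assumes M: "complex_manifold M" and N: "complex_manifold N" and L: "complex_manifold L"
    and f: "hmap_at M N f p" and g: "hmap_at N L g (f p)"
  shows "hmap_at M L (\<lambda>x. g (f x)) p"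
proof -
  have "limitin (mtop L) (\<lambda>x. g (f x)) (g (f p)) (nhdsin (mtop M) p)"
    unfolding limitin_def
  proof (intro conjI allI impI)
    show "g (f p) \<in> points L" using hmap_at_points [OF g] by simp
    fix U assume "openin (mtop L) U \<and> g (f p) \<in> U"
    then have "eventually (\<lambda>y. g y \<in> U) (nhdsin (mtop N) (f p))"
      using g by (auto simp: hmap_at_def limitin_def)
    then obtain V where V: "openin (mtop N) V" "f p \<in> V" "\<And>y. y \<in> V \<Longrightarrow> g y \<in> U"
      using hmap_at_points [OF f] by (auto simp: eventually_nhdsin)
    then have "eventually (\<lambda>x. f x \<in> V) (nhdsin (mtop M) p)" using f by (auto simp: hmap_at_def limitin_def)
    then show "eventually (\<lambda>x. g (f x) \<in> U) (nhdsin (mtop M) p)" by eventually_elim (rule V)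
  qed
  moreover obtain d where "d \<in> charts_at L (g (f p))" using charts_at_nonempty [OF L hmap_at_points(2) [OF g]] by blast
  moreover then have "hfun_at M (\<lambda>x. snd d (g (f x)) j) p" for j
    using hfun_at_compose [OF M N f hmap_at_chart [OF N L g]] by blast
  ultimately show ?thesis unfolding hmap_at_def using hmap_at_points [OF f] by blast
qed

text \<open>Continuity at \<open>p\<close> follows from the coordinates: holomorphic coordinate
  functions are continuous, and a small polydisc around \<open>snd d (f p)\<close> is carried by the
  inverse chart into any given neighbourhood of \<open>f p\<close>.\<close>

lemma hmap_atI:
  assumes M: "complex_manifold M" and N: "complex_manifold N" and p: "p \<in> points M"
    and d: "d \<in> charts_at N (f p)" and ev: "eventually (\<lambda>x. f x \<in> fst d) (nhdsin (mtop M) p)"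
    and f: "\<And>j. j < mdim N \<Longrightarrow> hfun_at M (\<lambda>x. snd d (f x) j) p"
  shows "hmap_at M N f p"
proof -
  obtain c where c: "c \<in> charts_at M p" using charts_at_nonempty [OF M p] by blast
  then have cd: "c \<in> atlas M" "p \<in> fst c" "d \<in> atlas N" "f p \<in> fst d" using d by (auto simp: charts_at_def)
  have "limitin (mtop N) f (f p) (nhdsin (mtop M) p)"
    unfolding limitin_def
  proof (intro conjI allI impI)
    show "f p \<in> points N" using chart_subset [OF N cd(3)] cd(4) by blast
    fix U assume U: "openin (mtop N) U \<and> f p \<in> U"
    then have "eventually (\<lambda>x. x \<in> U) (nhdsin (mtop N) (f p))" by (auto simp: eventually_nhdsin)
    then obtain e where e: "e > 0" "\<And>z. z \<in> polydisc (mdim N) (snd d (f p)) e \<Longrightarrow> chart_inv d z \<in> U"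
      using eventually_chart_inv [OF N cd(3,4), where P = "\<lambda>x. x \<in> U"]
      unfolding eventually_nhds_cspace_iff [OF chart_in_cspace [OF N cd(3,4)]] by blast
    have "eventually (\<lambda>z. \<forall>j\<in>{..<mdim N}. norm (snd d (f (chart_inv c z)) j - snd d (f p) j) < e) (nhds_cspace (mdim M) (snd c p))"
    proof (intro eventually_ball_finite ballI)
      fix j assume "j \<in> {..<mdim N}"
      then have "chol_at (mdim M) (\<lambda>z. snd d (f (chart_inv c z)) j) (snd c p)"
        using hfun_at_chart [OF M f c] by auto
      then have "((\<lambda>z. snd d (f (chart_inv c z)) j) \<longlongrightarrow> snd d (f (chart_inv c (snd c p))) j) (at (snd c p) within cspace (mdim M))"
        by (intro cdiff_at_tendsto chol_at_imp_cdiff_at)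
      then have "\<forall>\<^sub>F z in at (snd c p) within cspace (mdim M). dist (snd d (f (chart_inv c z)) j) (snd d (f (chart_inv c (snd c p))) j) < e"
        using e(1) by (rule tendstoD)
      then show "\<forall>\<^sub>F z in nhds_cspace (mdim M) (snd c p). norm (snd d (f (chart_inv c z)) j - snd d (f p) j) < e"
        using e(1) chart_inv_chart [OF M cd(1,2)]
        by (auto simp: eventually_at_filter eventually_inf_principal dist_norm elim!: eventually_mono)
    qed auto
    then have "eventually (\<lambda>x. \<forall>j\<in>{..<mdim N}. norm (snd d (f x) j - snd d (f p) j) < e) (nhdsin (mtop M) p)"
      by (simp add: eventually_chart_inv [OF M cd(1,2), where P = "\<lambda>x. \<forall>j\<in>{..<mdim N}. norm (snd d (f x) j - snd d (f p) j) < e"])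
    then show "eventually (\<lambda>x. f x \<in> U) (nhdsin (mtop M) p)"
      using ev
    proof eventually_elim
      case (elim x)
      then have "snd d (f x) \<in> polydisc (mdim N) (snd d (f p)) e"
        using chart_in_cspace [OF N cd(3)] by (auto simp: polydisc_def)
      then show ?case using e(2) [of "snd d (f x)"] chart_inv_chart [OF N cd(3) elim(2)] by simp
    qed
  qed
  then show ?thesis using p d f by (auto simp: hmap_at_def)
qed

lemma hmap_at_eventually:
  assumes M: "complex_manifold M" and N: "complex_manifold N" and f: "hmap_at M N f p"
  shows "eventually (hmap_at M N f) (nhdsin (mtop M) p)"
proof -
  obtain d where d: "d \<in> charts_at N (f p)" "\<And>j. j < mdim N \<Longrightarrow> hfun_at M (\<lambda>x. snd d (f x) j) p"
    and p: "p \<in> points M" and lim: "limitin (mtop N) f (f p) (nhdsin (mtop M) p)"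
    using f by (auto simp: hmap_at_def)
  then have "eventually (\<lambda>x. f x \<in> fst d) (nhdsin (mtop M) p)"
    using chart_open [OF N] by (auto simp: limitin_def charts_at_def)
  moreover have "eventually (\<lambda>x. \<forall>j\<in>{..<mdim N}. hfun_at M (\<lambda>x. snd d (f x) j) x) (nhdsin (mtop M) p)"
    by (intro eventually_ball_finite ballI hfun_at_eventually [OF M] d(2)) auto
  ultimately have "eventually (\<lambda>x. x \<in> points M \<and> d \<in> charts_at N (f x) \<and> eventually (\<lambda>x. f x \<in> fst d) (nhdsin (mtop M) x) \<and>
      (\<forall>j\<in>{..<mdim N}. hfun_at M (\<lambda>x. snd d (f x) j) x)) (nhdsin (mtop M) p)"
    using d(1) by (intro eventually_conj eventually_nhdsin_topspace eventually_nhdsin_eventually) (auto simp: charts_at_def)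
  then show ?thesis by eventually_elim (rule hmap_atI [OF M N], auto)
qed

lemma hmap_at_cong:
  assumes M: "complex_manifold M" and N: "complex_manifold N" and f: "hmap_at M N f p"
    and ev: "eventually (\<lambda>x. f x = g x) (nhdsin (mtop M) p)"
  shows "hmap_at M N g p"
proof -
  obtain d where d: "d \<in> charts_at N (f p)" "\<And>j. j < mdim N \<Longrightarrow> hfun_at M (\<lambda>x. snd d (f x) j) p"
    and p: "p \<in> points M" and lim: "limitin (mtop N) f (f p) (nhdsin (mtop M) p)"
    using f by (auto simp: hmap_at_def)
  have fg: "f p = g p" using ev p by (rule eventually_nhdsin_imp)
  show ?thesis
  proof (rule hmap_atI [OF M N p])
    show "d \<in> charts_at N (g p)" using d fg by simp
    have "eventually (\<lambda>x. f x \<in> fst d) (nhdsin (mtop M) p)"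
      using lim d chart_open [OF N] by (auto simp: limitin_def charts_at_def)
    with ev show "eventually (\<lambda>x. g x \<in> fst d) (nhdsin (mtop M) p)" by eventually_elim simp
    fix j assume "j < mdim N"
    moreover have "eventually (\<lambda>x. snd d (f x) j = snd d (g x) j) (nhdsin (mtop M) p)"
      using ev by eventually_elim simp
    ultimately show "hfun_at M (\<lambda>x. snd d (g x) j) p"
      using d(2) hfun_at_cong [OF M p, of "\<lambda>x. snd d (f x) j" "\<lambda>x. snd d (g x) j"] by simp
  qed
qed

lemma hmap_at_id:
  assumes M: "complex_manifold M" and p: "p \<in> points M"
  shows "hmap_at M M (\<lambda>x. x) p"
proof -
  obtain c where c: "c \<in> charts_at M p" using charts_at_nonempty [OF M p] by blast
  show ?thesis
  proof (rule hmap_atI [OF M M p, where d = c])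
    show "c \<in> charts_at M p" by (rule c)
    show "eventually (\<lambda>x. x \<in> fst c) (nhdsin (mtop M) p)"
      using c by (intro eventually_in_chart [OF M]) (auto simp: charts_at_def)
    show "hfun_at M (\<lambda>x. snd c x j) p" for j
      by (rule hfun_at_chart_coordinate [OF M c])
  qed
qed

text \<open>Trades the condition on all pairs of charts for one on germs, which can be checked at
  each point with a convenient chart.\<close>

lemma holomorphic_map_iff_hmap_at:
  assumes M: "complex_manifold M" and N: "complex_manifold N"
  shows "holomorphic_map M N f \<longleftrightarrow> (\<forall>p\<in>points M. hmap_at M N f p)"
proof
  assume f: "holomorphic_map M N f"
  then have cont: "continuous_map (mtop M) (mtop N) f" by (simp add: holomorphic_map_def)
  show "\<forall>p\<in>points M. hmap_at M N f p"
  proof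
    fix p assume p: "p \<in> points M"
    then have fp: "f p \<in> points N" using cont by (auto simp: continuous_map_def)
    obtain c d where c: "c \<in> charts_at M p" and d: "d \<in> charts_at N (f p)"
      using charts_at_nonempty [OF M p] charts_at_nonempty [OF N fp] by blast
    then have cd: "c \<in> atlas M" "p \<in> fst c" "d \<in> atlas N" "f p \<in> fst d" by (auto simp: charts_at_def)
    define W where "W = {x \<in> fst c. f x \<in> fst d}"
    have "W = fst c \<inter> {x \<in> points M. f x \<in> fst d}" using chart_subset [OF M cd(1)] by (auto simp: W_def)
    then have W: "openin (mtop M) W"
      using chart_open [OF M cd(1)] openin_continuous_map_preimage [OF cont chart_open [OF N cd(3)]] by auto
    show "hmap_at M N f p"
    proof (rule hmap_atI [OF M N p, where d = d])
      show "d \<in> charts_at N (f p)" by (rule d)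
      show "\<forall>\<^sub>F x in nhdsin (mtop M) p. f x \<in> fst d"
        using W cd by (auto simp: eventually_nhdsin W_def)
      fix j
      have "cholomorphic_on (mdim M) (snd c ` W) (\<lambda>z. snd d (f (chart_inv c z)) j)"
        using f cd unfolding W_def by (auto simp: holomorphic_map_def)
      moreover have "openin (cEuclidean_space (mdim M)) (snd c ` W)"
        by (rule chart_image_of_open [OF M cd(1) W]) (auto simp: W_def)
      ultimately show "hfun_at M (\<lambda>x. snd d (f x) j) p"
        using c cd by (auto simp: hfun_at_def cholomorphic_on_iff_chol_at W_def intro!: bexI [of _ c])
    qed
  qed
next
  assume f: "\<forall>p\<in>points M. hmap_at M N f p"
  have cont: "continuous_map (mtop M) (mtop N) f"
    unfolding continuous_map_def
  proof (intro conjI allI impI)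
    show "f \<in> points M \<rightarrow> points N"
    proof (rule Pi_I)
      fix x assume "x \<in> points M"
      then show "f x \<in> points N" using f by (intro hmap_at_points(2) [of M N f]) simp
    qed
    fix U assume U: "openin (mtop N) U"
    show "openin (mtop M) {x \<in> points M. f x \<in> U}"
    proof (subst openin_subopen, intro ballI)
      fix p assume p: "p \<in> {x \<in> points M. f x \<in> U}"
      then have "eventually (\<lambda>x. f x \<in> U) (nhdsin (mtop M) p)"
        using f U by (auto simp: hmap_at_def limitin_def)
      then obtain S where S: "openin (mtop M) S" "p \<in> S" "\<forall>x\<in>S. f x \<in> U"
        using p by (auto simp: eventually_nhdsin)
      then show "\<exists>T. openin (mtop M) T \<and> p \<in> T \<and> T \<subseteq> {x \<in> points M. f x \<in> U}"
        using openin_subset [OF S(1)] by blast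
    qed
  qed
  moreover have "cholomorphic_on (mdim M) (snd c ` {x \<in> fst c. f x \<in> fst d}) (\<lambda>z. snd d (f (chart_inv c z)) j)"
    if cd: "c \<in> atlas M" "d \<in> atlas N" for c d j
  proof -
    define W where "W = {x \<in> fst c. f x \<in> fst d}"
    have "W = fst c \<inter> {x \<in> points M. f x \<in> fst d}" using chart_subset [OF M cd(1)] by (auto simp: W_def)
    then have W: "openin (mtop M) W"
      using chart_open [OF M cd(1)] openin_continuous_map_preimage [OF cont chart_open [OF N cd(2)]] by auto
    have o: "openin (cEuclidean_space (mdim M)) (snd c ` W)"
      by (rule chart_image_of_open [OF M cd(1) W]) (auto simp: W_def)
    have "chol_at (mdim M) (\<lambda>z. snd d (f (chart_inv c z)) j) (snd c p)" if p: "p \<in> W" for p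
    proof (rule hfun_at_chart [OF M])
      have "p \<in> points M" using p chart_subset [OF M cd(1)] by (auto simp: W_def)
      then show "hfun_at M (\<lambda>z. snd d (f z) j) p"
        using p cd f by (intro hmap_at_chart [OF M N]) (auto simp: W_def charts_at_def)
    qed (use p cd in \<open>auto simp: W_def charts_at_def\<close>)
    then show ?thesis using o unfolding W_def [symmetric] by (auto simp: cholomorphic_on_iff_chol_at)
  qed
  ultimately show "holomorphic_map M N f" by (auto simp: holomorphic_map_def)
qed

lemma holomorphic_function_iff_hfun_at:
  assumes M: "complex_manifold M"
  shows "holomorphic_function M h \<longleftrightarrow> (\<forall>p\<in>points M. hfun_at M h p)"
proof
  assume h: "holomorphic_function M h"
  show "\<forall>p\<in>points M. hfun_at M h p"
  proof
    fix p assume p: "p \<in> points M"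
    obtain c where c: "c \<in> charts_at M p" using charts_at_nonempty [OF M p] by blast
    then show "hfun_at M h p"
      using h chart_image_open [OF M] unfolding hfun_at_iff_chart [OF M c]
      by (auto simp: holomorphic_function_def charts_at_def cholomorphic_on_iff_chol_at)
  qed
next
  assume h: "\<forall>p\<in>points M. hfun_at M h p"
  show "holomorphic_function M h"
    unfolding holomorphic_function_def
  proof
    fix c assume c: "c \<in> atlas M"
    have "chol_at (mdim M) (\<lambda>z. h (chart_inv c z)) (snd c p)" if "p \<in> fst c" for p
      using that c chart_subset [OF M c] h by (intro hfun_at_chart [OF M]) (auto simp: charts_at_def)
    then show "cholomorphic_on (mdim M) (snd c ` fst c) (\<lambda>z. h (chart_inv c z))"
      using chart_image_open [OF M c] by (auto simp: cholomorphic_on_iff_chol_at)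
  qed
qed

section \<open>The space \<open>cspace n\<close> as a complex manifold\<close>

lemma continuous_map_cEuclidean_space:
  "continuous_map T (cEuclidean_space n) f \<longleftrightarrow>
     f \<in> topspace T \<rightarrow> cspace n \<and> (\<forall>i. continuous_map T euclidean (\<lambda>x. f x i))"
  unfolding cEuclidean_space_def continuous_map_in_subtopology
  by (subst euclidean_product_topology [symmetric]) (auto simp: continuous_map_componentwise_UNIV)

lemma topspace_cEuclidean_space [simp]: "topspace (cEuclidean_space n) = cspace n"
  by (simp add: cEuclidean_space_def)

lemma complex_manifold_cspace: "complex_manifold (cspace_manifold n)"
proof -
  have "second_countable (euclidean :: (nat \<Rightarrow> complex) topology)"
    unfolding second_countable_def
  proof -
    obtain B :: "(nat \<Rightarrow> complex) set set" where B: "countable B" "topological_basis B"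
      using ex_countable_basis by blast
    show "\<exists>B :: (nat \<Rightarrow> complex) set set. countable B \<and> (\<forall>V\<in>B. openin euclidean V) \<and>
        (\<forall>U x. openin euclidean U \<and> x \<in> U \<longrightarrow> (\<exists>V\<in>B. x \<in> V \<and> V \<subseteq> U))"
    proof (intro exI [of _ B] conjI ballI allI impI)
      show "openin euclidean V" if "V \<in> B" for V
        using topological_basis_open [OF B(2) that] by simp
      fix U :: "(nat \<Rightarrow> complex) set" and x assume "openin euclidean U \<and> x \<in> U"
      then have "open U" "x \<in> U" by auto
      from topological_basisE [OF B(2) this] show "\<exists>V\<in>B. x \<in> V \<and> V \<subseteq> U" by metis
    qed (rule B(1))
  qed
  then have "second_countable (cEuclidean_space n)"
    unfolding cEuclidean_space_def by (rule second_countable_subtopology)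
  moreover have "Hausdorff_space (cEuclidean_space n)"
    unfolding cEuclidean_space_def by (simp add: Hausdorff_space_subtopology)
  moreover have "subtopology (cEuclidean_space n) (cspace n) = cEuclidean_space n"
    using subtopology_topspace [of "cEuclidean_space n"] by simp
  moreover have op: "openin (cEuclidean_space n) (cspace n)"
    using openin_topspace [of "cEuclidean_space n"] by simp
  moreover have "cholomorphic_on n (cspace n) (\<lambda>z. id (chart_inv (cspace n, id) z) j)" for j
    unfolding cholomorphic_on_iff_chol_at [OF op]
  proof
    fix a assume a: "a \<in> cspace n"
    have "eventually (\<lambda>z. z j = id (chart_inv (cspace n, id) z) j) (nhds_cspace n a)"
      using eventually_nhds_cspace_mem by eventually_elim (simp add: chart_inv_def inv_into_f_f)
    then show "chol_at n (\<lambda>z. id (chart_inv (cspace n, id) z) j) a"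
      by (rule chol_at_transform [OF chol_at_coordinate [OF a]])
  qed
  ultimately show ?thesis
    by (auto simp: complex_manifold_def cspace_manifold_def is_chart_def)
qed

lemma cspace_manifold_simps [simp]:
  "mtop (cspace_manifold n) = cEuclidean_space n" "mdim (cspace_manifold n) = n"
  "atlas (cspace_manifold n) = {(cspace n, id)}"
  by (simp_all add: cspace_manifold_def)

lemma hmap_at_cspace_manifold_iff:
  assumes M: "complex_manifold M" and p: "p \<in> points M" and ev: "eventually (\<lambda>x. f x \<in> cspace n) (nhdsin (mtop M) p)"
  shows "hmap_at M (cspace_manifold n) f p \<longleftrightarrow> (\<forall>j<n. hfun_at M (\<lambda>x. f x j) p)"
proof -
  have "f p \<in> cspace n" using ev p by (rule eventually_nhdsin_imp)
  then have ch: "(cspace n, id) \<in> charts_at (cspace_manifold n) (f p)" by (simp add: charts_at_def)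
  show ?thesis
    using hmap_at_chart [where f = f, OF M complex_manifold_cspace _ ch]
      hmap_atI [where f = f, OF M complex_manifold_cspace p ch] ev by auto
qed

section \<open>Product manifolds\<close>

text \<open>The coordinate map of a product chart, as in \<open>product_manifold\<close>. Its
  inverse is the pair of \<open>ctake\<close> and \<open>cdrop\<close>, where \<open>ctake\<close>
  fills up with 0 in order to land in \<open>cspace m\<close>.\<close>

definition cjoin :: "nat \<Rightarrow> (nat \<Rightarrow> complex) \<Rightarrow> (nat \<Rightarrow> complex) \<Rightarrow> nat \<Rightarrow> complex" where
  "cjoin m x y = (\<lambda>i. if i < m then x i else y (i - m))"

definition ctake :: "nat \<Rightarrow> (nat \<Rightarrow> complex) \<Rightarrow> nat \<Rightarrow> complex" where
  "ctake m z = (\<lambda>i. if i < m then z i else 0)"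

definition cdrop :: "nat \<Rightarrow> (nat \<Rightarrow> complex) \<Rightarrow> nat \<Rightarrow> complex" where
  "cdrop m z = (\<lambda>i. z (i + m))"

lemma cjoin_take_drop [simp]: "cjoin m (ctake m z) (cdrop m z) = z"
  by (auto simp: cjoin_def ctake_def cdrop_def)

lemma ctake_cjoin [simp]: "x \<in> cspace m \<Longrightarrow> ctake m (cjoin m x y) = x"
  by (auto simp: cjoin_def ctake_def cspace_def)

lemma cdrop_cjoin [simp]: "cdrop m (cjoin m x y) = y"
  by (auto simp: cjoin_def cdrop_def)

lemma ctake_in_cspace: "ctake m z \<in> cspace m"
  by (auto simp: ctake_def cspace_def)

lemma cdrop_in_cspace: "z \<in> cspace (m + n) \<Longrightarrow> cdrop m z \<in> cspace n"
  by (auto simp: cdrop_def cspace_def)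

lemma cjoin_in_cspace: "y \<in> cspace n \<Longrightarrow> cjoin m x y \<in> cspace (m + n)"
  by (auto simp: cjoin_def cspace_def)

lemma ctake_in_polydisc: "z \<in> polydisc (m + n) a e \<Longrightarrow> ctake m z \<in> polydisc m (ctake m a) e"
  by (auto simp: polydisc_def ctake_def cspace_def)

lemma cdrop_in_polydisc: "z \<in> polydisc (m + n) a e \<Longrightarrow> cdrop m z \<in> polydisc n (cdrop m a) e"
  by (auto simp: polydisc_def cdrop_def cspace_def)

lemma openin_cjoin:
  assumes A: "openin (cEuclidean_space m) A" and B: "openin (cEuclidean_space n) B"
  shows "openin (cEuclidean_space (m + n)) {cjoin m x y |x y. x \<in> A \<and> y \<in> B}"
  unfolding openin_cspace_iff
proof (intro conjI ballI)
  show "{cjoin m x y |x y. x \<in> A \<and> y \<in> B} \<subseteq> cspace (m + n)"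
    using B cjoin_in_cspace by (auto simp: openin_cspace_iff)
  fix z assume "z \<in> {cjoin m x y |x y. x \<in> A \<and> y \<in> B}"
  then obtain x y where xy: "z = cjoin m x y" "x \<in> A" "y \<in> B" by blast
  then obtain d e where de: "0 < d" "polydisc m x d \<subseteq> A" "0 < e" "polydisc n y e \<subseteq> B"
    using A B unfolding openin_cspace_iff by metis
  have x: "x \<in> cspace m" using A xy by (auto simp: openin_cspace_iff)
  have "polydisc (m + n) z (min d e) \<subseteq> {cjoin m x y |x y. x \<in> A \<and> y \<in> B}"
  proof
    fix w assume w: "w \<in> polydisc (m + n) z (min d e)"
    have "ctake m w \<in> A"
      using ctake_in_polydisc [OF w] xy x de polydisc_mono [of "min d e" d m x] by auto
    moreover have "cdrop m w \<in> B"
      using cdrop_in_polydisc [OF w] xy de polydisc_mono [of "min d e" e n y] by auto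
    ultimately show "w \<in> {cjoin m x y |x y. x \<in> A \<and> y \<in> B}"
      using cjoin_take_drop [of m w] by (intro CollectI exI [of _ "ctake m w"] exI [of _ "cdrop m w"]) auto
  qed
  then show "\<exists>e>0. polydisc (m + n) z e \<subseteq> {cjoin m x y |x y. x \<in> A \<and> y \<in> B}"
    using de by (intro exI [of _ "min d e"]) auto
qed

definition product_chart :: "nat \<Rightarrow> 'a chart \<Rightarrow> 'b chart \<Rightarrow> ('a \<times> 'b) chart" where
  "product_chart m c d = (fst c \<times> fst d, \<lambda>(x, y). cjoin m (snd c x) (snd d y))"

lemma product_manifold_simps [simp]:
  "mtop (product_manifold M N) = prod_topology (mtop M) (mtop N)"
  "mdim (product_manifold M N) = mdim M + mdim N"
  by (simp_all add: product_manifold_def)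

lemma atlas_product_manifold:
  "atlas (product_manifold M N) = {product_chart (mdim M) c d |c d. c \<in> atlas M \<and> d \<in> atlas N}"
proof -
  have "product_chart (mdim M) (U, \<phi>) (V, \<psi>) = (U \<times> V, \<lambda>(x, y) i. if i < mdim M then \<phi> x i else \<psi> y (i - mdim M))"
    for U \<phi> V \<psi> by (auto simp: product_chart_def cjoin_def)
  note eq = this
  show ?thesis
  proof (rule Set.set_eqI, rule iffI)
    fix k assume "k \<in> atlas (product_manifold M N)"
    then obtain U \<phi> V \<psi> where "k = product_chart (mdim M) (U, \<phi>) (V, \<psi>)" "(U, \<phi>) \<in> atlas M" "(V, \<psi>) \<in> atlas N"
      unfolding eq by (auto simp: product_manifold_def)
    then show "k \<in> {product_chart (mdim M) c d |c d. c \<in> atlas M \<and> d \<in> atlas N}" by blast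
  next
    fix k assume "k \<in> {product_chart (mdim M) c d |c d. c \<in> atlas M \<and> d \<in> atlas N}"
    then obtain c d where cd: "k = product_chart (mdim M) c d" "c \<in> atlas M" "d \<in> atlas N" by blast
    obtain U \<phi> V \<psi> where "c = (U, \<phi>)" "d = (V, \<psi>)" using prod.exhaust by metis
    with cd have "k = product_chart (mdim M) (U, \<phi>) (V, \<psi>)" "(U, \<phi>) \<in> atlas M" "(V, \<psi>) \<in> atlas N" by auto
    then show "k \<in> atlas (product_manifold M N)"
      unfolding eq by (auto simp: product_manifold_def)
  qed
qed

lemma fst_product_chart [simp]: "fst (product_chart m c d) = fst c \<times> fst d"
  and snd_product_chart: "snd (product_chart m c d) p = cjoin m (snd c (fst p)) (snd d (snd p))"
  by (auto simp: product_chart_def split: prod.splits)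

lemma charts_at_product_manifold:
  "charts_at (product_manifold M N) p =
     {product_chart (mdim M) c d |c d. c \<in> charts_at M (fst p) \<and> d \<in> charts_at N (snd p)}"
proof (rule Set.set_eqI)
  fix k
  show "k \<in> charts_at (product_manifold M N) p \<longleftrightarrow>
     k \<in> {product_chart (mdim M) c d |c d. c \<in> charts_at M (fst p) \<and> d \<in> charts_at N (snd p)}"
    unfolding charts_at_def atlas_product_manifold mem_Collect_eq
    by (metis fst_product_chart mem_Times_iff)
qed

lemma chol_at_ctake:
  assumes a: "a \<in> cspace (m + n)" and f: "chol_at m f (ctake m a)"
  shows "chol_at (m + n) (\<lambda>z. f (ctake m z)) a"
proof (rule chol_at_compose [OF a, where G = "ctake m" and F = f])
  show "\<forall>\<^sub>F z in nhds_cspace (m + n) a. ctake m z \<in> cspace m"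
    by (intro always_eventually allI ctake_in_cspace)
  show "chol_at (m + n) (\<lambda>z. ctake m z j) a" if "j < m" for j
    using chol_at_coordinate [OF a, of j] that by (simp add: ctake_def)
qed (rule f)

lemma chol_at_cdrop:
  assumes a: "a \<in> cspace (m + n)" and f: "chol_at n f (cdrop m a)"
  shows "chol_at (m + n) (\<lambda>z. f (cdrop m z)) a"
proof (rule chol_at_compose [OF a, where G = "cdrop m" and F = f])
  show "\<forall>\<^sub>F z in nhds_cspace (m + n) a. cdrop m z \<in> cspace n"
    using eventually_nhds_cspace_mem by eventually_elim (rule cdrop_in_cspace)
  show "chol_at (m + n) (\<lambda>z. cdrop m z j) a" for j
    using chol_at_coordinate [OF a, of "j + m"] by (simp add: cdrop_def)
qed (rule f)

lemma product_chart_image: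
  "snd (product_chart m c d) ` (A \<times> B) = {cjoin m x y |x y. x \<in> snd c ` A \<and> y \<in> snd d ` B}"
  by (force simp: snd_product_chart image_iff)

lemma second_countable_prod_topology:
  assumes "second_countable S" "second_countable T" shows "second_countable (prod_topology S T)"
proof -
  obtain A B where A: "countable A" "\<And>V. V \<in> A \<Longrightarrow> openin S V" "\<And>U x. openin S U \<Longrightarrow> x \<in> U \<Longrightarrow> \<exists>V\<in>A. x \<in> V \<and> V \<subseteq> U"
    and B: "countable B" "\<And>V. V \<in> B \<Longrightarrow> openin T V" "\<And>U x. openin T U \<Longrightarrow> x \<in> U \<Longrightarrow> \<exists>V\<in>B. x \<in> V \<and> V \<subseteq> U"
    using assms unfolding second_countable_def by metis
  show ?thesis
    unfolding second_countable_def
  proof (intro exI conjI ballI allI impI)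
    show "countable ((\<lambda>(U, V). U \<times> V) ` (A \<times> B))" using A B by auto
    fix W assume "W \<in> (\<lambda>(U, V). U \<times> V) ` (A \<times> B)"
    then show "openin (prod_topology S T) W" using A B by (auto simp: openin_prod_Times_iff)
  next
    fix U p assume U: "openin (prod_topology S T) U \<and> p \<in> U"
    obtain x y where p: "p = (x, y)" by (cases p)
    obtain V W where VW: "openin S V" "openin T W" "x \<in> V" "y \<in> W" "V \<times> W \<subseteq> U"
      using U p unfolding openin_prod_topology_alt by metis
    obtain V' where V': "V' \<in> A" "x \<in> V'" "V' \<subseteq> V" using A(3) VW by blast
    obtain W' where W': "W' \<in> B" "y \<in> W'" "W' \<subseteq> W" using B(3) VW by blast
    have "V' \<times> W' \<in> (\<lambda>(U, V). U \<times> V) ` (A \<times> B)" using V' W' by force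
    then show "\<exists>V\<in>(\<lambda>(U, V). U \<times> V) ` (A \<times> B). p \<in> V \<and> V \<subseteq> U"
      by (rule bexI [rotated]) (use V' W' VW p in auto)
  qed
qed

context
  fixes M :: "'a cmfd" and N :: "'b cmfd"
  assumes M: "complex_manifold M" and N: "complex_manifold N"
begin

lemma product_chart_inj:
  assumes c: "c \<in> atlas M" and d: "d \<in> atlas N"
  shows "inj_on (snd (product_chart (mdim M) c d)) (fst c \<times> fst d)"
proof (rule inj_onI)
  fix p q assume p: "p \<in> fst c \<times> fst d" and q: "q \<in> fst c \<times> fst d"
    and eq: "snd (product_chart (mdim M) c d) p = snd (product_chart (mdim M) c d) q"
  have "snd c (fst p) \<in> cspace (mdim M)" "snd c (fst q) \<in> cspace (mdim M)"
    using p q chart_in_cspace [OF M c] by auto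
  then have "snd c (fst p) = snd c (fst q)" "snd d (snd p) = snd d (snd q)"
    using eq unfolding snd_product_chart by (metis ctake_cjoin, metis cdrop_cjoin)
  then show "p = q"
    using inj_onD [OF chart_inj [OF M c]] inj_onD [OF chart_inj [OF N d]] p q
    by (metis mem_Times_iff prod_eqI)
qed

lemma product_chart_inv:
  assumes c: "c \<in> atlas M" and d: "d \<in> atlas N" and z: "z \<in> snd (product_chart (mdim M) c d) ` (fst c \<times> fst d)"
  shows "chart_inv (product_chart (mdim M) c d) z = (chart_inv c (ctake (mdim M) z), chart_inv d (cdrop (mdim M) z))"
proof -
  obtain x y where xy: "x \<in> fst c" "y \<in> fst d" "z = cjoin (mdim M) (snd c x) (snd d y)"
    using z by (auto simp: snd_product_chart)
  have "chart_inv (product_chart (mdim M) c d) (snd (product_chart (mdim M) c d) (x, y)) = (x, y)"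
    unfolding chart_inv_def using xy by (intro inv_into_f_f) (auto intro: product_chart_inj [OF c d])
  then show ?thesis
    using xy chart_inv_chart [OF M c] chart_inv_chart [OF N d] chart_in_cspace [OF M c] by (simp add: snd_product_chart)
qed

lemma is_chart_product:
  assumes c: "c \<in> atlas M" and d: "d \<in> atlas N"
  shows "is_chart (prod_topology (mtop M) (mtop N)) (mdim M + mdim N) (product_chart (mdim M) c d)"
proof -
  let ?k = "product_chart (mdim M) c d"
  let ?T = "prod_topology (mtop M) (mtop N)"
  have op: "openin ?T (fst c \<times> fst d)"
    using chart_open [OF M c] chart_open [OF N d] by (simp add: openin_prod_Times_iff)
  have img: "openin (cEuclidean_space (mdim M + mdim N)) (snd ?k ` (A \<times> B))"
    if "openin (mtop M) A" "A \<subseteq> fst c" "openin (mtop N) B" "B \<subseteq> fst d" for A B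
    unfolding product_chart_image
    by (intro openin_cjoin chart_image_of_open [OF M c] chart_image_of_open [OF N d] that)
  have ts: "topspace (subtopology ?T (fst c \<times> fst d)) = fst c \<times> fst d"
    using chart_subset [OF M c] chart_subset [OF N d] by auto
  have imgo: "openin (cEuclidean_space (mdim M + mdim N)) (snd ?k ` (fst c \<times> fst d))"
    using chart_open [OF M c] chart_open [OF N d] by (intro img) auto
  have tsi: "topspace (subtopology (cEuclidean_space (mdim M + mdim N)) (snd ?k ` (fst c \<times> fst d))) = snd ?k ` (fst c \<times> fst d)"
    using openin_subset [OF imgo] by auto
  have "homeomorphic_map (subtopology ?T (fst c \<times> fst d))
      (subtopology (cEuclidean_space (mdim M + mdim N)) (snd ?k ` (fst c \<times> fst d))) (snd ?k)"
  proof (rule bijective_open_imp_homeomorphic_map)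
    have cc: "continuous_map (subtopology (mtop M) (fst c)) (cEuclidean_space (mdim M)) (snd c)"
      using homeomorphic_imp_continuous_map [OF chart_homeomorphic [OF M c]] by (simp add: continuous_map_in_subtopology)
    have cd: "continuous_map (subtopology (mtop N) (fst d)) (cEuclidean_space (mdim N)) (snd d)"
      using homeomorphic_imp_continuous_map [OF chart_homeomorphic [OF N d]] by (simp add: continuous_map_in_subtopology)
    have sub: "subtopology ?T (fst c \<times> fst d) = prod_topology (subtopology (mtop M) (fst c)) (subtopology (mtop N) (fst d))"
      by (simp add: subtopology_Times)
    have "continuous_map (subtopology ?T (fst c \<times> fst d)) (cEuclidean_space (mdim M + mdim N)) (snd ?k)"
      unfolding continuous_map_cEuclidean_space
    proof (intro conjI allI)
      show "snd ?k \<in> topspace (subtopology ?T (fst c \<times> fst d)) \<rightarrow> cspace (mdim M + mdim N)"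
        unfolding ts using openin_subset [OF imgo] by auto
      fix i
      have 1: "continuous_map (subtopology ?T (fst c \<times> fst d)) euclidean (\<lambda>p. snd c (fst p) i)"
        using continuous_map_compose [OF continuous_map_fst [of "subtopology (mtop M) (fst c)" "subtopology (mtop N) (fst d)"], of euclidean "\<lambda>x. snd c x i"] cc
        unfolding sub continuous_map_cEuclidean_space by (simp add: o_def)
      have 2: "continuous_map (subtopology ?T (fst c \<times> fst d)) euclidean (\<lambda>p. snd d (snd p) (i - mdim M))"
        using continuous_map_compose [OF continuous_map_snd [of "subtopology (mtop M) (fst c)" "subtopology (mtop N) (fst d)"], of euclidean "\<lambda>x. snd d x (i - mdim M)"] cd
        unfolding sub continuous_map_cEuclidean_space by (simp add: o_def)
      show "continuous_map (subtopology ?T (fst c \<times> fst d)) euclidean (\<lambda>p. snd ?k p i)"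
        unfolding snd_product_chart cjoin_def using 1 2 by (cases "i < mdim M") simp_all
    qed
    then show "continuous_map (subtopology ?T (fst c \<times> fst d))
        (subtopology (cEuclidean_space (mdim M + mdim N)) (snd ?k ` (fst c \<times> fst d))) (snd ?k)"
      unfolding continuous_map_in_subtopology ts by auto
    show "open_map (subtopology ?T (fst c \<times> fst d))
        (subtopology (cEuclidean_space (mdim M + mdim N)) (snd ?k ` (fst c \<times> fst d))) (snd ?k)"
      unfolding open_map_def
    proof (intro allI impI)
      fix U assume "openin (subtopology ?T (fst c \<times> fst d)) U"
      then have U: "openin ?T U" "U \<subseteq> fst c \<times> fst d"
        using op by (simp_all add: openin_open_subtopology)
      have "openin (cEuclidean_space (mdim M + mdim N)) (snd ?k ` U)"
      proof (subst openin_subopen, intro ballI)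
        fix z assume "z \<in> snd ?k ` U"
        then obtain x y where xy: "(x, y) \<in> U" "z = snd ?k (x, y)" by auto
        then obtain A B where AB: "openin (mtop M) A" "openin (mtop N) B" "x \<in> A" "y \<in> B" "A \<times> B \<subseteq> U"
          using U(1) unfolding openin_prod_topology_alt by metis
        then have "A \<subseteq> fst c" "B \<subseteq> fst d" using U(2) by auto
        then show "\<exists>T. openin (cEuclidean_space (mdim M + mdim N)) T \<and> z \<in> T \<and> T \<subseteq> snd ?k ` U"
          using AB xy by (intro exI [of _ "snd ?k ` (A \<times> B)"] conjI img) auto
      qed
      then show "openin (subtopology (cEuclidean_space (mdim M + mdim N)) (snd ?k ` (fst c \<times> fst d))) (snd ?k ` U)"
        using U(2) imgo by (auto simp: openin_open_subtopology)
    qed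
    show "snd ?k ` topspace (subtopology ?T (fst c \<times> fst d)) =
        topspace (subtopology (cEuclidean_space (mdim M + mdim N)) (snd ?k ` (fst c \<times> fst d)))"
      unfolding ts tsi ..
    show "inj_on (snd ?k) (topspace (subtopology ?T (fst c \<times> fst d)))"
      unfolding ts by (rule product_chart_inj [OF c d])
  qed
  then show ?thesis using op imgo by (simp add: is_chart_def)
qed

text \<open>Formulated for arbitrary functions on the factors, in one given product chart, because
  it is needed before the product is known to be a manifold. It yields the transition maps of the
  product and afterwards the holomorphy of functions pulled back along the projections.\<close>

lemma product_transition_chol_at:
  assumes c: "c \<in> atlas M" and d: "d \<in> atlas N" and p: "x \<in> fst c" "y \<in> fst d"
    and h: "hfun_at M h x" and k: "hfun_at N k y"
  shows "chol_at (mdim M + mdim N) (\<lambda>z. h (fst (chart_inv (product_chart (mdim M) c d) z))) (snd (product_chart (mdim M) c d) (x, y))"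
    and "chol_at (mdim M + mdim N) (\<lambda>z. k (snd (chart_inv (product_chart (mdim M) c d) z))) (snd (product_chart (mdim M) c d) (x, y))"
proof -
  let ?k = "product_chart (mdim M) c d"
  let ?a = "snd ?k (x, y)"
  have o: "openin (cEuclidean_space (mdim M + mdim N)) (snd ?k ` (fst c \<times> fst d))"
    using is_chart_product [OF c d] by (simp add: is_chart_def)
  have a: "?a \<in> snd ?k ` (fst c \<times> fst d)" using p by auto
  have acs: "?a \<in> cspace (mdim M + mdim N)" using openin_subset [OF o] a by auto
  have ta: "ctake (mdim M) ?a = snd c x" "cdrop (mdim M) ?a = snd d y"
    using chart_in_cspace [OF M c] p by (auto simp: snd_product_chart)
  have ch: "c \<in> charts_at M x" "d \<in> charts_at N y" using c d p by (auto simp: charts_at_def)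
  have "chol_at (mdim M + mdim N) (\<lambda>z. h (chart_inv c (ctake (mdim M) z))) ?a"
    using hfun_at_chart [OF M h ch(1)] by (intro chol_at_ctake [OF acs, where f = "\<lambda>z. h (chart_inv c z)"]) (simp add: ta)
  moreover have "eventually (\<lambda>z. h (chart_inv c (ctake (mdim M) z)) = h (fst (chart_inv ?k z))) (nhds_cspace (mdim M + mdim N) ?a)"
    by (rule eventually_nhds_cspaceI [OF o a]) (simp add: product_chart_inv [OF c d])
  ultimately show "chol_at (mdim M + mdim N) (\<lambda>z. h (fst (chart_inv ?k z))) ?a" by (rule chol_at_transform)
  have "chol_at (mdim M + mdim N) (\<lambda>z. k (chart_inv d (cdrop (mdim M) z))) ?a"
    using hfun_at_chart [OF N k ch(2)] by (intro chol_at_cdrop [OF acs, where f = "\<lambda>z. k (chart_inv d z)"]) (simp add: ta)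
  moreover have "eventually (\<lambda>z. k (chart_inv d (cdrop (mdim M) z)) = k (snd (chart_inv ?k z))) (nhds_cspace (mdim M + mdim N) ?a)"
    by (rule eventually_nhds_cspaceI [OF o a]) (simp add: product_chart_inv [OF c d])
  ultimately show "chol_at (mdim M + mdim N) (\<lambda>z. k (snd (chart_inv ?k z))) ?a" by (rule chol_at_transform)
qed

lemma complex_manifold_product: "complex_manifold (product_manifold M N)"
  unfolding complex_manifold_def
proof (intro conjI ballI allI)
  show "Hausdorff_space (mtop (product_manifold M N))"
    using M N by (simp add: complex_manifold_def Hausdorff_space_prod_topology)
  show "second_countable (mtop (product_manifold M N))"
    using M N by (simp add: complex_manifold_def second_countable_prod_topology)
  show "is_chart (mtop (product_manifold M N)) (mdim (product_manifold M N)) k"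
    if "k \<in> atlas (product_manifold M N)" for k
    using that is_chart_product unfolding atlas_product_manifold by auto
  show "(\<Union>c\<in>atlas (product_manifold M N). fst c) = points (product_manifold M N)" (is "?L = ?R")
  proof (rule Set.set_eqI)
    fix p :: "'a \<times> 'b"
    have "p \<in> ?L \<longleftrightarrow> (\<exists>c\<in>atlas M. fst p \<in> fst c) \<and> (\<exists>d\<in>atlas N. snd p \<in> fst d)"
      unfolding atlas_product_manifold UN_iff Bex_def mem_Collect_eq
      by (metis fst_product_chart mem_Times_iff)
    also have "\<dots> \<longleftrightarrow> p \<in> ?R"
      using M N by (cases p) (auto simp: complex_manifold_def)
    finally show "p \<in> ?L \<longleftrightarrow> p \<in> ?R" .
  qed
  fix k l j assume k: "k \<in> atlas (product_manifold M N)" and l: "l \<in> atlas (product_manifold M N)"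
  obtain c d where c: "c \<in> atlas M" and d: "d \<in> atlas N" and kd: "k = product_chart (mdim M) c d"
    using k unfolding atlas_product_manifold by blast
  obtain c' d' where c': "c' \<in> atlas M" and d': "d' \<in> atlas N" and ld: "l = product_chart (mdim M) c' d'"
    using l unfolding atlas_product_manifold by blast
  have eq: "fst k \<inter> fst l = (fst c \<inter> fst c') \<times> (fst d \<inter> fst d')" by (auto simp: kd ld)
  have o: "openin (cEuclidean_space (mdim M + mdim N)) (snd k ` (fst k \<inter> fst l))"
    unfolding eq unfolding kd product_chart_image
    by (intro openin_cjoin chart_image_of_open [OF M c] chart_image_of_open [OF N d] openin_Int
        chart_open [OF M] chart_open [OF N] c c' d d') auto
  have "chol_at (mdim M + mdim N) (\<lambda>z. snd l (chart_inv k z) j) (snd k (x, y))"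
    if xy: "x \<in> fst c" "x \<in> fst c'" "y \<in> fst d" "y \<in> fst d'" for x y
  proof -
    have h: "hfun_at M (\<lambda>x. snd c' x i) x" for i
      using c' xy by (intro hfun_at_chart_coordinate [OF M]) (simp add: charts_at_def)
    have h': "hfun_at N (\<lambda>x. snd d' x i) y" for i
      using d' xy by (intro hfun_at_chart_coordinate [OF N]) (simp add: charts_at_def)
    show ?thesis
      using product_transition_chol_at [OF c d xy(1,3) h [of j] h' [of "j - mdim M"]]
      unfolding ld snd_product_chart cjoin_def kd by (cases "j < mdim M") auto
  qed
  then show "cholomorphic_on (mdim (product_manifold M N)) (snd k ` (fst k \<inter> fst l)) (\<lambda>z. snd l (chart_inv k z) j)"
    using o unfolding eq by (auto simp: cholomorphic_on_iff_chol_at)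
qed

lemma hfun_at_fst:
  assumes "hfun_at M h (fst p)" "snd p \<in> points N"
  shows "hfun_at (product_manifold M N) (\<lambda>x. h (fst x)) p"
proof -
  obtain c d where cd: "c \<in> charts_at M (fst p)" "d \<in> charts_at N (snd p)"
    using charts_at_nonempty [OF M hfun_at_points [OF M assms(1)]] charts_at_nonempty [OF N assms(2)] by blast
  have "product_chart (mdim M) c d \<in> charts_at (product_manifold M N) p"
    using cd unfolding charts_at_product_manifold by blast
  moreover have "chol_at (mdim M + mdim N) (\<lambda>z. h (fst (chart_inv (product_chart (mdim M) c d) z))) (snd (product_chart (mdim M) c d) (fst p, snd p))"
    using cd by (intro product_transition_chol_at(1) [OF _ _ _ _ assms(1) hfun_at_const [OF N assms(2)]]) (auto simp: charts_at_def)
  ultimately show ?thesis unfolding hfun_at_def by (auto intro!: bexI [of _ "product_chart (mdim M) c d"])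
qed

lemma hfun_at_snd:
  assumes "hfun_at N h (snd p)" "fst p \<in> points M"
  shows "hfun_at (product_manifold M N) (\<lambda>x. h (snd x)) p"
proof -
  obtain c d where cd: "c \<in> charts_at M (fst p)" "d \<in> charts_at N (snd p)"
    using charts_at_nonempty [OF N hfun_at_points [OF N assms(1)]] charts_at_nonempty [OF M assms(2)] by blast
  have "product_chart (mdim M) c d \<in> charts_at (product_manifold M N) p"
    using cd unfolding charts_at_product_manifold by blast
  moreover have "chol_at (mdim M + mdim N) (\<lambda>z. h (snd (chart_inv (product_chart (mdim M) c d) z))) (snd (product_chart (mdim M) c d) (fst p, snd p))"
    using cd by (intro product_transition_chol_at(2) [OF _ _ _ _ hfun_at_const [OF M assms(2)] assms(1)]) (auto simp: charts_at_def)
  ultimately show ?thesis unfolding hfun_at_def by (auto intro!: bexI [of _ "product_chart (mdim M) c d"])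
qed

lemma hmap_at_fst:
  assumes p: "p \<in> points (product_manifold M N)"
  shows "hmap_at (product_manifold M N) M fst p"
proof -
  have pp: "fst p \<in> points M" "snd p \<in> points N" using p by auto
  obtain c where c: "c \<in> charts_at M (fst p)" using charts_at_nonempty [OF M pp(1)] by blast
  show ?thesis
  proof (rule hmap_atI [OF complex_manifold_product M p, where d = c])
    have "openin (mtop (product_manifold M N)) (fst c \<times> points N)"
      using chart_open [OF M, of c] c by (simp add: openin_prod_Times_iff charts_at_def)
    then show "\<forall>\<^sub>F x in nhdsin (mtop (product_manifold M N)) p. fst x \<in> fst c"
      unfolding eventually_nhdsin using c pp by (intro disjI2 exI [of _ "fst c \<times> points N"]) (cases p, auto simp: charts_at_def)
    show "hfun_at (product_manifold M N) (\<lambda>x. snd c (fst x) j) p" for j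
      by (rule hfun_at_fst [OF hfun_at_chart_coordinate [OF M c] pp(2)])
  qed (rule c)
qed

lemma hmap_at_snd:
  assumes p: "p \<in> points (product_manifold M N)"
  shows "hmap_at (product_manifold M N) N snd p"
proof -
  have pp: "fst p \<in> points M" "snd p \<in> points N" using p by auto
  obtain c where c: "c \<in> charts_at N (snd p)" using charts_at_nonempty [OF N pp(2)] by blast
  show ?thesis
  proof (rule hmap_atI [OF complex_manifold_product N p, where d = c])
    have "openin (mtop (product_manifold M N)) (points M \<times> fst c)"
      using chart_open [OF N, of c] c by (simp add: openin_prod_Times_iff charts_at_def)
    then show "\<forall>\<^sub>F x in nhdsin (mtop (product_manifold M N)) p. snd x \<in> fst c"
      unfolding eventually_nhdsin using c pp by (intro disjI2 exI [of _ "points M \<times> fst c"]) (cases p, auto simp: charts_at_def)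
    show "hfun_at (product_manifold M N) (\<lambda>x. snd c (snd x) j) p" for j
      by (rule hfun_at_snd [OF hfun_at_chart_coordinate [OF N c] pp(1)])
  qed (rule c)
qed

lemma hmap_at_pair:
  assumes L: "complex_manifold L" and f: "hmap_at L M f p" and g: "hmap_at L N g p"
  shows "hmap_at L (product_manifold M N) (\<lambda>x. (f x, g x)) p"
proof -
  obtain c where c: "c \<in> charts_at M (f p)" using charts_at_nonempty [OF M hmap_at_points(2) [OF f]] by blast
  obtain d where d: "d \<in> charts_at N (g p)" using charts_at_nonempty [OF N hmap_at_points(2) [OF g]] by blast
  show ?thesis
  proof (rule hmap_atI [OF L complex_manifold_product hmap_at_points(1) [OF f], where d = "product_chart (mdim M) c d"])
    show "product_chart (mdim M) c d \<in> charts_at (product_manifold M N) (f p, g p)"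
      using c d unfolding charts_at_product_manifold by (intro CollectI exI [of _ c] exI [of _ d]) simp
    have "\<forall>\<^sub>F x in nhdsin (mtop L) p. f x \<in> fst c"
      using f c chart_open [OF M, of c] by (auto simp: hmap_at_def limitin_def charts_at_def)
    moreover have "\<forall>\<^sub>F x in nhdsin (mtop L) p. g x \<in> fst d"
      using g d chart_open [OF N, of d] by (auto simp: hmap_at_def limitin_def charts_at_def)
    ultimately show "\<forall>\<^sub>F x in nhdsin (mtop L) p. (f x, g x) \<in> fst (product_chart (mdim M) c d)"
      by eventually_elim simp
    show "hfun_at L (\<lambda>x. snd (product_chart (mdim M) c d) (f x, g x) j) p" for j
      using hmap_at_chart [OF L M f c, of j] hmap_at_chart [OF L N g d, of "j - mdim M"]
      by (cases "j < mdim M") (auto simp: snd_product_chart cjoin_def)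
  qed
qed

end

text \<open>The trivial bundle is trivialised over the whole base at once; this removes the
  restrictions to open sets that \<open>holomorphic_vbundle\<close> contains.\<close>

lemma open_submanifold_points: "complex_manifold M \<Longrightarrow> open_submanifold M (points M) = M"
proof -
  assume M: "complex_manifold M"
  have "(\<lambda>(V, \<phi>). (V \<inter> points M, \<phi>)) c = c" if "c \<in> atlas M" for c
    using chart_subset [OF M that] by (cases c) (simp add: inf.absorb1)
  then have "(\<lambda>(V, \<phi>). (V \<inter> points M, \<phi>)) ` atlas M = atlas M"
    by (simp cong: image_cong)
  then show ?thesis by (simp add: open_submanifold_def subtopology_topspace)
qed

section \<open>Integral curves and flows\<close>

text \<open>The Lie derivative of a function in coordinates, for the vector field with components
  \<open>V k\<close>.\<close>

definition lie :: "nat \<Rightarrow> (nat \<Rightarrow> (nat \<Rightarrow> complex) \<Rightarrow> complex) \<Rightarrow> ((nat \<Rightarrow> complex) \<Rightarrow> complex) \<Rightarrow> (nat \<Rightarrow> complex) \<Rightarrow> complex" where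
  "lie n V f z = (\<Sum>k<n. pd k f z * V k z)"

lemma chol_at_lie:
  assumes "chol_at n f a" "\<And>k. chol_at n (V k) a"
  shows "chol_at n (lie n V f) a"
proof -
  have "chol_at n (\<lambda>z. \<Sum>k<n. pd k f z * V k z) a"
    using assms by (intro chol_at_sum chol_at_mult chol_at_pd) (auto simp: chol_at_def)
  then show ?thesis by (simp add: lie_def [abs_def])
qed

lemma chol_at_lie_iterate:
  assumes "chol_at n f a" "\<And>k. chol_at n (V k) a"
  shows "chol_at n ((lie n V ^^ m) f) a"
  by (induction m) (use assms chol_at_lie in auto)

text \<open>By the chain rule one differentiation along a solution replaces \<open>f\<close> by its
  Lie derivative. The induction is over all times in the open set \<open>S\<close>, because
  differentiating once more uses the previous formula on a neighbourhood.\<close>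

lemma higher_deriv_along_curve:
  assumes S: "open S" and \<gamma>: "\<And>s. s \<in> S \<Longrightarrow> \<gamma> s \<in> cspace n"
    and ode: "\<And>s k. s \<in> S \<Longrightarrow> k < n \<Longrightarrow> ((\<lambda>s. \<gamma> s k) has_field_derivative V k (\<gamma> s)) (at s)"
    and f: "\<And>s. s \<in> S \<Longrightarrow> chol_at n f (\<gamma> s)" and V: "\<And>s k. s \<in> S \<Longrightarrow> chol_at n (V k) (\<gamma> s)"
    and t: "t \<in> S"
  shows "(deriv ^^ m) (\<lambda>s. f (\<gamma> s)) t = (lie n V ^^ m) f (\<gamma> t)"
  using t
proof (induction m arbitrary: t)
  case (Suc m)
  have "(deriv ^^ Suc m) (\<lambda>s. f (\<gamma> s)) t = deriv ((deriv ^^ m) (\<lambda>s. f (\<gamma> s))) t" by simp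
  also have "\<dots> = deriv (\<lambda>s. (lie n V ^^ m) f (\<gamma> s)) t"
  proof (rule deriv_cong_ev)
    have "eventually (\<lambda>s. s \<in> S) (nhds t)" using S Suc.prems by (rule eventually_nhds_in_open)
    then show "\<forall>\<^sub>F s in nhds t. (deriv ^^ m) (\<lambda>s. f (\<gamma> s)) s = (lie n V ^^ m) f (\<gamma> s)"
      by eventually_elim (rule Suc.IH)
  qed simp
  also have "\<dots> = (\<Sum>k<n. pd k ((lie n V ^^ m) f) (\<gamma> t) * V k (\<gamma> t))"
    using Suc.prems
    by (intro DERIV_imp_deriv cdiff_at_curve [OF _ S] chol_at_imp_cdiff_at chol_at_lie_iterate \<gamma> ode f V)
  also have "\<dots> = (lie n V ^^ Suc m) f (\<gamma> t)" by (simp add: lie_def)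
  finally show ?case .
qed simp

lemma integral_curve_points: "integral_curve X \<xi> \<gamma> \<Longrightarrow> \<gamma> t \<in> points X"
  by (auto simp: integral_curve_def continuous_map_def)

lemma integral_curve_open_vimage:
  assumes "integral_curve X \<xi> \<gamma>" "openin (mtop X) U"
  shows "open {t. \<gamma> t \<in> U}"
  using assms openin_continuous_map_preimage [of euclidean "mtop X" \<gamma> U] by (simp add: integral_curve_def)

lemma integral_curve_chart_derivative:
  assumes X: "complex_manifold X" and \<gamma>: "integral_curve X \<xi> \<gamma>" and c: "c \<in> atlas X" "\<gamma> t \<in> fst c" and k: "k < mdim X"
  shows "((\<lambda>s. snd c (\<gamma> s) k) has_field_derivative \<xi> (chart_inv c (snd c (\<gamma> t))) c k) (at t)"
proof -
  have "c \<in> charts_at X (\<gamma> t)" using c by (simp add: in_charts_at)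
  then have "((\<lambda>s. snd c (\<gamma> s) k) has_field_derivative \<xi> (\<gamma> t) c k) (at t)"
    using \<gamma> k unfolding integral_curve_def by blast
  then show ?thesis using chart_inv_chart [OF X c] by simp
qed

lemma integral_curve_holomorphic:
  assumes X: "complex_manifold X" and \<gamma>: "integral_curve X \<xi> \<gamma>" and c: "c \<in> atlas X" and S: "\<And>s. s \<in> S \<Longrightarrow> \<gamma> s \<in> fst c" and j: "j < mdim X"
  shows "(\<lambda>s. snd c (\<gamma> s) j) holomorphic_on S"
  unfolding holomorphic_on_def field_differentiable_def
  using integral_curve_chart_derivative [OF X \<gamma> c S j] has_field_derivative_at_within by blast

context
  fixes X :: "'x cmfd" and \<xi> :: "'x vfield"
  assumes X: "complex_manifold X"
    and \<xi>: "\<And>c j. c \<in> atlas X \<Longrightarrow> cholomorphic_on (mdim X) (snd c ` fst c) (\<lambda>z. \<xi> (chart_inv c z) c j)"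
begin

lemma vfield_chol_at:
  assumes "c \<in> atlas X" "x \<in> fst c"
  shows "chol_at (mdim X) (\<lambda>z. \<xi> (chart_inv c z) c j) (snd c x)"
  using \<xi> [OF assms(1)] assms chart_image_open [OF X assms(1)] by (auto simp: cholomorphic_on_iff_chol_at)

lemma integral_curve_higher_deriv:
  assumes \<gamma>: "integral_curve X \<xi> \<gamma>" and c: "c \<in> atlas X" and S: "open S" "\<And>s. s \<in> S \<Longrightarrow> \<gamma> s \<in> fst c" and t: "t \<in> S"
  shows "(deriv ^^ m) (\<lambda>s. snd c (\<gamma> s) j) t
      = (lie (mdim X) (\<lambda>k z. \<xi> (chart_inv c z) c k) ^^ m) (\<lambda>z. z j) (snd c (\<gamma> t))"
  by (rule higher_deriv_along_curve [where f = "\<lambda>z. z j" and \<gamma> = "\<lambda>s. snd c (\<gamma> s)" and S = S])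
    (use integral_curve_chart_derivative [OF X \<gamma> c S(2)] chart_in_cspace [OF X c S(2)] vfield_chol_at [OF c S(2)] S(1) t
      in \<open>auto intro: chol_at_coordinate\<close>)

text \<open>The Taylor coefficients at \<open>t\<close> of an integral curve in a chart are determined by its value at \<open>t\<close>.\<close>

lemma integral_curve_unique:
  assumes \<gamma>: "integral_curve X \<xi> \<gamma>" and \<delta>: "integral_curve X \<xi> \<delta>" and eq: "\<gamma> 0 = \<delta> 0"
  shows "\<gamma> t = \<delta> t"
proof -
  \<comment> \<open>The set where the curves agree is shown to be open by comparing Taylor series
    and closed by the Hausdorff property. It contains 0 and the complex plane is connected.\<close>
  have "open {t. \<gamma> t = \<delta> t}"
    unfolding open_subopen [of "{t. \<gamma> t = \<delta> t}"]
  proof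
    fix t assume "t \<in> {t. \<gamma> t = \<delta> t}"
    then have t: "\<gamma> t = \<delta> t" by simp
    obtain c where "c \<in> charts_at X (\<gamma> t)"
      using charts_at_nonempty [OF X integral_curve_points [OF \<gamma>]] by blast
    then have c: "c \<in> atlas X" "\<gamma> t \<in> fst c" by (auto simp: charts_at_def)
    have "open ({s. \<gamma> s \<in> fst c} \<inter> {s. \<delta> s \<in> fst c})"
      by (intro open_Int integral_curve_open_vimage [OF \<gamma>] integral_curve_open_vimage [OF \<delta>] chart_open [OF X c(1)])
    then obtain e where e: "e > 0" "ball t e \<subseteq> {s. \<gamma> s \<in> fst c} \<inter> {s. \<delta> s \<in> fst c}"
      using c t unfolding open_contains_ball by (metis (mono_tags, lifting) IntI mem_Collect_eq)
    have in1: "\<gamma> s \<in> fst c" and in2: "\<delta> s \<in> fst c" if "s \<in> ball t e" for s using e that by auto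
    have "\<gamma> s = \<delta> s" if s: "s \<in> ball t e" for s
    proof -
      have "snd c (\<gamma> s) j = snd c (\<delta> s) j" for j
      proof (cases "j < mdim X")
        case True
        have "(\<lambda>m. (deriv ^^ m) (\<lambda>s. snd c (\<gamma> s) j) t / fact m * (s - t) ^ m) sums snd c (\<gamma> s) j"
          by (rule holomorphic_power_series [OF integral_curve_holomorphic [OF X \<gamma> c(1) in1 True] s])
        moreover have "(\<lambda>m. (deriv ^^ m) (\<lambda>s. snd c (\<delta> s) j) t / fact m * (s - t) ^ m) sums snd c (\<delta> s) j"
          by (rule holomorphic_power_series [OF integral_curve_holomorphic [OF X \<delta> c(1) in2 True] s])
        moreover have "(deriv ^^ m) (\<lambda>s. snd c (\<gamma> s) j) t = (deriv ^^ m) (\<lambda>s. snd c (\<delta> s) j) t" for m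
          using integral_curve_higher_deriv [OF \<gamma> c(1) open_ball in1, where t = t and m = m and j = j]
            integral_curve_higher_deriv [OF \<delta> c(1) open_ball in2, where t = t and m = m and j = j] t e(1) by simp
        ultimately show ?thesis by (simp add: sums_unique2)
      next
        case False
        then show ?thesis
          using chart_in_cspace [OF X c(1) in1 [OF s]] chart_in_cspace [OF X c(1) in2 [OF s]] by (simp add: cspace_def)
      qed
      then have "snd c (\<gamma> s) = snd c (\<delta> s)" by blast
      then show ?thesis using inj_onD [OF chart_inj [OF X c(1)]] in1 [OF s] in2 [OF s] by blast
    qed
    then show "\<exists>T. open T \<and> t \<in> T \<and> T \<subseteq> {t. \<gamma> t = \<delta> t}"
      using e(1) by (intro exI [of _ "ball t e"]) auto
  qed
  moreover have "open (- {t. \<gamma> t = \<delta> t})"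
    unfolding open_subopen [of "- {t. \<gamma> t = \<delta> t}"]
  proof
    fix t assume "t \<in> - {t. \<gamma> t = \<delta> t}"
    then obtain U V where UV: "openin (mtop X) U" "openin (mtop X) V" "\<gamma> t \<in> U" "\<delta> t \<in> V" "disjnt U V"
      using X integral_curve_points [OF \<gamma>, of t] integral_curve_points [OF \<delta>, of t]
      unfolding complex_manifold_def Hausdorff_space_def by (metis (mono_tags, lifting) ComplD mem_Collect_eq)
    have "open ({s. \<gamma> s \<in> U} \<inter> {s. \<delta> s \<in> V})"
      by (intro open_Int integral_curve_open_vimage [OF \<gamma>] integral_curve_open_vimage [OF \<delta>] UV)
    then show "\<exists>T. open T \<and> t \<in> T \<and> T \<subseteq> - {t. \<gamma> t = \<delta> t}"
      using UV by (intro exI [of _ "{s. \<gamma> s \<in> U} \<inter> {s. \<delta> s \<in> V}"]) (auto simp: disjnt_iff)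
  qed
  ultimately have "{t. \<gamma> t = \<delta> t} = {} \<or> {t. \<gamma> t = \<delta> t} = UNIV"
    using clopen [of "{t. \<gamma> t = \<delta> t}"] by (simp add: closed_def)
  then show ?thesis using eq by blast
qed

end

text \<open>Used with \<open>a = 1\<close> for the group law of a flow, and with
  \<open>b = 0\<close> to rescale the time by a value of a character.\<close>

lemma integral_curve_affine:
  assumes "integral_curve X \<xi> \<gamma>"
  shows "integral_curve X (\<lambda>x c i. a * \<xi> x c i) (\<lambda>s. \<gamma> (a * s + b))"
  unfolding integral_curve_def
proof (intro conjI allI ballI impI)
  have "continuous_map euclidean (mtop X) (\<gamma> \<circ> (\<lambda>s. a * s + b))"
    using assms by (intro continuous_map_compose [of _ euclidean])
      (auto simp: integral_curve_def intro!: continuous_intros)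
  then show "continuous_map euclidean (mtop X) (\<lambda>s. \<gamma> (a * s + b))" by (simp add: o_def)
  fix t c i assume c: "c \<in> charts_at X (\<gamma> (a * t + b))" and i: "i < mdim X"
  have d1: "((\<lambda>s. snd c (\<gamma> s) i) has_field_derivative \<xi> (\<gamma> (a * t + b)) c i) (at (a * t + b))"
    using assms c i unfolding integral_curve_def by blast
  have d2: "((\<lambda>s. a * s + b) has_field_derivative a) (at t)"
    by (auto intro!: derivative_eq_intros)
  show "((\<lambda>s. snd c (\<gamma> (a * s + b)) i) has_field_derivative a * \<xi> (\<gamma> (a * t + b)) c i) (at t)"
    using DERIV_chain2 [where f = "\<lambda>s. snd c (\<gamma> s) i" and g = "\<lambda>s. a * s + b", OF d1 d2]
    by (simp add: mult.commute)
qed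

section \<open>Confinement of integral curves to a chart\<close>

lemma compact_closed_polydisc:
  "compactin (cEuclidean_space n) {z \<in> cspace n. \<forall>i<n. norm (z i - a i) \<le> r}"
proof -
  have "{z \<in> cspace n. \<forall>i<n. norm (z i - a i) \<le> r} = (\<Pi>\<^sub>E i\<in>UNIV. if i < n then cball (a i) r else {0})" (is "?A = ?B")
  proof (rule Set.set_eqI)
    fix z :: "nat \<Rightarrow> complex"
    have "z \<in> ?B \<longleftrightarrow> (\<forall>i. z i \<in> (if i < n then cball (a i) r else {0}))" by (auto simp: PiE_def Pi_def)
    also have "\<dots> \<longleftrightarrow> (\<forall>i. (n \<le> i \<longrightarrow> z i = 0) \<and> (i < n \<longrightarrow> norm (z i - a i) \<le> r))"
      by (intro all_cong1) (simp add: dist_norm norm_minus_commute)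
    also have "\<dots> \<longleftrightarrow> z \<in> ?A" by (simp add: all_conj_distrib cspace_def)
    finally show "z \<in> ?A \<longleftrightarrow> z \<in> ?B" by simp
  qed
  \<comment> \<open>Tychonoff's theorem for all coordinates at once: those from \<open>n\<close> on
    contribute the compact factor \<open>{0}\<close>.\<close>
  moreover have "compactin (product_topology (\<lambda>i. euclidean) UNIV) ?B"
    by (subst compactin_PiE) auto
  ultimately show ?thesis
    unfolding cEuclidean_space_def compactin_subtopology by (auto simp: euclidean_product_topology)
qed

text \<open>The point is closedness in all of \<open>X\<close>, not merely in the domain of the
  chart: the set is the image of a compact set in a Hausdorff space. It prevents a curve from
  leaving the chart directly from within this set.\<close>

lemma chart_closed_polydisc:
  assumes X: "complex_manifold X" and c: "c \<in> atlas X"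
    and sub: "{z \<in> cspace (mdim X). \<forall>i<mdim X. norm (z i - a i) \<le> r} \<subseteq> snd c ` fst c"
  shows "closedin (mtop X) {x \<in> fst c. \<forall>i<mdim X. norm (snd c x i - a i) \<le> r}"
proof -
  let ?K = "{z \<in> cspace (mdim X). \<forall>i<mdim X. norm (z i - a i) \<le> r}"
  have "continuous_map (subtopology (cEuclidean_space (mdim X)) (snd c ` fst c)) (mtop X) (chart_inv c)"
    unfolding continuous_map_def
  proof (intro conjI allI impI)
    show "chart_inv c \<in> topspace (subtopology (cEuclidean_space (mdim X)) (snd c ` fst c)) \<rightarrow> points X"
      using chart_inv_in [OF X c] chart_subset [OF X c] by auto
    fix U assume U: "openin (mtop X) U"
    have "{z \<in> topspace (subtopology (cEuclidean_space (mdim X)) (snd c ` fst c)). chart_inv c z \<in> U} = snd c ` (U \<inter> fst c)"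
      using chart_inv_chart [OF X c] chart_in_cspace [OF X c] by auto
    moreover have "openin (cEuclidean_space (mdim X)) (snd c ` (U \<inter> fst c))"
      using U chart_open [OF X c] by (intro chart_image_of_open [OF X c]) auto
    ultimately show "openin (subtopology (cEuclidean_space (mdim X)) (snd c ` fst c))
        {z \<in> topspace (subtopology (cEuclidean_space (mdim X)) (snd c ` fst c)). chart_inv c z \<in> U}"
      using chart_image_open [OF X c] by (auto simp: openin_open_subtopology)
  qed
  moreover have "compactin (subtopology (cEuclidean_space (mdim X)) (snd c ` fst c)) ?K"
    using sub compact_closed_polydisc by (simp add: compactin_subtopology)
  ultimately have "compactin (mtop X) (chart_inv c ` ?K)"
    by (rule image_compactin [rotated])
  moreover have "chart_inv c ` ?K = {x \<in> fst c. \<forall>i<mdim X. norm (snd c x i - a i) \<le> r}"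
  proof (intro equalityI subsetI)
    fix x assume "x \<in> chart_inv c ` ?K"
    then show "x \<in> {x \<in> fst c. \<forall>i<mdim X. norm (snd c x i - a i) \<le> r}"
      using sub chart_inv_in [OF X c] chart_chart_inv [OF X c] by auto
  next
    fix x assume "x \<in> {x \<in> fst c. \<forall>i<mdim X. norm (snd c x i - a i) \<le> r}"
    then have "x = chart_inv c (snd c x)" "snd c x \<in> ?K"
      using chart_inv_chart [OF X c] chart_in_cspace [OF X c] by auto
    then show "x \<in> chart_inv c ` ?K" by blast
  qed
  ultimately show ?thesis using X by (auto simp: complex_manifold_def intro: compactin_imp_closedin)
qed

context
  fixes X :: "'x cmfd" and \<xi> :: "'x vfield"
  assumes X: "complex_manifold X"
    and \<xi>: "\<And>c j. c \<in> atlas X \<Longrightarrow> cholomorphic_on (mdim X) (snd c ` fst c) (\<lambda>z. \<xi> (chart_inv c z) c j)"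
begin

text \<open>As long as the curve is in the polydisc of radius \<open>2 * r\<close>, every coordinate
  moves with speed at most \<open>B\<close>, hence by at most \<open>B * norm t\<close>, which is
  less than \<open>r\<close>. The circularity is removed by looking at the first exit along the
  straight segment from time 0 to time \<open>t\<close>.\<close>

lemma integral_curve_stays_in_polydisc:
  assumes \<gamma>: "integral_curve X \<xi> \<gamma>" and c: "c \<in> atlas X" and \<gamma>0: "\<gamma> 0 \<in> fst c"
    and start: "snd c (\<gamma> 0) \<in> polydisc (mdim X) a r"
    and sub: "polydisc (mdim X) a (2 * r) \<subseteq> snd c ` fst c"
    and B: "\<And>z k. z \<in> polydisc (mdim X) a (2 * r) \<Longrightarrow> k < mdim X \<Longrightarrow> norm (\<xi> (chart_inv c z) c k) \<le> B"
    and r: "0 < r" and B0: "0 \<le> B" and t: "B * norm t < r"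
  shows "\<gamma> t \<in> fst c \<and> snd c (\<gamma> t) \<in> polydisc (mdim X) a (2 * r)"
proof (rule ccontr)
  assume not: "\<not> (\<gamma> t \<in> fst c \<and> snd c (\<gamma> t) \<in> polydisc (mdim X) a (2 * r))"
  define \<sigma> where "\<sigma> s = \<gamma> (of_real s * t)" for s :: real
  \<comment> \<open>The largest distance reached: less than \<open>r\<close> at the start, and
    \<open>B * norm t\<close> for the travel. It is strictly below \<open>2 * r\<close>, so the
    closed set \<open>K\<close> of this radius fits inside the open set \<open>W\<close>.\<close>
  define \<rho> where "\<rho> = r + B * norm t"
  define W where "W = {x \<in> fst c. snd c x \<in> polydisc (mdim X) a (2 * r)}"
  define K where "K = {x \<in> fst c. \<forall>i<mdim X. norm (snd c x i - a i) \<le> \<rho>}"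
  have W: "openin (mtop X) W" unfolding W_def by (rule chart_vimage_of_open [OF X c openin_polydisc])
  have K: "closedin (mtop X) K"
    unfolding K_def
  proof (rule chart_closed_polydisc [OF X c])
    have "{z \<in> cspace (mdim X). \<forall>i<mdim X. norm (z i - a i) \<le> \<rho>} \<subseteq> polydisc (mdim X) a (2 * r)"
      using t by (fastforce simp: polydisc_def \<rho>_def)
    then show "{z \<in> cspace (mdim X). \<forall>i<mdim X. norm (z i - a i) \<le> \<rho>} \<subseteq> snd c ` fst c"
      using sub by blast
  qed
  have KW: "K \<subseteq> W"
    using t chart_in_cspace [OF X c] by (fastforce simp: K_def W_def polydisc_def \<rho>_def)
  have \<sigma>_open: "open {s. \<sigma> s \<in> U}" if "openin (mtop X) U" for U
  proof -
    have "open ((\<lambda>s :: real. of_real s * t) -` {u. \<gamma> u \<in> U})"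
      by (intro open_vimage integral_curve_open_vimage [OF \<gamma> that] continuous_intros)
    then show ?thesis by (simp add: \<sigma>_def vimage_def)
  qed
  \<comment> \<open>The parameters on the segment at which the curve is outside \<open>W\<close>.
    The set is closed and contains 1, so its infimum is attained and is the first exit.\<close>
  define A where "A = {s \<in> {0..1}. \<sigma> s \<notin> W}"
  have "A = {0..1} \<inter> - {s. \<sigma> s \<in> W}" by (auto simp: A_def)
  then have "closed A" using \<sigma>_open [OF W] by (simp add: closed_Int closed_Compl)
  moreover have "1 \<in> A" using not by (simp add: A_def \<sigma>_def W_def)
  moreover have bdd: "bdd_below A" by (rule bdd_belowI [of _ 0]) (simp add: A_def)
  ultimately have s0: "Inf A \<in> A" using closed_contains_Inf by blast
  have before: "\<sigma> s \<in> W" if "0 \<le> s" "s < Inf A" for s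
  proof (rule ccontr)
    assume "\<sigma> s \<notin> W"
    then have "s \<in> A" using that s0 by (auto simp: A_def)
    then show False using that cInf_lower [OF _ bdd] by fastforce
  qed
  have \<sigma>0: "\<sigma> 0 \<in> W"
    using \<gamma>0 start polydisc_mono [of r "2 * r"] r by (auto simp: \<sigma>_def W_def)
  have pos: "0 < Inf A" using s0 \<sigma>0 by (metis (mono_tags, lifting) A_def atLeastAtMost_iff less_eq_real_def mem_Collect_eq)
  have inK: "\<sigma> s \<in> K" if s: "0 \<le> s" "s < Inf A" for s
  proof -
    have "norm (snd c (\<sigma> s) i - a i) \<le> \<rho>" if i: "i < mdim X" for i
    proof -
      \<comment> \<open>The mean value inequality needs the bound on the derivative along the whole
        segment from 0 to \<open>of_real s * t\<close>. All its points are times before the first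
        exit.\<close>
      have seg: "\<gamma> u \<in> W" if u: "u \<in> closed_segment 0 (of_real s * t)" for u
      proof -
        obtain \<tau> where "0 \<le> \<tau>" "\<tau> \<le> 1" "u = \<tau> *\<^sub>R (of_real s * t)"
          using u by (auto simp: in_segment)
        then have "\<gamma> u = \<sigma> (\<tau> * s)" "0 \<le> \<tau> * s" "\<tau> * s < Inf A"
          using s mult_right_mono [of \<tau> 1 s] by (auto simp: \<sigma>_def scaleR_conv_of_real mult.assoc)
        then show ?thesis using before by simp
      qed
      have "norm (snd c (\<gamma> (of_real s * t)) i - snd c (\<gamma> 0) i) \<le> B * norm (of_real s * t - 0)"
      proof (rule field_differentiable_bound [where S = "closed_segment 0 (of_real s * t)" and f = "\<lambda>u. snd c (\<gamma> u) i"
            and f' = "\<lambda>u. \<xi> (chart_inv c (snd c (\<gamma> u))) c i"])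
        fix u assume u: "u \<in> closed_segment 0 (of_real s * t)"
        show "((\<lambda>u. snd c (\<gamma> u) i) has_field_derivative \<xi> (chart_inv c (snd c (\<gamma> u))) c i) (at u within closed_segment 0 (of_real s * t))"
          using seg [OF u] i
          by (intro has_field_derivative_at_within [OF integral_curve_chart_derivative [OF X \<gamma> c]]) (auto simp: W_def)
        show "norm (\<xi> (chart_inv c (snd c (\<gamma> u))) c i) \<le> B"
          using seg [OF u] i by (intro B) (auto simp: W_def)
      qed auto
      also have "\<dots> \<le> B * norm t"
        using s0 s by (intro mult_left_mono B0) (simp add: norm_mult A_def mult_left_le_one_le)
      finally have "norm (snd c (\<sigma> s) i - snd c (\<gamma> 0) i) \<le> B * norm t" by (simp add: \<sigma>_def)
      moreover have "norm (snd c (\<gamma> 0) i - a i) < r" using start i by (simp add: polydisc_def)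
      ultimately show ?thesis
        using norm_triangle_ineq [of "snd c (\<sigma> s) i - snd c (\<gamma> 0) i" "snd c (\<gamma> 0) i - a i"] by (simp add: \<rho>_def)
    qed
    then show ?thesis using before [OF s] by (simp add: K_def W_def)
  qed
  \<comment> \<open>By closedness the curve is still in \<open>K\<close> at the exit parameter,
    although it is outside \<open>W\<close> there.\<close>
  have "{s. \<sigma> s \<in> K} = - {s. \<sigma> s \<in> points X - K}"
    using integral_curve_points [OF \<gamma>] by (auto simp: \<sigma>_def)
  then have "closed {s. \<sigma> s \<in> K}" using \<sigma>_open [of "points X - K"] K by (auto simp: closedin_def)
  then have "closure {0<..<Inf A} \<subseteq> {s. \<sigma> s \<in> K}"
    using inK by (intro closure_minimal) auto
  then have "{0..Inf A} \<subseteq> {s. \<sigma> s \<in> K}" using pos by simp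
  then have "\<sigma> (Inf A) \<in> K" using pos by (auto simp: subset_iff)
  then show False using KW s0 by (auto simp: A_def)
qed

section \<open>Holomorphy of the flow of a complete field\<close>

context
  fixes \<Phi> :: "complex \<Rightarrow> 'x \<Rightarrow> 'x"
  assumes \<Phi>0: "\<And>x. x \<in> points X \<Longrightarrow> \<Phi> 0 x = x" and \<Phi>: "\<And>x. x \<in> points X \<Longrightarrow> integral_curve X \<xi> (\<lambda>t. \<Phi> t x)"
begin

lemma flow_points: "x \<in> points X \<Longrightarrow> \<Phi> t x \<in> points X"
  by (rule integral_curve_points [OF \<Phi>])

text \<open>As functions of \<open>s\<close> both sides are integral curves that start at
  \<open>\<Phi> t x\<close>, so uniqueness applies.\<close>

lemma flow_add:
  assumes x: "x \<in> points X" shows "\<Phi> (s + t) x = \<Phi> s (\<Phi> t x)"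
proof -
  have 1: "integral_curve X \<xi> (\<lambda>s. \<Phi> (s + t) x)"
    using integral_curve_affine [OF \<Phi> [OF x], of 1 t] by simp
  have 2: "integral_curve X \<xi> (\<lambda>s. \<Phi> s (\<Phi> t x))" by (rule \<Phi> [OF flow_points [OF x]])
  show ?thesis
    using integral_curve_unique [OF X \<xi> 1 2, of s] \<Phi>0 [OF flow_points [OF x], of t] by simp
qed

text \<open>Near a point of a chart the coordinates of the flow are the sums of their Taylor series in
  the time, whose coefficients are holomorphic in the initial point. By Cauchy's estimates the
  convergence is uniform.\<close>

lemma flow_holomorphic_at_0:
  assumes p: "p \<in> points X"
  shows "hmap_at (product_manifold X (cspace_manifold 1)) X (\<lambda>q. \<Phi> (snd q 0) (fst q)) (p, \<lambda>i. 0)"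
proof -
  define n where "n = mdim X"
  obtain c where ch: "c \<in> charts_at X p" using charts_at_nonempty [OF X p] by blast
  then have c: "c \<in> atlas X" and pc: "p \<in> fst c" by (auto simp: charts_at_def)
  define a where "a = snd c p"
  have a: "a \<in> cspace n" using chart_in_cspace [OF X c pc] by (simp add: a_def n_def)
  define V where "V k z = \<xi> (chart_inv c z) c k" for k z
  have V: "chol_at n (V k) (snd c x)" if "x \<in> fst c" for k x
    using vfield_chol_at [OF X \<xi> c that, where j = k] by (simp add: V_def [abs_def] n_def)
  \<comment> \<open>The summand 1 makes the bound strict at \<open>a\<close>, so that it persists
    nearby, and makes \<open>B\<close> positive even if the field vanishes at
    \<open>p\<close>.\<close>
  define B where "B = (\<Sum>k<n. norm (V k a)) + 1"
  have B: "0 < B" by (simp add: B_def add_nonneg_pos sum_nonneg)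
  have "eventually (\<lambda>z. \<forall>k\<in>{..<n}. norm (V k z) \<le> B) (nhds_cspace n a)"
  proof (intro eventually_ball_finite ballI)
    fix k assume k: "k \<in> {..<n}"
    have "norm (V k a) \<le> (\<Sum>k<n. norm (V k a))" using k by (intro member_le_sum) auto
    then have VB: "norm (V k a) < B" by (simp add: B_def)
    have "(V k \<longlongrightarrow> V k a) (at a within cspace n)"
      using V [OF pc] by (intro cdiff_at_tendsto chol_at_imp_cdiff_at) (simp add: a_def)
    then have "((\<lambda>z. norm (V k z)) \<longlongrightarrow> norm (V k a)) (at a within cspace n)" by (rule tendsto_norm)
    then have "eventually (\<lambda>z. norm (V k z) < B) (at a within cspace n)" using VB by (rule order_tendstoD)
    then show "eventually (\<lambda>z. norm (V k z) \<le> B) (nhds_cspace n a)"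
      using VB by (auto simp: eventually_at_filter eventually_inf_principal elim!: eventually_mono)
  qed auto
  then obtain e1 where e1: "0 < e1" "\<And>z k. z \<in> polydisc n a e1 \<Longrightarrow> k < n \<Longrightarrow> norm (V k z) \<le> B"
    using eventually_nhds_cspace_iff [OF a] by auto
  obtain e0 where e0: "0 < e0" "polydisc n a e0 \<subseteq> snd c ` fst c"
    using chart_image_open [OF X c] pc unfolding openin_cspace_iff a_def n_def by blast
  \<comment> \<open>Halved because curves that start in the polydisc of radius \<open>r\<close> are
    followed in the one of radius \<open>2 * r\<close>, which has to lie in the chart and in the
    region where \<open>B\<close> bounds the field.\<close>
  define r where "r = min e0 e1 / 2"
  have r: "0 < r" using e0 e1 by (simp add: r_def)
  have sub: "polydisc n a (2 * r) \<subseteq> snd c ` fst c" using e0 polydisc_mono [of "2 * r" e0 n a] by (auto simp: r_def)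
  have VB: "norm (V k z) \<le> B" if "z \<in> polydisc n a (2 * r)" "k < n" for k z
    using that e1(2) polydisc_mono [of "2 * r" e1 n a] by (auto simp: r_def)
  \<comment> \<open>The length of time for which the confinement lemma applies.\<close>
  define \<delta> where "\<delta> = r / B"
  have \<delta>: "0 < \<delta>" using r B by (simp add: \<delta>_def)
  define N where "N = {x \<in> fst c. snd c x \<in> polydisc n a r}"
  have N: "openin (mtop X) N" unfolding N_def n_def by (rule chart_vimage_of_open [OF X c openin_polydisc])
  have pN: "p \<in> N" using pc centre_in_polydisc [OF a r] by (simp add: N_def a_def)
  have NX: "x \<in> points X" if "x \<in> N" for x using that openin_subset [OF N] by blast
  have stay: "\<Phi> t x \<in> fst c" "snd c (\<Phi> t x) \<in> polydisc n a (2 * r)" if x: "x \<in> N" and t: "norm t < \<delta>" for x t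
  proof -
    have "\<Phi> t x \<in> fst c \<and> snd c (\<Phi> t x) \<in> polydisc (mdim X) a (2 * r)"
    proof (rule integral_curve_stays_in_polydisc [OF \<Phi> [OF NX [OF x]] c])
      show "norm (\<xi> (chart_inv c z) c k) \<le> B" if "z \<in> polydisc (mdim X) a (2 * r)" "k < mdim X" for z k
        using VB that by (simp add: V_def n_def)
      show "B * norm t < r" using t B by (simp add: \<delta>_def field_simps)
    qed (use x \<Phi>0 NX [OF x] sub r B in \<open>auto simp: N_def n_def\<close>)
    then show "\<Phi> t x \<in> fst c" "snd c (\<Phi> t x) \<in> polydisc n a (2 * r)" by (auto simp: n_def)
  qed
  \<comment> \<open>The coordinates of \<open>p\<close> at time 0. In \<open>cspace (n + 1)\<close>
    the time is the last coordinate, the one with index \<open>n\<close>.\<close>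
  define b where "b = cjoin n a (\<lambda>i. 0)"
  have b: "b \<in> cspace (n + 1)" "ctake n b = a" "b n = 0"
    using a by (auto simp: b_def cjoin_def cspace_def ctake_def)
  have XC: "complex_manifold (product_manifold X (cspace_manifold 1))"
    by (rule complex_manifold_product [OF X complex_manifold_cspace])
  have hf: "hfun_at (product_manifold X (cspace_manifold 1)) (\<lambda>q. snd c (\<Phi> (snd q 0) (fst q)) j) (p, \<lambda>i. 0)"
    if j: "j < n" for j
  proof -
    \<comment> \<open>The bound \<open>r\<close> keeps the starting points in \<open>N\<close>. The
      bound \<open>\<delta> / 2\<close> leaves a gap between the times that occur and the Cauchy
      circle of radius \<open>3 / 4 * \<delta>\<close>.\<close>
    define \<rho> where "\<rho> = min r (\<delta> / 2)"
    have \<rho>: "0 < \<rho>" "\<rho> \<le> r" "\<rho> \<le> \<delta> / 2" using r \<delta> by (auto simp: \<rho>_def)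
    define F where "F z = snd c (\<Phi> (z n) (chart_inv c (ctake n z))) j" for z
    \<comment> \<open>The Taylor term of degree \<open>m\<close> in the time. Written with iterated
      Lie derivatives instead of time derivatives, it is visibly holomorphic in the starting point
      as well.\<close>
    define T where "T m z = (lie n V ^^ m) (\<lambda>z. z j) (ctake n z) * z n ^ m * (1 / fact m)" for m z
    \<comment> \<open>A bound for the j-th coordinate on the polydisc of radius \<open>2 * r\<close>
      about \<open>a\<close>, where the curves remain.\<close>
    define C where "C = norm (a j) + 2 * r"
    have z_in: "ctake n z \<in> polydisc n a r" "norm (z n) < \<rho>" if "z \<in> polydisc (n + 1) b \<rho>" for z
      using that ctake_in_polydisc [OF that] b polydisc_mono [OF \<rho>(2), of n a] by (auto simp: polydisc_def)
    have x_in: "chart_inv c (ctake n z) \<in> N" "snd c (chart_inv c (ctake n z)) = ctake n z" if "z \<in> polydisc (n + 1) b \<rho>" for z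
    proof -
      have "ctake n z \<in> snd c ` fst c" using z_in(1) [OF that] sub polydisc_mono [of r "2 * r" n a] r by auto
      then show "chart_inv c (ctake n z) \<in> N" "snd c (chart_inv c (ctake n z)) = ctake n z"
        using z_in(1) [OF that] chart_inv_in [OF X c] chart_chart_inv [OF X c] by (auto simp: N_def)
    qed
    have taylor: "T m z = (deriv ^^ m) (\<lambda>t. snd c (\<Phi> t (chart_inv c (ctake n z))) j) 0 / fact m * (z n - 0) ^ m"
      and hol: "(\<lambda>t. snd c (\<Phi> t (chart_inv c (ctake n z))) j) holomorphic_on ball 0 \<delta>"
      if z: "z \<in> polydisc (n + 1) b \<rho>" for m z
    proof -
      note x = x_in [OF z]
      have inc: "\<Phi> t (chart_inv c (ctake n z)) \<in> fst c" if "t \<in> ball 0 \<delta>" for t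
        using stay(1) [OF x(1)] that by simp
      have "(deriv ^^ m) (\<lambda>t. snd c (\<Phi> t (chart_inv c (ctake n z))) j) 0
          = (lie (mdim X) (\<lambda>k z. \<xi> (chart_inv c z) c k) ^^ m) (\<lambda>z. z j) (snd c (\<Phi> 0 (chart_inv c (ctake n z))))"
        by (rule integral_curve_higher_deriv [OF X \<xi> \<Phi> [OF NX [OF x(1)]] c open_ball [of 0 \<delta>] inc]) (use \<delta> in auto)
      then show "T m z = (deriv ^^ m) (\<lambda>t. snd c (\<Phi> t (chart_inv c (ctake n z))) j) 0 / fact m * (z n - 0) ^ m"
        using x \<Phi>0 NX by (simp add: T_def V_def [abs_def] n_def)
      show "(\<lambda>t. snd c (\<Phi> t (chart_inv c (ctake n z))) j) holomorphic_on ball 0 \<delta>"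
        using j by (intro integral_curve_holomorphic [OF X \<Phi> [OF NX [OF x(1)]] c inc]) (auto simp: n_def)
    qed
    have sums: "(\<lambda>m. T m z) sums F z" if z: "z \<in> polydisc (n + 1) b \<rho>" for z
      unfolding taylor [OF z] F_def
      by (rule holomorphic_power_series [OF hol [OF z]]) (use z_in [OF z] \<rho> in auto)
    have bound: "norm (T m z) \<le> C * (2 / 3) ^ m" if z: "z \<in> polydisc (n + 1) b \<rho>" for m z
    proof -
      define h where "h t = snd c (\<Phi> t (chart_inv c (ctake n z))) j" for t
      \<comment> \<open>The circle lies strictly inside the disc of radius \<open>\<delta>\<close>
        on which \<open>h\<close> is holomorphic. Times are below \<open>\<delta> / 2\<close>, and
        the quotient of the two radii is the ratio 2/3 of the majorising series.\<close>
      have "norm ((deriv ^^ m) h 0) \<le> fact m * C / (3 / 4 * \<delta>) ^ m"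
      proof (rule Cauchy_inequality)
        have hh: "h holomorphic_on ball 0 \<delta>" using hol [OF z] by (simp add: h_def [abs_def])
        show "h holomorphic_on ball 0 (3 / 4 * \<delta>)" by (rule holomorphic_on_subset [OF hh]) (use \<delta> in auto)
        have "h holomorphic_on cball 0 (3 / 4 * \<delta>)" by (rule holomorphic_on_subset [OF hh]) (use \<delta> in auto)
        then show "continuous_on (cball 0 (3 / 4 * \<delta>)) h" by (rule holomorphic_on_imp_continuous_on)
        fix t :: complex assume "norm (0 - t) = 3 / 4 * \<delta>"
        then have "norm t < \<delta>" using \<delta> by simp
        then have "norm (h t - a j) < 2 * r"
          using stay(2) [OF x_in(1) [OF z]] j by (auto simp: h_def polydisc_def)
        then show "norm (h t) \<le> C" using norm_triangle_ineq2 [of "h t" "a j"] by (simp add: C_def)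
      qed (use \<delta> in auto)
      then have "norm ((deriv ^^ m) h 0) / fact m \<le> fact m * C / (3 / 4 * \<delta>) ^ m / fact m"
        by (rule divide_right_mono) simp
      then have "norm ((deriv ^^ m) h 0) / fact m \<le> C / (3 / 4 * \<delta>) ^ m"
        by (simp del: power_divide power_mult_distrib)
      moreover have "norm (z n) ^ m \<le> (\<delta> / 2) ^ m" using z_in(2) [OF z] \<rho> by (intro power_mono) auto
      ultimately have "norm ((deriv ^^ m) h 0) / fact m * norm (z n) ^ m \<le> C / (3 / 4 * \<delta>) ^ m * (\<delta> / 2) ^ m"
        using r \<delta> by (intro mult_mono) (auto simp: C_def intro!: divide_nonneg_nonneg)
      also have "\<dots> = C * (\<delta> / 2 / (3 / 4 * \<delta>)) ^ m" unfolding power_divide [of "\<delta> / 2"] by (rule times_divide_eq_left [THEN trans]) (rule times_divide_eq_right [symmetric])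
      also have "\<delta> / 2 / (3 / 4 * \<delta>) = 2 / 3" using \<delta> by simp
      finally show ?thesis
        unfolding taylor [OF z] h_def [abs_def, symmetric] by (simp add: norm_mult norm_divide norm_power)
    qed
    have "uniform_limit (polydisc (n + 1) b \<rho>) (\<lambda>k z. \<Sum>m<k. T m z) (\<lambda>z. suminf (\<lambda>m. T m z)) sequentially"
    proof (rule Weierstrass_m_test)
      show "norm (T m z) \<le> C * (2 / 3) ^ m" if "z \<in> polydisc (n + 1) b \<rho>" for m z by (rule bound [OF that])
      show "summable (\<lambda>m. C * (2 / 3) ^ m)" by (intro summable_mult summable_geometric) auto
    qed
    moreover have "chol_at (n + 1) (\<lambda>z. \<Sum>m<k. T m z) z" if z: "z \<in> polydisc (n + 1) b \<rho>" for k z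
      unfolding T_def
    proof (intro chol_at_sum chol_at_mult chol_at_power chol_at_coordinate chol_at_const)
      show zc: "z \<in> cspace (n + 1)" "z \<in> cspace (n + 1)" "z \<in> cspace (n + 1)" using z polydisc_subset_cspace by blast+
      have xc: "chart_inv c (ctake n z) \<in> fst c" using x_in(1) [OF z] by (simp add: N_def)
      show "chol_at (n + 1) (\<lambda>z. (lie n V ^^ m) (\<lambda>z. z j) (ctake n z)) z" for m
        using V [OF xc] x_in(2) [OF z]
        by (intro chol_at_ctake [OF zc(1)] chol_at_lie_iterate chol_at_coordinate ctake_in_cspace) simp
    qed
    ultimately have "chol_at (n + 1) (\<lambda>z. suminf (\<lambda>m. T m z)) b"
      by (intro chol_at_uniform_limit [OF _ _ b(1) \<rho>(1)])
    moreover have "eventually (\<lambda>z. suminf (\<lambda>m. T m z) = F z) (nhds_cspace (n + 1) b)"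
      by (rule eventually_nhds_cspaceI [OF openin_polydisc centre_in_polydisc [OF b(1) \<rho>(1)]])
        (simp add: sums_unique [OF sums, symmetric])
    ultimately have F: "chol_at (n + 1) F b" by (rule chol_at_transform)
    define d where "d = (cspace 1, id :: (nat \<Rightarrow> complex) \<Rightarrow> nat \<Rightarrow> complex)"
    define k where "k = product_chart n c d"
    have d: "d \<in> atlas (cspace_manifold 1)" by (simp add: d_def)
    have dinv: "chart_inv d w = w" if "w \<in> cspace 1" for w
      using that by (simp add: d_def chart_inv_def inv_into_f_f)
    have k: "k \<in> charts_at (product_manifold X (cspace_manifold 1)) (p, \<lambda>i. 0)"
      using ch d unfolding charts_at_product_manifold k_def n_def
      by (intro CollectI exI [of _ c] exI [of _ d]) (simp add: charts_at_def d_def cspace_def)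
    have kp: "snd k (p, \<lambda>i. 0) = b" by (simp add: k_def snd_product_chart b_def a_def d_def)
    have "eventually (\<lambda>z. F z = snd c (\<Phi> (snd (chart_inv k z) 0) (fst (chart_inv k z))) j) (nhds_cspace (n + 1) b)"
    proof (rule eventually_nhds_cspaceI)
      show "openin (cEuclidean_space (n + 1)) (snd k ` (fst c \<times> cspace 1))"
        using is_chart_product [OF X complex_manifold_cspace c d] by (simp add: is_chart_def k_def n_def d_def)
      show "b \<in> snd k ` (fst c \<times> cspace 1)"
        using pc by (subst kp [symmetric]) (auto simp: cspace_def)
      fix z assume z: "z \<in> snd k ` (fst c \<times> cspace 1)"
      then have ki: "chart_inv k z = (chart_inv c (ctake n z), chart_inv d (cdrop n z))"
        using product_chart_inv [OF X complex_manifold_cspace c d, of z] by (simp add: k_def n_def d_def)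
      have "cdrop n z \<in> cspace 1"
        using z by (auto simp: k_def snd_product_chart d_def)
      then show "F z = snd c (\<Phi> (snd (chart_inv k z) 0) (fst (chart_inv k z))) j"
        unfolding ki F_def by (simp add: dinv) (simp add: cdrop_def)
    qed
    with F have "chol_at (n + 1) (\<lambda>z. snd c (\<Phi> (snd (chart_inv k z) 0) (fst (chart_inv k z))) j) b"
      by (rule chol_at_transform)
    then show ?thesis
      unfolding hfun_at_def using k kp by (intro bexI [of _ k]) (simp_all add: n_def)
  qed
  show ?thesis
  proof (rule hmap_atI [OF XC X, where d = c])
    show "(p, \<lambda>i. 0) \<in> points (product_manifold X (cspace_manifold 1))" using p by (simp add: cspace_def)
    show "c \<in> charts_at X (\<Phi> (snd (p, \<lambda>i. 0 :: complex) 0) (fst (p, \<lambda>i :: nat. 0 :: complex)))"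
      using ch \<Phi>0 [OF p] by simp
    have "openin (mtop (product_manifold X (cspace_manifold 1))) (N \<times> polydisc 1 (\<lambda>i. 0) \<delta>)"
      using N openin_polydisc by (simp add: openin_prod_Times_iff)
    moreover have "(p, \<lambda>i. 0) \<in> N \<times> polydisc 1 (\<lambda>i. 0) \<delta>" using pN \<delta> by (simp add: polydisc_def cspace_def)
    moreover have "\<Phi> (snd q 0) (fst q) \<in> fst c" if "q \<in> N \<times> polydisc 1 (\<lambda>i. 0) \<delta>" for q
      using that by (intro stay(1)) (auto simp: polydisc_def)
    ultimately show "\<forall>\<^sub>F q in nhdsin (mtop (product_manifold X (cspace_manifold 1))) (p, \<lambda>i. 0). \<Phi> (snd q 0) (fst q) \<in> fst c"
      unfolding eventually_nhdsin by blast
  qed (rule hf, simp add: n_def)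
qed

text \<open>The set of times at which the flow is jointly holomorphic near \<open>p\<close> is closed because
  \<open>\<Phi> t = \<Phi> (t - s) \<circ> \<Phi> s\<close>, where for \<open>s\<close> near \<open>t\<close> the first factor is given by the local result.\<close>

lemma flow_holomorphic:
  assumes p: "p \<in> points X" and v: "v \<in> cspace 1"
  shows "hmap_at (product_manifold X (cspace_manifold 1)) X (\<lambda>q. \<Phi> (snd q 0) (fst q)) (p, v)"
proof -
  let ?C = "cspace_manifold 1"
  let ?XC = "product_manifold X ?C"
  let ?F = "\<lambda>q :: 'x \<times> (nat \<Rightarrow> complex). \<Phi> (snd q 0) (fst q)"
  define e :: "complex \<Rightarrow> nat \<Rightarrow> complex" where "e t = (\<lambda>i. if i = 0 then t else 0)" for t
  have e: "e t \<in> cspace 1" "e t 0 = t" for t by (auto simp: e_def cspace_def)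
  note C = complex_manifold_cspace [of 1]
  note XC = complex_manifold_product [OF X C]
  define good where "good = {t. hmap_at ?XC X ?F (p, e t)}"
  \<comment> \<open>Holomorphy of a germ is an open condition and open sets of a product contain
    boxes, so one radius \<open>\<eta>\<close> in time serves a whole neighbourhood of
    \<open>y\<close>.\<close>
  have box: "\<exists>N \<eta>. openin (mtop X) N \<and> y \<in> N \<and> 0 < \<eta> \<and> (\<forall>x\<in>N. \<forall>s\<in>ball t \<eta>. hmap_at ?XC X ?F (x, e s))"
    if h: "hmap_at ?XC X ?F (y, e t)" for y t
  proof -
    obtain S where S: "openin (mtop ?XC) S" "(y, e t) \<in> S" "\<And>q. q \<in> S \<Longrightarrow> hmap_at ?XC X ?F q"
      using hmap_at_eventually [OF XC X h] hmap_at_points(1) [OF h] unfolding eventually_nhdsin by blast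
    obtain N V where NV: "openin (mtop X) N" "openin (cEuclidean_space 1) V" "y \<in> N" "e t \<in> V" "N \<times> V \<subseteq> S"
      using S(1,2) unfolding product_manifold_simps cspace_manifold_simps openin_prod_topology_alt by metis
    obtain \<eta> where \<eta>: "0 < \<eta>" "polydisc 1 (e t) \<eta> \<subseteq> V"
      using NV(2,4) unfolding openin_cspace_iff by blast
    have "e s \<in> V" if "s \<in> ball t \<eta>" for s
      using that \<eta>(2) e [of s] by (auto simp: polydisc_def dist_norm norm_minus_commute e(2) subset_iff)
    then show ?thesis using S(3) NV \<eta>(1) by blast
  qed
  have "open good"
    unfolding open_contains_ball
  proof
    fix t assume "t \<in> good"
    then show "\<exists>\<eta>>0. ball t \<eta> \<subseteq> good" using box [of p t] by (auto simp: good_def)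
  qed
  moreover have "open (- good)"
    unfolding open_contains_ball
  proof
    fix t assume t: "t \<in> - good"
    have y: "\<Phi> t p \<in> points X" by (rule flow_points [OF p])
    have "e 0 = (\<lambda>i. 0)" by (auto simp: e_def)
    \<comment> \<open>The box is taken around \<open>\<Phi> t p\<close> at time 0. For
      \<open>s\<close> near \<open>t\<close> the point \<open>\<Phi> s p\<close> lies in
      \<open>N\<close>, so the factor \<open>\<Phi> (t - s)\<close> is available there with the same
      \<open>\<delta>\<close> for all these \<open>s\<close>.\<close>
    then obtain N \<delta> where N: "openin (mtop X) N" "\<Phi> t p \<in> N" "0 < \<delta>"
      "\<And>x s. x \<in> N \<Longrightarrow> s \<in> ball 0 \<delta> \<Longrightarrow> hmap_at ?XC X ?F (x, e s)"
      using box [of "\<Phi> t p" 0] flow_holomorphic_at_0 [OF y] by metis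
    have "open {s. \<Phi> s p \<in> N}" by (rule integral_curve_open_vimage [OF \<Phi> [OF p] N(1)])
    then obtain \<eta> where \<eta>: "0 < \<eta>" "\<And>s. s \<in> ball t \<eta> \<Longrightarrow> \<Phi> s p \<in> N"
      using N(2) unfolding open_contains_ball by blast
    \<comment> \<open>A good time this close to \<open>t\<close> would make \<open>t\<close> good
      through the factorisation.\<close>
    have "s \<notin> good" if s: "s \<in> ball t (min \<eta> \<delta>)" for s
    proof
      assume "s \<in> good"
      then have gs: "hmap_at ?XC X ?F (p, e s)" by (simp add: good_def)
      have pt: "(p, e t) \<in> points ?XC" using p e by simp
      have const: "hmap_at X ?C (\<lambda>x. e s) p"
        using e hfun_at_const [OF X p]
        by (subst hmap_at_cspace_manifold_iff [OF X p]) (auto intro: always_eventually)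
      \<comment> \<open>Freezing the time turns joint holomorphy at \<open>(p, e s)\<close> into
        holomorphy of the single map \<open>\<Phi> s\<close> at \<open>p\<close>, the first
        factor.\<close>
      have "hmap_at X ?XC (\<lambda>x. (x, e s)) p"
        by (rule hmap_at_pair [OF X C X hmap_at_id [OF X p] const])
      then have "hmap_at X X (\<lambda>x. ?F (x, e s)) p"
        by (rule hmap_at_compose [where f = "\<lambda>x. (x, e s)" and g = ?F, OF X XC X _ gs])
      then have s1: "hmap_at X X (\<lambda>x. \<Phi> s x) (fst (p, e t))" by (simp add: e)
      have f: "hmap_at ?XC X (\<lambda>q. \<Phi> s (fst q)) (p, e t)"
        by (rule hmap_at_compose [where f = fst and g = "\<Phi> s", OF XC X X hmap_at_fst [OF X C pt] s1])
      have ch: "(cspace 1, id) \<in> charts_at ?C (snd (p, e t))" using e by (simp add: charts_at_def)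
      have "hfun_at ?XC (\<lambda>q. snd q 0 + - s) (p, e t)"
        using hfun_at_snd [OF X C hfun_at_chart_coordinate [OF C ch, of 0]] p
        by (intro hfun_at_add [OF XC] hfun_at_const [OF XC pt]) simp
      then have g: "hmap_at ?XC ?C (\<lambda>q. e (snd q 0 - s)) (p, e t)"
        using e by (subst hmap_at_cspace_manifold_iff [OF XC pt]) (auto intro: always_eventually)
      have "hmap_at ?XC X ?F (\<Phi> s p, e (t - s))"
        using s by (intro N(4) \<eta>(2)) (auto simp: dist_norm norm_minus_commute)
      then have "hmap_at ?XC X (\<lambda>q. ?F (\<Phi> s (fst q), e (snd q 0 - s))) (p, e t)"
        by (intro hmap_at_compose [where f = "\<lambda>q. (\<Phi> s (fst q), e (snd q 0 - s))" and g = ?F, OF XC XC X hmap_at_pair [OF X C XC f g]])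
          (simp add: e)
      moreover have "eventually (\<lambda>q. ?F (\<Phi> s (fst q), e (snd q 0 - s)) = ?F q) (nhdsin (mtop ?XC) (p, e t))"
        using eventually_nhdsin_topspace
      proof eventually_elim
        case (elim q)
        then have "fst q \<in> points X" by auto
        then show ?case using flow_add [of "fst q" "snd q 0 - s" s] by (simp add: e)
      qed
      ultimately have "hmap_at ?XC X ?F (p, e t)" by (rule hmap_at_cong [OF XC X])
      then show False using t by (simp add: good_def)
    qed
    then show "\<exists>\<epsilon>>0. ball t \<epsilon> \<subseteq> - good" using \<eta> N(3) by (intro exI [of _ "min \<eta> \<delta>"]) auto
  qed
  ultimately have "good = {} \<or> good = UNIV" using clopen [of good] by (simp add: closed_def)
  moreover have "0 \<in> good" using flow_holomorphic_at_0 [OF p] by (simp add: good_def e_def)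
  ultimately have "v 0 \<in> good" by blast
  moreover have "v = e (v 0)" using v by (auto simp: e_def cspace_def)
  ultimately show ?thesis by (simp add: good_def)
qed

end

end

section \<open>Equivariance of flows\<close>

text \<open>The library's \<open>group_action\<close> is a homomorphism into the group of
  extensional bijections. Bijectivity comes from the inverse elements, which leaves the usual axioms
  and extensionality to be checked.\<close>

lemma group_actionI:
  assumes G: "group G"
    and closed: "\<And>g x. g \<in> carrier G \<Longrightarrow> x \<in> S \<Longrightarrow> \<beta> g x \<in> S"
    and one: "\<And>x. x \<in> S \<Longrightarrow> \<beta> \<one>\<^bsub>G\<^esub> x = x"
    and mult: "\<And>g h x. g \<in> carrier G \<Longrightarrow> h \<in> carrier G \<Longrightarrow> x \<in> S \<Longrightarrow> \<beta> (g \<otimes>\<^bsub>G\<^esub> h) x = \<beta> g (\<beta> h x)"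
    and ext: "\<And>g. g \<in> carrier G \<Longrightarrow> \<beta> g \<in> extensional S"
  shows "group_action G S \<beta>"
proof -
  interpret G: group G by (rule G)
  have Bij: "\<beta> g \<in> Bij S" if g: "g \<in> carrier G" for g
  proof -
    have "bij_betw (\<beta> g) S S"
    proof (rule bij_betwI [where g = "\<beta> (inv\<^bsub>G\<^esub> g)"])
      show "\<beta> (inv\<^bsub>G\<^esub> g) (\<beta> g x) = x" if "x \<in> S" for x
        using mult [of "inv\<^bsub>G\<^esub> g" g x] g that one by simp
      show "\<beta> g (\<beta> (inv\<^bsub>G\<^esub> g) x) = x" if "x \<in> S" for x
        using mult [of g "inv\<^bsub>G\<^esub> g" x] g that one by simp
    qed (use g closed in auto)
    then show ?thesis using ext [OF g] by (simp add: Bij_def)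
  qed
  have "\<beta> (g \<otimes>\<^bsub>G\<^esub> h) = compose S (\<beta> g) (\<beta> h)" if "g \<in> carrier G" "h \<in> carrier G" for g h
    using that mult ext [of "g \<otimes>\<^bsub>G\<^esub> h"]
    by (intro extensionalityI [of _ S]) (auto simp: compose_def)
  then have "\<beta> \<in> hom G (BijGroup S)"
    using Bij by (auto simp: hom_def BijGroup_def)
  then show ?thesis
    unfolding group_action_def group_hom_def group_hom_axioms_def using G group_BijGroup by blast
qed

lemma group_actionD:
  assumes "group_action G S \<alpha>"
  shows "g \<in> carrier G \<Longrightarrow> x \<in> S \<Longrightarrow> \<alpha> g x \<in> S"
    and "x \<in> S \<Longrightarrow> \<alpha> \<one>\<^bsub>G\<^esub> x = x"
    and "g \<in> carrier G \<Longrightarrow> h \<in> carrier G \<Longrightarrow> x \<in> S \<Longrightarrow> \<alpha> (g \<otimes>\<^bsub>G\<^esub> h) x = \<alpha> g (\<alpha> h x)"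
    and "g \<in> carrier G \<Longrightarrow> x \<in> S \<Longrightarrow> \<alpha> (inv\<^bsub>G\<^esub> g) (\<alpha> g x) = x"
proof -
  interpret group_action G S \<alpha> by (rule assms)
  interpret G: group G using group_hom by (simp add: group_hom_def)
  show "g \<in> carrier G \<Longrightarrow> x \<in> S \<Longrightarrow> \<alpha> g x \<in> S" using element_image by blast
  show one: "x \<in> S \<Longrightarrow> \<alpha> \<one>\<^bsub>G\<^esub> x = x" using id_eq_one by (metis restrict_apply')
  show mult: "g \<in> carrier G \<Longrightarrow> h \<in> carrier G \<Longrightarrow> x \<in> S \<Longrightarrow> \<alpha> (g \<otimes>\<^bsub>G\<^esub> h) x = \<alpha> g (\<alpha> h x)" for g h
    using composition_rule by blast
  show "g \<in> carrier G \<Longrightarrow> x \<in> S \<Longrightarrow> \<alpha> (inv\<^bsub>G\<^esub> g) (\<alpha> g x) = x"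
    using mult [of "inv\<^bsub>G\<^esub> g" g] one by simp
qed

lemma holomorphic_action_hmap_at:
  assumes G: "complex_manifold (gmfd G)" and X: "complex_manifold X" and act: "holomorphic_action G X \<alpha>"
    and g: "g \<in> points (gmfd G)" and x: "x \<in> points X"
  shows "hmap_at X X (\<alpha> g) x"
proof -
  have GX: "complex_manifold (product_manifold (gmfd G) X)" by (rule complex_manifold_product [OF G X])
  have 1: "hmap_at (product_manifold (gmfd G) X) X (\<lambda>(g, x). \<alpha> g x) (g, x)"
    using act g x by (simp add: holomorphic_action_def holomorphic_map_iff_hmap_at [OF GX X])
  obtain c where c: "c \<in> charts_at (gmfd G) g" using charts_at_nonempty [OF G g] by blast
  have "hmap_at X (gmfd G) (\<lambda>x. g) x"
    by (rule hmap_atI [OF X G x, where d = c]) (use c in \<open>auto simp: in_charts_at intro: hfun_at_const [OF X x] always_eventually\<close>)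
  then have "hmap_at X (product_manifold (gmfd G) X) (\<lambda>x. (g, x)) x"
    by (intro hmap_at_pair [OF G X X] hmap_at_id [OF X x])
  then show ?thesis
    using hmap_at_compose [where f = "\<lambda>x. (g, x)" and g = "\<lambda>(g, x). \<alpha> g x", OF X GX X _ 1] by simp
qed

lemma vfields_charD:
  assumes "\<xi> \<in> vfields_char G X \<alpha> \<kappa>"
  shows "x \<in> points X \<Longrightarrow> \<xi> x \<in> tangent_space X x"
    and "c \<in> atlas X \<Longrightarrow> cholomorphic_on (mdim X) (snd c ` fst c) (\<lambda>z. \<xi> (chart_inv c z) c j)"
    and "g \<in> carrier G \<Longrightarrow> push_vfield G X \<alpha> g \<xi> = (\<lambda>x\<in>points X. \<lambda>c i. \<kappa> g * \<xi> x c i)"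
  using assms unfolding vfields_char_def holomorphic_vfields_def by (blast dest: PiE_mem)+

text \<open>By the chain rule the velocity of the image curve is the differential of
  \<open>\<alpha> g\<close> applied to \<open>\<xi> (\<gamma> t)\<close>. Since the inverse of
  \<open>g\<close> takes the image point back to \<open>\<gamma> t\<close>, this is the value there
  of the pushed field, which the character condition evaluates.\<close>

lemma integral_curve_image:
  assumes G: "complex_lie_group G" and X: "complex_manifold X" and act: "holomorphic_action G X \<alpha>"
    and \<xi>: "\<xi> \<in> vfields_char G X \<alpha> \<kappa>" and \<gamma>: "integral_curve X \<xi> \<gamma>" and g: "g \<in> carrier G"
  shows "integral_curve X (\<lambda>x c i. \<kappa> g * \<xi> x c i) (\<lambda>t. \<alpha> g (\<gamma> t))"
proof -
  have Gm: "complex_manifold (gmfd G)" and Gp: "points (gmfd G) = carrier G"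
    using G by (auto simp: complex_lie_group_def)
  have ga: "group_action G (points X) \<alpha>" using act by (simp add: holomorphic_action_def)
  have hm: "hmap_at X X (\<alpha> g) x" if "x \<in> points X" for x
    using g Gp that by (intro holomorphic_action_hmap_at [OF Gm X act]) auto
  then have "holomorphic_map X X (\<alpha> g)" using holomorphic_map_iff_hmap_at [OF X X] by blast
  then have cont: "continuous_map (mtop X) (mtop X) (\<alpha> g)" by (simp add: holomorphic_map_def)
  show ?thesis
    unfolding integral_curve_def
  proof (intro conjI allI ballI impI)
    show "continuous_map euclidean (mtop X) (\<lambda>t. \<alpha> g (\<gamma> t))"
      using continuous_map_compose [OF _ cont] \<gamma> by (fastforce simp: integral_curve_def o_def)
    fix t d i assume d: "d \<in> charts_at X (\<alpha> g (\<gamma> t))" and i: "i < mdim X"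
    have p: "\<gamma> t \<in> points X" by (rule integral_curve_points [OF \<gamma>])
    \<comment> \<open>The very chart that \<open>differential\<close> selects, so that the sum from
      the chain rule is literally what \<open>push_vfield\<close> unfolds to.\<close>
    define c where "c = (SOME c. c \<in> charts_at X (\<gamma> t))"
    have c: "c \<in> charts_at X (\<gamma> t)"
      unfolding c_def by (rule someI_ex [OF charts_at_nonempty [OF X p]])
    then have ca: "c \<in> atlas X" "\<gamma> t \<in> fst c" by (auto simp: in_charts_at)
    define h where "h z = snd d (\<alpha> g (chart_inv c z)) i" for z
    define S where "S = {s. \<gamma> s \<in> fst c}"
    have S: "open S" "t \<in> S"
      unfolding S_def using integral_curve_open_vimage [OF \<gamma> chart_open [OF X ca(1)]] ca by auto
    have "chol_at (mdim X) h (snd c (\<gamma> t))"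
      unfolding h_def [abs_def] by (rule hfun_at_chart [OF X hmap_at_chart [OF X X hm [OF p] d] c])
    then have "((\<lambda>s. h (snd c (\<gamma> s))) has_field_derivative
        (\<Sum>k<mdim X. pd k h (snd c (\<gamma> t)) * \<xi> (chart_inv c (snd c (\<gamma> t))) c k)) (at t)"
      by (intro cdiff_at_curve [where \<gamma> = "\<lambda>s. snd c (\<gamma> s)", OF _ S] chol_at_imp_cdiff_at
          integral_curve_chart_derivative [OF X \<gamma> ca] chart_in_cspace [OF X ca(1)]) (auto simp: S_def)
    moreover have "(\<Sum>k<mdim X. pd k h (snd c (\<gamma> t)) * \<xi> (chart_inv c (snd c (\<gamma> t))) c k)
        = push_vfield G X \<alpha> g \<xi> (\<alpha> g (\<gamma> t)) d i"
      using group_actionD(1,4) [OF ga g p] d chart_inv_chart [OF X ca]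
      by (simp add: push_vfield_def differential_def Let_def cjacobian_def pd_def h_def flip: c_def)
    moreover have "push_vfield G X \<alpha> g \<xi> (\<alpha> g (\<gamma> t)) d i = \<kappa> g * \<xi> (\<alpha> g (\<gamma> t)) d i"
      using group_actionD(1) [OF ga g p] by (simp add: vfields_charD(3) [OF \<xi> g])
    ultimately have "((\<lambda>s. h (snd c (\<gamma> s))) has_field_derivative \<kappa> g * \<xi> (\<alpha> g (\<gamma> t)) d i) (at t)"
      by simp
    then show "((\<lambda>s. snd d (\<alpha> g (\<gamma> s)) i) has_field_derivative \<kappa> g * \<xi> (\<alpha> g (\<gamma> t)) d i) (at t)"
      by (rule has_field_derivative_transform_within_open [OF _ S])
        (simp add: h_def S_def chart_inv_chart [OF X ca(1)])
  qed
qed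

text \<open>Both sides are integral curves of the rescaled field, \<open>\<kappa> g\<close> times
  \<open>\<xi>\<close>, starting at \<open>\<alpha> g x\<close>: the left one as an image under
  \<open>g\<close>, the right one by a change of speed.\<close>

lemma flow_equivariant:
  assumes G: "complex_lie_group G" and X: "complex_manifold X" and act: "holomorphic_action G X \<alpha>"
    and \<xi>: "\<xi> \<in> vfields_char G X \<alpha> \<kappa>"
    and \<Phi>0: "\<And>x. x \<in> points X \<Longrightarrow> \<Phi> 0 x = x" and \<Phi>: "\<And>x. x \<in> points X \<Longrightarrow> integral_curve X \<xi> (\<lambda>t. \<Phi> t x)"
    and g: "g \<in> carrier G" and x: "x \<in> points X"
  shows "\<alpha> g (\<Phi> t x) = \<Phi> (\<kappa> g * t) (\<alpha> g x)"
proof -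
  have ga: "group_action G (points X) \<alpha>" using act by (simp add: holomorphic_action_def)
  have gx: "\<alpha> g x \<in> points X" using group_actionD(1) [OF ga g x] .
  have hol: "cholomorphic_on (mdim X) (snd c ` fst c) (\<lambda>z. \<kappa> g * \<xi> (chart_inv c z) c j)" if c: "c \<in> atlas X" for c j
    using vfields_charD(2) [OF \<xi> c, of j] chol_at_mult [OF chol_at_const] chart_image_open [OF X c]
    by (auto simp: cholomorphic_on_iff_chol_at chol_at_def [of _ "\<lambda>z. \<xi> (chart_inv c z) c j"] intro: chol_at_mult chol_at_const)
  have 1: "integral_curve X (\<lambda>x c i. \<kappa> g * \<xi> x c i) (\<lambda>t. \<alpha> g (\<Phi> t x))"
    by (rule integral_curve_image [OF G X act \<xi> \<Phi> [OF x] g])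
  have 2: "integral_curve X (\<lambda>x c i. \<kappa> g * \<xi> x c i) (\<lambda>t. \<Phi> (\<kappa> g * t) (\<alpha> g x))"
    using integral_curve_affine [OF \<Phi> [OF gx], of "\<kappa> g" 0] by simp
  show ?thesis
    using integral_curve_unique [OF X hol 1 2, of t] \<Phi>0 x gx by simp
qed

section \<open>The spray of a family of complete vector fields\<close>

definition unit_vector :: "nat \<Rightarrow> nat \<Rightarrow> complex" where
  "unit_vector i = (\<lambda>k. if k = i then 1 else 0)"

lemma unit_vector_in_cspace: "i < n \<Longrightarrow> unit_vector i \<in> cspace n"
  by (auto simp: unit_vector_def cspace_def)

lemma zero_in_cspace: "(\<lambda>i. 0) \<in> cspace n"
  by (simp add: cspace_def)

text \<open>\<open>clinear_on\<close> speaks of sums of two vectors only, so the expansion is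
  reached by adding one coordinate of \<open>w\<close> at a time.\<close>

lemma clinear_on_expand:
  assumes T: "clinear_on n T" and w: "w \<in> cspace n"
  shows "T w j = (\<Sum>i<n. w i * T (unit_vector i) j)"
proof -
  have "T (\<lambda>k. if k < m then w k else 0) j = (\<Sum>i<m. w i * T (unit_vector i) j)" if "m \<le> n" for m
    using that
  proof (induction m)
    case 0
    have "\<forall>v\<in>cspace n. T (\<lambda>i. 0 * v i) = (\<lambda>i. 0 * T v i)" using T unfolding clinear_on_def by blast
    from bspec [OF this zero_in_cspace] have "T (\<lambda>i. 0) = (\<lambda>i. 0)" by simp
    then show ?case by simp
  next
    case (Suc m)
    have 1: "(\<lambda>k. if k < m then w k else 0) \<in> cspace n" using Suc.prems by (simp add: cspace_def)
    have u: "unit_vector m \<in> cspace n" using Suc.prems by (simp add: unit_vector_in_cspace)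
    have 2: "(\<lambda>k. w m * unit_vector m k) \<in> cspace n" using u by (simp add: cspace_def)
    have "(\<lambda>k. if k < Suc m then w k else 0) = (\<lambda>k. (if k < m then w k else 0) + w m * unit_vector m k)"
      by (auto simp: unit_vector_def less_Suc_eq)
    then have "T (\<lambda>k. if k < Suc m then w k else 0) j = T (\<lambda>k. if k < m then w k else 0) j + T (\<lambda>k. w m * unit_vector m k) j"
      using T 1 2 by (simp add: clinear_on_def)
    also have "T (\<lambda>k. w m * unit_vector m k) j = w m * T (unit_vector m) j"
      using T u by (simp add: clinear_on_def)
    finally show ?case using Suc by simp
  qed
  from this [of n] have "T (\<lambda>k. if k < n then w k else 0) j = (\<Sum>i<n. w i * T (unit_vector i) j)" by simp
  moreover have "(\<lambda>k. if k < n then w k else 0) = w" using w by (auto simp: cspace_def)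
  ultimately show ?thesis by simp
qed

text \<open>The charts of a fibre are linear isomorphisms, so their transition maps are linear; this
  computes how tangent vectors of the fibre transform.\<close>

lemma cjacobian_clinear_on:
  assumes T: "clinear_on n T" and w: "w \<in> cspace n"
  shows "cjacobian n T (\<lambda>i. 0) w = T w"
proof
  fix j
  have "deriv (\<lambda>t. T ((\<lambda>i. 0)(i := t)) j) 0 = T (unit_vector i) j" if i: "i < n" for i
  proof (rule DERIV_imp_deriv)
    have "T ((\<lambda>i. 0)(i := t)) j = t * T (unit_vector i) j" for t
    proof -
      have "(\<lambda>i. 0)(i := t) = (\<lambda>k. t * unit_vector i k)" by (auto simp: unit_vector_def)
      then show ?thesis using T unit_vector_in_cspace [OF i] by (simp add: clinear_on_def)
    qed
    then show "((\<lambda>t. T ((\<lambda>i. 0)(i := t)) j) has_field_derivative T (unit_vector i) j) (at 0)"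
      by (auto intro!: derivative_eq_intros)
  qed
  then show "cjacobian n T (\<lambda>i. 0) w j = T w j"
    unfolding cjacobian_def clinear_on_expand [OF T w, of j] by (intro sum.cong) (auto simp: mult.commute)
qed

section \<open>The trivial bundle\<close>

definition trivial_vbundle :: "nat \<Rightarrow> 'x cmfd \<Rightarrow> ('x, 'x \<times> (nat \<Rightarrow> complex)) vbundle" where
  "trivial_vbundle r X =
     \<lparr>total = product_manifold X (cspace_manifold r), proj = fst, vzero = (\<lambda>x. (x, \<lambda>i. 0)),
      vadd = (\<lambda>e e'. (fst e, \<lambda>i. snd e i + snd e' i)), vscale = (\<lambda>a e. (fst e, \<lambda>i. a * snd e i))\<rparr>"

lemma trivial_vbundle_simps [simp]:
  "total (trivial_vbundle r X) = product_manifold X (cspace_manifold r)"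
  "proj (trivial_vbundle r X) = fst"
  "vzero (trivial_vbundle r X) x = (x, \<lambda>i. 0)"
  "vadd (trivial_vbundle r X) e e' = (fst e, \<lambda>i. snd e i + snd e' i)"
  "vscale (trivial_vbundle r X) a e = (fst e, \<lambda>i. a * snd e i)"
  by (simp_all add: trivial_vbundle_def)

lemma fibre_trivial_vbundle: "x \<in> points X \<Longrightarrow> fibre (trivial_vbundle r X) x = {x} \<times> cspace r"
  by (auto simp: fibre_def)

lemma fibre_iso_trivial_vbundle:
  assumes "x \<in> points X" shows "fibre_iso r (trivial_vbundle r X) x snd"
proof -
  have "bij_betw snd ({x} \<times> cspace r) (cspace r)" by (force simp: bij_betw_def inj_on_def)
  then show ?thesis
    unfolding fibre_iso_def fibre_trivial_vbundle [OF assms] by (auto simp: cspace_def)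
qed

lemma holomorphic_vbundle_trivial:
  assumes X: "complex_manifold X"
  shows "holomorphic_vbundle r X (trivial_vbundle r X)"
proof -
  let ?C = "cspace_manifold r"
  let ?E = "product_manifold X ?C"
  note C = complex_manifold_cspace [of r]
  note E = complex_manifold_product [OF X C]
  have id: "holomorphic_map ?E ?E (\<lambda>e. e)" using holomorphic_map_iff_hmap_at [OF E E] hmap_at_id [OF E] by blast
  \<comment> \<open>\<open>inv_into\<close> gives the identity on the points of the manifold only;
    for germs this is enough.\<close>
  have "holomorphic_map ?E ?E (inv_into (points ?E) (\<lambda>e. e))"
    unfolding holomorphic_map_iff_hmap_at [OF E E]
  proof
    fix p assume p: "p \<in> points ?E"
    have "eventually (\<lambda>q. q = inv_into (points ?E) (\<lambda>e. e) q) (nhdsin (mtop ?E) p)"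
      using eventually_nhdsin_topspace
    proof eventually_elim
      case (elim q)
      then show ?case using inv_into_f_f [of "\<lambda>e. e" "points ?E" q] by simp
    qed
    then show "hmap_at ?E ?E (inv_into (points ?E) (\<lambda>e. e)) p"
      by (rule hmap_at_cong [OF E E hmap_at_id [OF E p]])
  qed
  then have bi: "biholomorphic_map ?E ?E (\<lambda>e. e)"
    using id by (simp add: biholomorphic_map_def bij_betw_def)
  have pts: "{e \<in> points ?E. fst e \<in> points X} = points ?E" by auto
  show ?thesis
    unfolding holomorphic_vbundle_def
  proof (intro conjI ballI)
    show "complex_manifold (total (trivial_vbundle r X))" using E by simp
    show "holomorphic_map (total (trivial_vbundle r X)) X (proj (trivial_vbundle r X))"
      using hmap_at_fst [OF X C] by (simp add: holomorphic_map_iff_hmap_at [OF E X])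
    fix x assume x: "x \<in> points X"
    have bi': "biholomorphic_map
        (open_submanifold (total (trivial_vbundle r X)) {e \<in> points (total (trivial_vbundle r X)). proj (trivial_vbundle r X) e \<in> points X})
        (product_manifold (open_submanifold X (points X)) ?C) (\<lambda>e. e)"
      unfolding trivial_vbundle_simps pts open_submanifold_points [OF X] open_submanifold_points [OF E] by (rule bi)
    show "\<exists>U \<theta>. openin (mtop X) U \<and> x \<in> U \<and>
        biholomorphic_map
          (open_submanifold (total (trivial_vbundle r X)) {e \<in> points (total (trivial_vbundle r X)). proj (trivial_vbundle r X) e \<in> U})
          (product_manifold (open_submanifold X U) (cspace_manifold r)) \<theta> \<and>
        (\<forall>y\<in>U. (\<forall>e\<in>fibre (trivial_vbundle r X) y. fst (\<theta> e) = y) \<and> fibre_iso r (trivial_vbundle r X) y (\<lambda>e. snd (\<theta> e)))"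
    proof (rule exI [of _ "points X"], rule exI [of _ "\<lambda>e. e"], intro conjI ballI)
      show "openin (mtop X) (points X)" by simp
      show "fst e = y" if "e \<in> fibre (trivial_vbundle r X) y" for y e
        using that by (simp add: fibre_def)
    qed (use x bi' fibre_iso_trivial_vbundle in auto)
  qed
qed

text \<open>The inductions on holomorphy and equivariance run over the partial composites. Their
  argument is always the full fibre vector, of which the first \<open>k\<close> entries are read as
  times.\<close>

primrec multiflow :: "(nat \<Rightarrow> complex \<Rightarrow> 'x \<Rightarrow> 'x) \<Rightarrow> nat \<Rightarrow> 'x \<times> (nat \<Rightarrow> complex) \<Rightarrow> 'x" where
  "multiflow \<Phi> 0 e = fst e"
| "multiflow \<Phi> (Suc k) e = \<Phi> k (snd e k) (multiflow \<Phi> k e)"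

lemma hfun_at_snd_coordinate:
  assumes M: "complex_manifold M" and p: "p \<in> points (product_manifold M (cspace_manifold r))"
  shows "hfun_at (product_manifold M (cspace_manifold r)) (\<lambda>q. snd q k) p"
proof -
  have "(cspace r, id) \<in> charts_at (cspace_manifold r) (snd p)" using p by (auto simp: in_charts_at)
  then have "hfun_at (cspace_manifold r) (\<lambda>v. snd (cspace r, id) v k) (snd p)"
    by (rule hfun_at_chart_coordinate [OF complex_manifold_cspace])
  moreover have "fst p \<in> points M" using p by auto
  ultimately show ?thesis
    using hfun_at_snd [OF M complex_manifold_cspace [of r]] by fastforce
qed

section \<open>The composed flows as a dominating spray\<close>

context
  fixes X :: "'x cmfd" and r :: nat and \<xi> :: "nat \<Rightarrow> 'x vfield" and \<Phi> :: "nat \<Rightarrow> complex \<Rightarrow> 'x \<Rightarrow> 'x"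
  assumes X: "complex_manifold X"
    and \<xi>: "\<And>i. i < r \<Longrightarrow> \<xi> i \<in> holomorphic_vfields X"
    and \<Phi>0: "\<And>i x. i < r \<Longrightarrow> x \<in> points X \<Longrightarrow> \<Phi> i 0 x = x"
    and \<Phi>: "\<And>i x. i < r \<Longrightarrow> x \<in> points X \<Longrightarrow> integral_curve X (\<xi> i) (\<lambda>t. \<Phi> i t x)"
begin

lemma multiflow_points: "k \<le> r \<Longrightarrow> fst e \<in> points X \<Longrightarrow> multiflow \<Phi> k e \<in> points X"
  by (induction k) (auto intro: integral_curve_points [OF \<Phi>])

lemma multiflow_holomorphic:
  assumes k: "k \<le> r" and p: "p \<in> points (product_manifold X (cspace_manifold r))"
  shows "hmap_at (product_manifold X (cspace_manifold r)) X (multiflow \<Phi> k) p"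
  using k
proof (induction k)
  case 0
  have "multiflow \<Phi> 0 = fst" by auto
  then show ?case using hmap_at_fst [OF X complex_manifold_cspace p] by simp
next
  case (Suc k)
  let ?E = "product_manifold X (cspace_manifold r)"
  let ?e = "\<lambda>t (i::nat). if i = 0 then t else (0::complex)"
  note C1 = complex_manifold_cspace [of 1]
  note E = complex_manifold_product [OF X complex_manifold_cspace [of r]]
  have e: "?e t \<in> cspace 1" for t by (simp add: cspace_def)
  have hol: "cholomorphic_on (mdim X) (snd c ` fst c) (\<lambda>z. \<xi> k (chart_inv c z) c j)" if "c \<in> atlas X" for c j
    using \<xi> [of k] Suc.prems that unfolding holomorphic_vfields_def by auto
  have 1: "hmap_at ?E X (multiflow \<Phi> k) p" using Suc by simp
  have 2: "hmap_at ?E (cspace_manifold 1) (\<lambda>q. ?e (snd q k)) p"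
    using hfun_at_snd_coordinate [OF X p, of k] e
    by (subst hmap_at_cspace_manifold_iff [OF E p]) (auto intro: always_eventually)
  have F: "hmap_at (product_manifold X (cspace_manifold 1)) X (\<lambda>q. \<Phi> k (snd q 0) (fst q)) (multiflow \<Phi> k p, ?e (snd p k))"
    by (rule flow_holomorphic [OF X hol \<Phi>0 \<Phi>]) (use Suc.prems p e in \<open>auto intro: multiflow_points\<close>)
  show ?case
    using hmap_at_compose [where f = "\<lambda>q. (multiflow \<Phi> k q, ?e (snd q k))" and g = "\<lambda>q. \<Phi> k (snd q 0) (fst q)",
        OF E complex_manifold_product [OF X C1] X hmap_at_pair [OF X C1 E 1 2] F] by simp
qed

lemma multiflow_zero: "k \<le> r \<Longrightarrow> x \<in> points X \<Longrightarrow> multiflow \<Phi> k (x, \<lambda>i. 0) = x"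
  by (induction k) (auto simp: \<Phi>0)

text \<open>Along a coordinate axis of the fibre all flows but one are taken at time 0 and do
  nothing. This isolates the partial derivatives of the spray at the zero section.\<close>

lemma multiflow_single:
  "k \<le> r \<Longrightarrow> x \<in> points X \<Longrightarrow> multiflow \<Phi> k (x, (\<lambda>i. 0)(i := t)) = (if i < k then \<Phi> i t x else x)"
proof (induction k)
  case (Suc k)
  have "\<Phi> i t x \<in> points X" if "i < r" using integral_curve_points [OF \<Phi> [OF that Suc.prems(2)]] .
  then show ?case using Suc by (auto simp: \<Phi>0 less_Suc_eq)
qed simp

text \<open>Holomorphy makes the derivative at 0 linear in the direction, so it is determined by the
  partial derivatives, and along each axis the spray is a single integral curve.\<close>

lemma multiflow_derivative:
  assumes x: "x \<in> points X" and u: "u \<in> cspace r" and d: "d \<in> charts_at X x"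
  shows "((\<lambda>\<tau>. snd d (multiflow \<Phi> r (x, \<lambda>i. \<tau> * u i)) j) has_field_derivative (\<Sum>i<r. \<xi> i x d j * u i)) (at 0)"
proof -
  let ?C = "cspace_manifold r"
  let ?E = "product_manifold X ?C"
  note C = complex_manifold_cspace [of r]
  note E = complex_manifold_product [OF X C]
  define H where "H v = snd d (multiflow \<Phi> r (x, v)) j" for v
  have z: "(\<lambda>i. 0) \<in> points ?C" by (simp add: zero_in_cspace)
  obtain c where c: "c \<in> charts_at X x" using d by blast
  have "hmap_at ?C X (\<lambda>v. x) (\<lambda>i. 0)"
    by (rule hmap_atI [OF C X z, where d = c]) (use c in \<open>auto simp: in_charts_at intro: hfun_at_const [OF C z] always_eventually\<close>)
  then have pair: "hmap_at ?C ?E (\<lambda>v. (x, v)) (\<lambda>i. 0)"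
    by (intro hmap_at_pair [OF X C C] hmap_at_id [OF C z])
  have "hmap_at ?E X (multiflow \<Phi> r) (x, \<lambda>i. 0)"
    using x by (intro multiflow_holomorphic) (auto simp: zero_in_cspace)
  then have "hmap_at ?C X (\<lambda>v. multiflow \<Phi> r (x, v)) (\<lambda>i. 0)"
    by (rule hmap_at_compose [where f = "\<lambda>v. (x, v)" and g = "multiflow \<Phi> r", OF C E X pair])
  then have "hfun_at ?C H (\<lambda>i. 0)"
    unfolding H_def [abs_def] by (rule hmap_at_chart [OF C X]) (use d multiflow_zero [OF order_refl x] in simp)
  moreover have ch: "(cspace r, id) \<in> charts_at ?C (\<lambda>i. 0)" using z by (simp add: in_charts_at)
  ultimately have "chol_at r (\<lambda>z. H (chart_inv (cspace r, id) z)) (\<lambda>i. 0)"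
    using hfun_at_chart [OF C _ ch, of H] by simp
  then have "chol_at r H (\<lambda>i. 0)"
    by (rule chol_at_transform) (auto simp: eventually_inf_principal chart_inv_def inv_into_f_f)
  then have cd: "cdiff_at r H (\<lambda>i. 0)" by (rule chol_at_imp_cdiff_at)
  have "((\<lambda>\<tau>. H (\<lambda>i. \<tau> * u i)) has_field_derivative (\<Sum>i<r. pd i H (\<lambda>i. 0 * u i) * u i)) (at 0)"
    by (rule cdiff_at_curve [where \<gamma> = "\<lambda>\<tau> i. \<tau> * u i" and S = UNIV])
      (use cd u in \<open>auto simp: cspace_def intro!: derivative_eq_intros\<close>)
  moreover have "pd i H (\<lambda>i. 0 * u i) = \<xi> i x d j" if i: "i < r" for i
  proof -
    have curve: "integral_curve X (\<xi> i) (\<lambda>t. \<Phi> i t x)" by (rule \<Phi> [OF i x])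
    have d0: "d \<in> atlas X" "\<Phi> i 0 x \<in> fst d" "x \<in> fst d" using d \<Phi>0 [OF i x] by (auto simp: in_charts_at)
    have "((\<lambda>t. snd d (\<Phi> i t x) j) has_field_derivative \<xi> i x d j) (at 0)"
    proof (cases "j < mdim X")
      case True
      then show ?thesis
        using integral_curve_chart_derivative [OF X curve d0(1,2) True] chart_inv_chart [OF X d0(1,3)] by (simp add: \<Phi>0 i x)
    next
      case False
      \<comment> \<open>\<open>integral_curve\<close> constrains the coordinates below
        \<open>mdim X\<close> only. From there on the chart coordinates and the components of the
        field are 0.\<close>
      have "\<xi> i x \<in> tangent_space X x" using \<xi> [OF i] x unfolding holomorphic_vfields_def by auto
      then have "\<xi> i x d \<in> cspace (mdim X)" using d unfolding tangent_space_def by blast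
      then have "\<xi> i x d j = 0" using False by (simp add: cspace_def)
      moreover have "((\<lambda>t. snd d (\<Phi> i t x) j) has_field_derivative 0) (at 0)"
      proof (rule has_field_derivative_transform_within_open)
        show "((\<lambda>t. 0) has_field_derivative 0) (at (0::complex))" by simp
        show "open {t. \<Phi> i t x \<in> fst d}" by (rule integral_curve_open_vimage [OF curve chart_open [OF X d0(1)]])
        show "0 \<in> {t. \<Phi> i t x \<in> fst d}" using d0(2) by simp
        show "0 = snd d (\<Phi> i t x) j" if "t \<in> {t. \<Phi> i t x \<in> fst d}" for t
          using that chart_in_cspace [OF X d0(1), of "\<Phi> i t x"] False by (simp add: cspace_def)
      qed
      ultimately show ?thesis by simp
    qed
    then show ?thesis
      unfolding pd_def H_def using multiflow_single [OF order_refl x, of i] i by (simp add: DERIV_imp_deriv)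
  qed
  ultimately show ?thesis by (simp add: H_def)
qed

text \<open>A fibre is a vector space whose charts are all its linear isomorphisms to
  \<open>cspace r\<close>, and a tangent vector is a family indexed by all of them. Identifying a
  tangent vector at zero with a fibre vector \<open>u\<close>, the differential becomes the map from
  \<open>u\<close> to the sum of the \<open>u i * \<xi> i x\<close>, whose image is the tangent
  space by \<open>span\<close>.\<close>

lemma multiflow_dominating:
  assumes span: "\<And>x. x \<in> points X \<Longrightarrow>
      tangent_space X x = {(\<lambda>c j. \<Sum>i<r. u i * \<xi> i x c j) |u. u \<in> cspace r}"
  shows "dominating r X (trivial_vbundle r X) (multiflow \<Phi> r)"
  unfolding dominating_def submersion_at_def
proof
  fix x assume x: "x \<in> points X"
  let ?E = "trivial_vbundle r X"
  let ?M = "fibre_manifold r ?E x"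
  define p where "p = vzero ?E x"
  have fib: "fibre ?E x = {x} \<times> cspace r" by (rule fibre_trivial_vbundle [OF x])
  have charts: "charts_at ?M p = {(fibre ?E x, L) |L. fibre_iso r ?E x L}"
    unfolding charts_at_def p_def by (auto simp: fibre_manifold_def fib zero_in_cspace)
  have sp: "multiflow \<Phi> r p = x" using multiflow_zero [OF order_refl x] by (simp add: p_def)
  have md: "mdim ?M = r" by (simp add: fibre_manifold_def)
  \<comment> \<open>For an arbitrary chart of the fibre, \<open>B\<close> is the linear map from its
    coordinates back to the standard fibre coordinates.\<close>
  have chart: "\<exists>B. (\<forall>z\<in>cspace r. chart_inv c z = (x, B z) \<and> B z \<in> cspace r \<and> snd c (x, B z) = z) \<and> clinear_on r B \<and>
      (\<forall>u\<in>cspace r. snd c (x, u) \<in> cspace r \<and> B (snd c (x, u)) = u) \<and> snd c p = (\<lambda>i. 0) \<and>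
      clinear_on r (\<lambda>u. snd c (x, u))" if c: "c \<in> charts_at ?M p" for c
  proof -
    obtain L where cL: "c = ({x} \<times> cspace r, L)" and L: "fibre_iso r ?E x L"
      using c unfolding charts fib by blast
    have bij: "bij_betw L ({x} \<times> cspace r) (cspace r)" and L0: "L p = (\<lambda>i. 0)"
      and add: "\<And>u v. u \<in> cspace r \<Longrightarrow> v \<in> cspace r \<Longrightarrow> L (x, \<lambda>i. u i + v i) = (\<lambda>i. L (x, u) i + L (x, v) i)"
      and scale: "\<And>a u. u \<in> cspace r \<Longrightarrow> L (x, \<lambda>i. a * u i) = (\<lambda>i. a * L (x, u) i)"
      using L unfolding fibre_iso_def fib by (auto simp: p_def)
    define B where "B z = snd (chart_inv c z)" for z
    have inv: "chart_inv c z = (x, B z)" "B z \<in> cspace r" "L (x, B z) = z" if z: "z \<in> cspace r" for z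
    proof -
      have "chart_inv c z \<in> {x} \<times> cspace r" "L (chart_inv c z) = z"
        using bij_betw_inv_into_right [OF bij z] inv_into_into [of z L "{x} \<times> cspace r"] z bij
        by (auto simp: chart_inv_def cL bij_betw_def)
      then show "chart_inv c z = (x, B z)" "B z \<in> cspace r" "L (x, B z) = z"
        by (auto simp: B_def)
    qed
    have Lc: "L (x, u) \<in> cspace r" if "u \<in> cspace r" for u
      using bij_betwE [OF bij] that by blast
    have BL: "B (L (x, u)) = u" if "u \<in> cspace r" for u
      using bij_betw_inv_into_left [OF bij, of "(x, u)"] that by (simp add: B_def chart_inv_def cL)
    have "clinear_on r B"
      unfolding clinear_on_def
    proof (intro conjI ballI allI)
      fix v w assume v: "v \<in> cspace r" and w: "w \<in> cspace r"
      have "(\<lambda>i. B v i + B w i) \<in> cspace r" using inv(2) [OF v] inv(2) [OF w] by (simp add: cspace_def)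
      then show "B (\<lambda>i. v i + w i) = (\<lambda>i. B v i + B w i)"
        using BL [of "\<lambda>i. B v i + B w i"] add [OF inv(2) [OF v] inv(2) [OF w]] inv(3) v w by simp
    next
      fix a v assume v: "v \<in> cspace r"
      have "(\<lambda>i. a * B v i) \<in> cspace r" using inv(2) [OF v] by (simp add: cspace_def)
      then show "B (\<lambda>i. a * v i) = (\<lambda>i. a * B v i)"
        using BL [of "\<lambda>i. a * B v i"] scale [OF inv(2) [OF v], of a] inv(3) v by simp
    qed
    moreover have "clinear_on r (\<lambda>u. L (x, u))" using add scale by (simp add: clinear_on_def)
    ultimately show ?thesis using inv Lc BL L0 by (intro exI [of _ B]) (simp add: cL)
  qed
  \<comment> \<open>The chart that \<open>differential\<close> uses, named so that its definition
    unfolds to it.\<close>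
  define c where "c = (SOME c. c \<in> charts_at ?M p)"
  have c: "c \<in> charts_at ?M p"
    unfolding c_def charts by (rule someI_ex) (use fibre_iso_trivial_vbundle [OF x] in blast)
  obtain B where B: "\<And>z. z \<in> cspace r \<Longrightarrow> chart_inv c z = (x, B z)" "\<And>z. z \<in> cspace r \<Longrightarrow> B z \<in> cspace r"
      "clinear_on r B" "\<And>u. u \<in> cspace r \<Longrightarrow> snd c (x, u) \<in> cspace r" "\<And>u. u \<in> cspace r \<Longrightarrow> B (snd c (x, u)) = u"
      "snd c p = (\<lambda>i. 0)"
    using chart [OF c] by blast
  have diff: "differential ?M X (multiflow \<Phi> r) p v = (\<lambda>d j. \<Sum>i<r. B (v c) i * \<xi> i x d j)"
    if v: "v c \<in> cspace r" for v
  proof (intro ext)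
    fix d j
    show "differential ?M X (multiflow \<Phi> r) p v d j = (\<Sum>i<r. B (v c) i * \<xi> i x d j)"
    proof (cases "d \<in> charts_at X x")
      case True
      have "deriv (\<lambda>t. snd d (multiflow \<Phi> r (chart_inv c ((\<lambda>i. 0)(k := t)))) j) 0
          = (\<Sum>i<r. \<xi> i x d j * B (unit_vector k) i)" if k: "k < r" for k
      proof (rule DERIV_imp_deriv)
        have "chart_inv c ((\<lambda>i. 0)(k := t)) = (x, \<lambda>i. t * B (unit_vector k) i)" for t
        proof -
          have "(\<lambda>i. 0)(k := t) = (\<lambda>i. t * unit_vector k i)" by (auto simp: unit_vector_def)
          moreover have "(\<lambda>i. t * unit_vector k i) \<in> cspace r" using unit_vector_in_cspace [OF k] by (simp add: cspace_def)
          ultimately show ?thesis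
            using B(1) B(3) unit_vector_in_cspace [OF k] by (simp add: clinear_on_def)
        qed
        then show "((\<lambda>t. snd d (multiflow \<Phi> r (chart_inv c ((\<lambda>i. 0)(k := t)))) j) has_field_derivative
            (\<Sum>i<r. \<xi> i x d j * B (unit_vector k) i)) (at 0)"
          using multiflow_derivative [OF x B(2) [OF unit_vector_in_cspace [OF k]] True, of j] by simp
      qed
      then have "differential ?M X (multiflow \<Phi> r) p v d j
          = (\<Sum>k<r. (\<Sum>i<r. \<xi> i x d j * B (unit_vector k) i) * v c k)"
        using True by (simp add: differential_def Let_def sp cjacobian_def md B(6) flip: c_def)
      also have "\<dots> = (\<Sum>i<r. \<Sum>k<r. \<xi> i x d j * B (unit_vector k) i * v c k)"
        by (simp add: sum_distrib_right) (rule sum.swap)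
      also have "\<dots> = (\<Sum>i<r. B (v c) i * \<xi> i x d j)"
        by (intro sum.cong) (auto simp: clinear_on_expand [OF B(3) v] sum_distrib_right sum_distrib_left mult_ac)
      finally show ?thesis .
    next
      case False
      \<comment> \<open>Away from the charts around \<open>x\<close> both sides have the dummy value
        0.\<close>
      have "\<xi> i x d = (\<lambda>j. 0)" if "i < r" for i
      proof -
        have "\<xi> i x \<in> tangent_space X x" using \<xi> [OF that] x unfolding holomorphic_vfields_def by auto
        then show ?thesis using False unfolding tangent_space_def by blast
      qed
      then show ?thesis using False by (simp add: differential_def Let_def sp)
    qed
  qed
  have onto: "\<exists>v\<in>tangent_space ?M p. B (v c) = u" if u: "u \<in> cspace r" for u
  proof
    \<comment> \<open>The tangent vector at zero that corresponds to the fibre vector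
      \<open>u\<close>: its component in a linear chart is the image of \<open>u\<close> under that
      chart.\<close>
    define v where "v d = (if d \<in> charts_at ?M p then snd d (x, u) else (\<lambda>i. 0))" for d
    show "B (v c) = u" using B(5) [OF u] c by (simp add: v_def)
    have v_in: "v d \<in> cspace r" if d: "d \<in> charts_at ?M p" for d
      using chart [OF d] u d by (auto simp: v_def)
    have v_comp: "v d' = cjacobian r (\<lambda>z. snd d' (chart_inv d z)) (snd d p) (v d)"
      if d: "d \<in> charts_at ?M p" and d': "d' \<in> charts_at ?M p" for d d'
    proof -
      obtain D where D: "\<And>z. z \<in> cspace r \<Longrightarrow> chart_inv d z = (x, D z)" "\<And>z. z \<in> cspace r \<Longrightarrow> D z \<in> cspace r"
        "clinear_on r D" "\<And>u. u \<in> cspace r \<Longrightarrow> snd d (x, u) \<in> cspace r" "\<And>u. u \<in> cspace r \<Longrightarrow> D (snd d (x, u)) = u"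
        "snd d p = (\<lambda>i. 0)"
        using chart [OF d] by blast
      have "clinear_on r (\<lambda>u. snd d' (x, u))" using chart [OF d'] by blast
      then have "clinear_on r (\<lambda>z. snd d' (x, D z))" using D(2,3) unfolding clinear_on_def by simp
      moreover have "(\<lambda>i. v i + w i) \<in> cspace r" "(\<lambda>i. a * v i) \<in> cspace r" if "v \<in> cspace r" "w \<in> cspace r" for a and v w :: "nat \<Rightarrow> complex"
        using that by (auto simp: cspace_def)
      ultimately have "clinear_on r (\<lambda>z. snd d' (chart_inv d z))"
        using D(1) unfolding clinear_on_def by simp
      \<comment> \<open>The transition map is linear, hence its own derivative at 0, and it carries
        the component of \<open>v\<close> in \<open>d\<close> to the one in
        \<open>d'\<close>.\<close>
      then have "cjacobian r (\<lambda>z. snd d' (chart_inv d z)) (\<lambda>i. 0) (v d) = snd d' (chart_inv d (v d))"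
        using D(4) [OF u] d by (intro cjacobian_clinear_on) (auto simp: v_def)
      also have "\<dots> = v d'" using D(1,5) D(4) [OF u] u d d' by (simp add: v_def)
      finally show ?thesis by (simp add: D(6))
    qed
    show "v \<in> tangent_space ?M p"
      unfolding tangent_space_def md
    proof (intro CollectI conjI allI impI ballI)
      show "v d = (\<lambda>i. 0)" if "d \<notin> charts_at ?M p" for d using that by (simp add: v_def)
    qed (rule v_in, assumption, rule v_comp)
  qed
  have "differential ?M X (multiflow \<Phi> r) p ` tangent_space ?M p = {(\<lambda>c j. \<Sum>i<r. u i * \<xi> i x c j) |u. u \<in> cspace r}"
  proof (intro equalityI subsetI)
    fix w assume "w \<in> differential ?M X (multiflow \<Phi> r) p ` tangent_space ?M p"
    then obtain v where v: "v \<in> tangent_space ?M p" "w = differential ?M X (multiflow \<Phi> r) p v" by blast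
    have "v c \<in> cspace r" using v(1) c unfolding tangent_space_def md by blast
    then show "w \<in> {(\<lambda>c j. \<Sum>i<r. u i * \<xi> i x c j) |u. u \<in> cspace r}"
      using diff [of v] B(2) v(2) by blast
  next
    fix w assume "w \<in> {(\<lambda>c j. \<Sum>i<r. u i * \<xi> i x c j) |u. u \<in> cspace r}"
    then obtain u where u: "u \<in> cspace r" "w = (\<lambda>c j. \<Sum>i<r. u i * \<xi> i x c j)" by blast
    obtain v where v: "v \<in> tangent_space ?M p" "B (v c) = u" using onto [OF u(1)] by blast
    have "v c \<in> cspace r" using v(1) c unfolding tangent_space_def md by blast
    then have "w = differential ?M X (multiflow \<Phi> r) p v" using diff [of v] v(2) u(2) by simp
    then show "w \<in> differential ?M X (multiflow \<Phi> r) p ` tangent_space ?M p" using v(1) by blast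
  qed
  then show "differential ?M X (multiflow \<Phi> r) (vzero ?E x) ` tangent_space ?M (vzero ?E x)
      = tangent_space X (multiflow \<Phi> r (vzero ?E x))"
    unfolding p_def [symmetric] sp using span [OF x] by simp
qed

end

section \<open>The lifted action and the theorem\<close>

definition vbundle_action ::
    "nat \<Rightarrow> 'x cmfd \<Rightarrow> ('g \<Rightarrow> 'x \<Rightarrow> 'x) \<Rightarrow> (nat \<Rightarrow> 'g \<Rightarrow> complex) \<Rightarrow> 'g \<Rightarrow> 'x \<times> (nat \<Rightarrow> complex) \<Rightarrow> 'x \<times> (nat \<Rightarrow> complex)" where
  "vbundle_action r X \<alpha> \<kappa> g =
     (\<lambda>e\<in>points (product_manifold X (cspace_manifold r)). (\<alpha> g (fst e), \<lambda>i. \<kappa> i g * snd e i))"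

lemma character_mult:
  assumes "\<kappa> \<in> characters G" "g \<in> carrier G" "h \<in> carrier G"
  shows "\<kappa> (g \<otimes>\<^bsub>G\<^esub> h) = \<kappa> g * \<kappa> h"
  using assms by (auto simp: characters_def hom_def Cstar_def)

lemma character_one:
  assumes "group G" "\<kappa> \<in> characters G"
  shows "\<kappa> \<one>\<^bsub>G\<^esub> = 1"
proof -
  interpret group G by (rule assms)
  have "\<kappa> \<one>\<^bsub>G\<^esub> \<noteq> 0" using assms(2) by (auto simp: characters_def hom_def Cstar_def Pi_iff)
  moreover have "\<kappa> \<one>\<^bsub>G\<^esub> * \<kappa> \<one>\<^bsub>G\<^esub> = \<kappa> \<one>\<^bsub>G\<^esub>"
    using character_mult [OF assms(2), of "\<one>\<^bsub>G\<^esub>" "\<one>\<^bsub>G\<^esub>"] by simp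
  ultimately show ?thesis by simp
qed

lemma holomorphic_vbundle_action:
  assumes G: "complex_lie_group G" and X: "complex_manifold X" and act: "holomorphic_action G X \<alpha>"
    and \<kappa>: "\<And>i. i < r \<Longrightarrow> \<kappa> i \<in> characters G"
  shows "holomorphic_action G (product_manifold X (cspace_manifold r)) (vbundle_action r X \<alpha> \<kappa>)"
proof -
  let ?C = "cspace_manifold r"
  let ?E = "product_manifold X ?C"
  let ?GE = "product_manifold (gmfd G) ?E"
  have grp: "group G" and Gm: "complex_manifold (gmfd G)" and Gp: "points (gmfd G) = carrier G"
    using G by (auto simp: complex_lie_group_def)
  note C = complex_manifold_cspace [of r]
  note E = complex_manifold_product [OF X C]
  note GE = complex_manifold_product [OF Gm E]
  note GX = complex_manifold_product [OF Gm X]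
  interpret G: group G by (rule grp)
  have ga: "group_action G (points X) \<alpha>" using act by (simp add: holomorphic_action_def)
  have scale: "(\<lambda>i. k i * v i) \<in> cspace r" if "v \<in> cspace r" for k v :: "nat \<Rightarrow> complex"
    using that by (simp add: cspace_def)
  have val: "vbundle_action r X \<alpha> \<kappa> g e = (\<alpha> g (fst e), \<lambda>i. \<kappa> i g * snd e i)" if "e \<in> points ?E" for g e
    using that by (simp add: vbundle_action_def)
  have mem: "vbundle_action r X \<alpha> \<kappa> g e \<in> points ?E" if "g \<in> carrier G" "e \<in> points ?E" for g e
    using that group_actionD(1) [OF ga] scale by (auto simp: val)
  have "group_action G (points ?E) (vbundle_action r X \<alpha> \<kappa>)"
  proof (rule group_actionI [OF grp mem])
    fix e assume e: "e \<in> points ?E"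
    \<comment> \<open>Only for \<open>i < r\<close> is \<open>\<kappa> i\<close> known to be a
      character; beyond that the coordinate of \<open>e\<close> is 0.\<close>
    have "\<kappa> i \<one>\<^bsub>G\<^esub> * snd e i = snd e i" for i
      using e \<kappa> character_one [OF grp] by (cases "i < r") (auto simp: cspace_def)
    then show "vbundle_action r X \<alpha> \<kappa> \<one>\<^bsub>G\<^esub> e = e"
      using e group_actionD(2) [OF ga] unfolding val [OF e] by auto
    fix g h assume g: "g \<in> carrier G" and h: "h \<in> carrier G"
    have "\<kappa> i (g \<otimes>\<^bsub>G\<^esub> h) * snd e i = \<kappa> i g * (\<kappa> i h * snd e i)" for i
      using e \<kappa> character_mult [OF _ g h] by (cases "i < r") (auto simp: cspace_def)
    then have "(\<lambda>i. \<kappa> i (g \<otimes>\<^bsub>G\<^esub> h) * snd e i) = (\<lambda>i. \<kappa> i g * (\<kappa> i h * snd e i))" by (rule ext)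
    moreover have "(\<alpha> h (fst e), \<lambda>i. \<kappa> i h * snd e i) \<in> points ?E" using mem [OF h e] val [OF e] by simp
    ultimately show "vbundle_action r X \<alpha> \<kappa> (g \<otimes>\<^bsub>G\<^esub> h) e = vbundle_action r X \<alpha> \<kappa> g (vbundle_action r X \<alpha> \<kappa> h e)"
      using e group_actionD(3) [OF ga g h, of "fst e"] unfolding val [OF e] by (simp add: val mem_Times_iff)
  \<comment> \<open>The restriction in \<open>vbundle_action\<close> serves the extensionality that
    \<open>group_action\<close> demands.\<close>
  qed (assumption, assumption, unfold vbundle_action_def, rule restrict_extensional)
  moreover have "hmap_at ?GE ?E (\<lambda>(g, e). vbundle_action r X \<alpha> \<kappa> g e) p" if p: "p \<in> points ?GE" for p
  proof -
    have p1: "fst p \<in> points (gmfd G)" "fst (snd p) \<in> points X" and p2: "snd p \<in> points ?E" using p by auto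
    have fst_p: "hmap_at ?GE (gmfd G) fst p" by (rule hmap_at_fst [OF Gm E p])
    have snd_p: "hmap_at ?GE ?E snd p" by (rule hmap_at_snd [OF Gm E p])
    have "hmap_at ?GE X (\<lambda>q. fst (snd q)) p"
      by (rule hmap_at_compose [where f = snd and g = fst, OF GE E X snd_p hmap_at_fst [OF X C p2]])
    then have pair: "hmap_at ?GE (product_manifold (gmfd G) X) (\<lambda>q. (fst q, fst (snd q))) p"
      by (rule hmap_at_pair [OF Gm X GE fst_p])
    have "hmap_at (product_manifold (gmfd G) X) X (\<lambda>(g, x). \<alpha> g x) (fst p, fst (snd p))"
      using act p1 unfolding holomorphic_action_def holomorphic_map_iff_hmap_at [OF GX X] by simp
    then have 1: "hmap_at ?GE X (\<lambda>q. \<alpha> (fst q) (fst (snd q))) p"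
      using hmap_at_compose [where f = "\<lambda>q. (fst q, fst (snd q))" and g = "\<lambda>(g, x). \<alpha> g x", OF GE GX X pair] by simp
    have "hfun_at ?GE (\<lambda>q. \<kappa> i (fst q) * snd (snd q) i) p" if i: "i < r" for i
    proof (rule hfun_at_mult [OF GE])
      have "hfun_at (gmfd G) (\<kappa> i) (fst p)"
        using \<kappa> [OF i] p1 holomorphic_function_iff_hfun_at [OF Gm] by (simp add: characters_def)
      then show "hfun_at ?GE (\<lambda>q. \<kappa> i (fst q)) p" by (rule hfun_at_fst [OF Gm E _ p2])
      show "hfun_at ?GE (\<lambda>q. snd (snd q) i) p"
        by (rule hfun_at_snd [OF Gm E hfun_at_snd_coordinate [OF X p2] p1(1)])
    qed
    moreover have "eventually (\<lambda>q. (\<lambda>i. \<kappa> i (fst q) * snd (snd q) i) \<in> cspace r) (nhdsin (mtop ?GE) p)"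
      using eventually_nhdsin_topspace by eventually_elim (auto intro: scale)
    ultimately have 2: "hmap_at ?GE ?C (\<lambda>q i. \<kappa> i (fst q) * snd (snd q) i) p"
      by (simp add: hmap_at_cspace_manifold_iff [OF GE p])
    have "eventually (\<lambda>q. (\<alpha> (fst q) (fst (snd q)), \<lambda>i. \<kappa> i (fst q) * snd (snd q) i)
        = (\<lambda>(g, e). vbundle_action r X \<alpha> \<kappa> g e) q) (nhdsin (mtop ?GE) p)"
      using eventually_nhdsin_topspace
    proof eventually_elim
      case (elim q)
      then have "snd q \<in> points ?E" by auto
      then show ?case using val [of "snd q" "fst q"] by (simp add: split_beta)
    qed
    then show ?thesis by (rule hmap_at_cong [OF GE E hmap_at_pair [OF X C GE 1 2]])
  qed
  ultimately show ?thesis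
    unfolding holomorphic_action_def holomorphic_map_iff_hmap_at [OF GE E] by blast
qed

theorem theorem3p3:
  fixes G :: "'g clie_group" and X :: "'x cmfd" and \<alpha> :: "'g \<Rightarrow> 'x \<Rightarrow> 'x"
    and n :: nat and chi :: "nat \<Rightarrow> 'g \<Rightarrow> complex" and F :: "'x vfield set"
  assumes "complex_lie_group G" and "comm_group G" and "reductive G"
    and "complex_G_manifold G X \<alpha>"
    and "\<forall>j\<in>{1..n}. chi j \<in> characters G"
    and "finite F" and "F \<subseteq> (\<Union>j\<in>{1..n}. vfields_char G X \<alpha> (chi j))"
    and "\<forall>\<xi>\<in>F. complete_vfield X \<xi>"
    and "\<forall>x\<in>points X. spans_tangent_space X F x"
  shows "G_elliptic G X \<alpha>"
proof -
  note G = assms(1)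
  have X: "complex_manifold X" and act: "holomorphic_action G X \<alpha>"
    using assms(4) by (auto simp: complex_G_manifold_def)
  have ga: "group_action G (points X) \<alpha>" using act by (simp add: holomorphic_action_def)
  define r where "r = card F"
  \<comment> \<open>An enumeration without repetition, so that sums over \<open>F\<close> become
    sums over \<open>{..<r}\<close> and \<open>r\<close> is the rank of the bundle.\<close>
  obtain \<xi> where bij: "bij_betw \<xi> {..<r} F"
    using ex_bij_betw_nat_finite [OF assms(6)] unfolding r_def atLeast0LessThan by blast
  have \<xi>F: "\<xi> i \<in> F" if "i < r" for i using bij_betwE [OF bij] that by blast
  have "\<forall>i\<in>{..<r}. \<exists>j\<in>{1..n}. \<xi> i \<in> vfields_char G X \<alpha> (chi j)"
    using \<xi>F assms(7) by blast
  then obtain ix where ix: "\<And>i. i < r \<Longrightarrow> ix i \<in> {1..n}" "\<And>i. i < r \<Longrightarrow> \<xi> i \<in> vfields_char G X \<alpha> (chi (ix i))"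
    by (metis lessThan_iff)
  \<comment> \<open>Characters are reindexed by the fields, because several fields may share one and
    each gets its own fibre coordinate.\<close>
  define \<kappa> where "\<kappa> i = chi (ix i)" for i
  have \<kappa>: "\<kappa> i \<in> characters G" if "i < r" for i using ix(1) [OF that] assms(5) by (simp add: \<kappa>_def)
  have \<xi>\<kappa>: "\<xi> i \<in> vfields_char G X \<alpha> (\<kappa> i)" if "i < r" for i using ix(2) [OF that] by (simp add: \<kappa>_def)
  then have \<xi>: "\<xi> i \<in> holomorphic_vfields X" if "i < r" for i
    using that by (auto simp: vfields_char_def)
  have "\<forall>i\<in>{..<r}. \<exists>\<Phi>. \<forall>x\<in>points X. \<Phi> 0 x = x \<and> integral_curve X (\<xi> i) (\<lambda>t. \<Phi> t x)"
    using \<xi>F assms(8) by (auto simp: complete_vfield_def)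
  then obtain \<Phi> where \<Phi>: "\<forall>i\<in>{..<r}. \<forall>x\<in>points X. \<Phi> i 0 x = x \<and> integral_curve X (\<xi> i) (\<lambda>t. \<Phi> i t x)"
    by (subst (asm) bchoice_iff) blast
  then have \<Phi>0: "\<Phi> i 0 x = x" and curve: "integral_curve X (\<xi> i) (\<lambda>t. \<Phi> i t x)" if "i < r" "x \<in> points X" for i x
    using that by auto
  let ?E = "trivial_vbundle r X"
  let ?s = "multiflow \<Phi> r"
  let ?\<beta> = "vbundle_action r X \<alpha> \<kappa>"
  have E: "complex_manifold (total ?E)"
    using complex_manifold_product [OF X complex_manifold_cspace] by simp
  have spray: "spray r X ?E ?s"
    unfolding spray_def holomorphic_map_iff_hmap_at [OF E X]
    using holomorphic_vbundle_trivial [OF X] multiflow_holomorphic [OF X \<xi> \<Phi>0 curve order_refl]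
      multiflow_zero [OF X \<xi> \<Phi>0 curve order_refl] by auto
  \<comment> \<open>Proved for every partial composite: passing \<open>g\<close> through the flow
    with index \<open>k\<close> multiplies its time by \<open>\<kappa> k g\<close>, which is the
    k-th entry of the transformed fibre vector.\<close>
  have equivariant: "multiflow \<Phi> k (?\<beta> g e) = \<alpha> g (multiflow \<Phi> k e)"
    if "k \<le> r" and g: "g \<in> carrier G" and e: "e \<in> points (total ?E)" for k g e
    using that(1)
  proof (induction k)
    case 0
    then show ?case using e by (simp add: vbundle_action_def mem_Times_iff)
  next
    case (Suc k)
    have "multiflow \<Phi> k e \<in> points X"
      using Suc.prems e by (intro multiflow_points [OF X \<xi> \<Phi>0 curve]) auto
    then have "\<alpha> g (\<Phi> k (snd e k) (multiflow \<Phi> k e)) = \<Phi> k (\<kappa> k g * snd e k) (\<alpha> g (multiflow \<Phi> k e))"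
      using Suc.prems by (intro flow_equivariant [OF G X act \<xi>\<kappa> \<Phi>0 curve g]) auto
    then show ?case using Suc e by (simp add: vbundle_action_def mem_Times_iff)
  qed
  have "G_spray r G X \<alpha> ?E ?s"
    unfolding G_spray_def
  proof (intro conjI exI [of _ ?\<beta>] ballI allI)
    show "holomorphic_action G (total ?E) ?\<beta>"
      using holomorphic_vbundle_action [OF G X act \<kappa>] by simp
    show "proj ?E (?\<beta> g e) = \<alpha> g (proj ?E e)" if "e \<in> points (total ?E)" for g e
      using that by (simp add: vbundle_action_def)
    show "?s (?\<beta> g e) = \<alpha> g (?s e)" if "g \<in> carrier G" "e \<in> points (total ?E)" for g e
      by (rule equivariant [OF order_refl that])
    show "?\<beta> g (vadd ?E e e') = vadd ?E (?\<beta> g e) (?\<beta> g e')"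
      if "x \<in> points X" "e \<in> fibre ?E x" "e' \<in> fibre ?E x" for g x e e'
      using that by (auto simp: fibre_def vbundle_action_def cspace_def distrib_left)
    show "?\<beta> g (vscale ?E a e) = vscale ?E a (?\<beta> g e)"
      if "x \<in> points X" "e \<in> fibre ?E x" for g x e a
      using that by (auto simp: fibre_def vbundle_action_def cspace_def mult.left_commute)
  qed (rule spray)
  moreover have "dominating r X ?E ?s"
  proof (rule multiflow_dominating [OF X \<xi> \<Phi>0 curve])
    fix x assume x: "x \<in> points X"
    have reindex: "(\<Sum>\<eta>\<in>F. a \<eta> * \<eta> x c j) = (\<Sum>i<r. a (\<xi> i) * \<xi> i x c j)" for a c j
      using sum.reindex_bij_betw [OF bij, of "\<lambda>\<eta>. a \<eta> * \<eta> x c j"] by simp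
    have "tangent_space X x = {(\<lambda>c j. \<Sum>i<r. a (\<xi> i) * \<xi> i x c j) |a. True}"
      using assms(9) x by (simp add: spans_tangent_space_def reindex)
    \<comment> \<open>Coefficients in \<open>spans_tangent_space\<close> are functions on fields,
      here they are vectors. One direction truncates at \<open>r\<close>, the other composes with
      the inverse of the enumeration.\<close>
    also have "\<dots> = {(\<lambda>c j. \<Sum>i<r. u i * \<xi> i x c j) |u. u \<in> cspace r}"
    proof (intro equalityI subsetI)
      fix w assume "w \<in> {(\<lambda>c j. \<Sum>i<r. a (\<xi> i) * \<xi> i x c j) |a. True}"
      then obtain a where "w = (\<lambda>c j. \<Sum>i<r. a (\<xi> i) * \<xi> i x c j)" by blast
      then show "w \<in> {(\<lambda>c j. \<Sum>i<r. u i * \<xi> i x c j) |u. u \<in> cspace r}"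
        by (intro CollectI exI [of _ "\<lambda>i. if i < r then a (\<xi> i) else 0"]) (simp add: cspace_def)
    next
      fix w assume "w \<in> {(\<lambda>c j. \<Sum>i<r. u i * \<xi> i x c j) |u. u \<in> cspace r}"
      then obtain u where "w = (\<lambda>c j. \<Sum>i<r. u i * \<xi> i x c j)" by blast
      moreover have "inv_into {..<r} \<xi> (\<xi> i) = i" if "i < r" for i
        using bij that by (intro inv_into_f_f) (auto simp: bij_betw_def)
      ultimately show "w \<in> {(\<lambda>c j. \<Sum>i<r. a (\<xi> i) * \<xi> i x c j) |a. True}"
        by (intro CollectI exI [of _ "\<lambda>\<eta>. u (inv_into {..<r} \<xi> \<eta>)"]) simp
    qed
    finally show "tangent_space X x = {(\<lambda>c j. \<Sum>i<r. u i * \<xi> i x c j) |u. u \<in> cspace r}" .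
  qed
  ultimately show ?thesis unfolding G_elliptic_def by blast
qed

end
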